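(* Fix an integer $k\ge 1$, vertex-weights $r_1,\dots,r_k>0$ with $\sum_{i=1}^k r_i=1$, and a symmetric $k\times k$ matrix $\mathbf{P}=(p_{ij})$ of rank $k$ with entries $0\le p_{ij}\le 1$; let $H$ be the corresponding model graph on $k$ vertices. Let $(G_n)$ be a generalized random graph sequence on the model graph $H$ (defined in the context), with random vertex-classes $U_1,\dots,U_k$ of sizes $n_1,\dots,n_k$, so that $n_i/n\to r_i$ as $n\to\infty$ (strong balancing condition). Let $\mathbf{A}_n=(a^{(n)}_{uv})$ be the adjacency matrix and $\mathbf{M}_{D,n}$ the normalized modularity matrix of $G_n$. Then, as $n\to\infty$, the following hold almost surely: (0) $G_n\to W_H$, i.e. for every simple graph $F$, $\hom(F,G_n)/n^{|V(F)|}\to \hom(F,H)$. (1) $\mathbf{A}_n$ has exactly $k$ eigenvalues that are $\Theta(n)$, while the remaining eigenvalues are $O(\sqrt n)$ in absolute value; moreover the $k$-variance $S^2_{k,n}$ of the $k$-dimensional vertex representatives, built from eigenvectors of these $k$ eigenvalues of $\mathbf{A}_n$, is $O(1/n)$. (2) There is a constant $0<\delta<1$ independent of $n$ (depending only on $k$) such that $\mathbf{M}_{D,n}$ has exactly $k-1$ eigenvalues of absolute value greater than $\delta$, while all other eigenvalues are $O(n^{-\tau})$ for every $0<\tau<\frac12$; moreover the weighted $k$-variance $\tilde S^2_{k,n}$ of the $(k-1)$-dimensional vertex representatives built from the transformed eigenvectors of these $k-1$ eigenvalues of $\mathbf{M}_{D,n}$ is $O(n^{-2\tau})$ for every $0<\tau<\frac12$.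 (3) There is a constant $0<\theta<1$ independent of $n$ such that $\mathrm{md}_1(G_n)>\theta,\dots,\mathrm{md}_{k-1}(G_n)>\theta$, and $\mathrm{md}(G_n;U_1,\dots,U_k)=O(n^{-\tau})$ for every $0<\tau<\frac12$. (4) For every $1\le i\le j\le k$ and every $u\in U_i$, $N_1(u;U_j):=\sum_{v\in U_j}a^{(n)}_{uv}=p_{ij}n_j+o(n)$; and for every $1\le i\le j\le k$ and $u,v\in U_i$, $u\ne v$, $N_2(u,v;U_j):=\sum_{t\in U_j}a^{(n)}_{ut}a^{(n)}_{vt}=p_{ij}^2 n_j+o(n)$.
   Context: Generalized random graph on $H$: $G_n$ has $n$ vertices; each vertex $v$ independently receives a cluster label $c_v\in\{1,\dots,k\}$ with $\Pr(c_v=i)=r_i$; given the labels, each pair $u\ne v$ is joined independently with probability $p_{c_uc_v}$. $U_i=\{v:c_v=i\}$, $n_i=|U_i|$. Homomorphism densities: $\hom(F,G)$ is the number of homomorphisms $F\to G$; $\hom(F,H)=\sum_{\psi:V(F)\to V(H)}\prod_{i\in V(F)}r_{\psi(i)}\prod_{ij\in E(F)}p_{\psi(i)\psi(j)}$; $W_H$ is the step-function graphon taking value $p_{ij}$ on $I_i\times I_j$ where $[0,1]$ is split into consecutive intervals $I_i$ of lengths $r_i$. For a graph with (weighted) adjacency matrix $\mathbf{A}$ scaled so that its entries sum to 1, degrees $d_i=\sum_j a_{ij}$, $\mathbf{D}=\mathrm{diag}(d_1,\dots,d_n)$, $\sqrt{\mathbf d}=(\sqrt{d_1},\dots,\sqrt{d_n})^T$: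 the normalized modularity matrix is $\mathbf{M}_D=\mathbf{D}^{-1/2}\mathbf{A}\mathbf{D}^{-1/2}-\sqrt{\mathbf d}\sqrt{\mathbf d}^T$ (unchanged by rescaling $\mathbf{A}$). For $X,Y\subseteq V$: $a(X,Y)=\sum_{i\in X,j\in Y}a_{ij}$, $\mathrm{Vol}(X)=\sum_{i\in X}d_i$, $\rho(X,Y)=a(X,Y)/(\mathrm{Vol}(X)\mathrm{Vol}(Y))$. For a partition $U_1,\dots,U_k$ of $V$ into nonempty parts, $\mathrm{md}(G;U_1,\dots,U_k)=\max_{1\le i\le j\le k}\max_{X\subseteq U_i,Y\subseteq U_j}|\rho(X,Y)-\rho(U_i,U_j)|\sqrt{\mathrm{Vol}(X)\mathrm{Vol}(Y)}$, and $\mathrm{md}_k(G)$ is the minimum of this over all partitions of $V$ into $k$ nonempty parts. $k$-variance: if $\mathbf{r}_v\in\mathbb R^k$ are the rows of the $n\times k$ matrix whose columns are orthonormal eigenvectors of the chosen $k$ eigenvalues of $\mathbf{A}$, then $S_k^2=\min_{(U_1,\dots,U_k)}\sum_{i=1}^k\sum_{v\in U_i}\|\mathbf r_v-\mathbf c_i\|^2$ with $\mathbf c_i=\frac1{|U_i|}\sum_{v\in U_i}\mathbf r_v$. Weighted $k$-variance: if $\mathbf u_1,\dots,\mathbf u_{k-1}$ are orthonormal eigenvectors of the chosen $k-1$ eigenvalues of $\mathbf{M}_D$ and $\mathbf r_v\in\mathbb R^{k-1}$ are the rows of the matrix with columns $\mathbf D^{-1/2}\mathbf u_1,\dots,\mathbf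 D^{-1/2}\mathbf u_{k-1}$, then $\tilde S_k^2=\min_{(U_1,\dots,U_k)}\sum_{i=1}^k\sum_{v\in U_i}d_v\|\mathbf r_v-\mathbf c_i\|^2$ with $\mathbf c_i=\frac1{\mathrm{Vol}(U_i)}\sum_{v\in U_i}d_v\mathbf r_v$; minima are over partitions into $k$ nonempty parts.
   Formalization: In (2) the constant δ is independent of n but may depend on r and P as well as k: a δ depending only on k does not exist (k=2, r=(1/2,1/2), p11=p22=1/2+e, p12=1/2 gives the eigenvalue limit e/(1+e), arbitrarily small). *)

theory Defs
  imports
    "HOL-Probability.Probability"
    "HOL-Library.Disjoint_Sets"
    "Jordan_Normal_Form.Char_Poly"
    "Jordan_Normal_Form.DL_Rank"
begin

(* Vertices are {..<n} and clusters are {..<k}, matching the 0-based matrix indices.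
   A simple graph is a finite vertex set with a symmetric irreflexive set of pairs. *)

definition simple_graph :: "nat set \<Rightarrow> (nat \<times> nat) set \<Rightarrow> bool" where
  "simple_graph V E \<longleftrightarrow> finite V \<and> E \<subseteq> V \<times> V \<and> sym E \<and> irrefl E"

definition hom_count ::
    "nat set \<Rightarrow> (nat \<times> nat) set \<Rightarrow> nat set \<Rightarrow> (nat \<times> nat) set \<Rightarrow> nat" where
  "hom_count VF EF V E = card {\<phi> \<in> VF \<rightarrow>\<^sub>E V. \<forall>(i, j) \<in> EF. (\<phi> i, \<phi> j) \<in> E}"

(* The restriction i < j makes each undirected edge contribute one factor. *)
definition hom_model ::
    "nat set \<Rightarrow> (nat \<times> nat) set \<Rightarrow> nat \<Rightarrow> (nat \<Rightarrow> real) \<Rightarrow> real mat \<Rightarrow> real" where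
  "hom_model VF EF k r P =
     (\<Sum>\<psi> \<in> VF \<rightarrow>\<^sub>E {..<k}.
        (\<Prod>i\<in>VF. r (\<psi> i)) * (\<Prod>(i, j) \<in> {(i, j) \<in> EF. i < j}. P $$ (\<psi> i, \<psi> j)))"


(* Only meaningful when r is nonnegative on {..<k} with sum 1. *)
definition label_pmf :: "nat \<Rightarrow> (nat \<Rightarrow> real) \<Rightarrow> nat pmf" where
  "label_pmf k r = embed_pmf (\<lambda>i. if i < k then r i else 0)"

(* Joint law of the labelling and the edge set: independent labels, then one independent
   Bernoulli variable for each pair u < v, symmetrised to an edge relation. *)
definition random_graph_pmf ::
    "nat \<Rightarrow> nat \<Rightarrow> (nat \<Rightarrow> real) \<Rightarrow> real mat \<Rightarrow> ((nat \<Rightarrow> nat) \<times> (nat \<times> nat) set) pmf" where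
  "random_graph_pmf n k r P =
     bind_pmf (Pi_pmf {..<n} 0 (\<lambda>_. label_pmf k r)) (\<lambda>c.
       map_pmf (\<lambda>b. (c, {(u, v). b (u, v) \<or> b (v, u)}))
         (Pi_pmf {(u, v). u < v \<and> v < n} False (\<lambda>(u, v). bernoulli_pmf (P $$ (c u, c v)))))"

(* Only the law of each single G_n is prescribed; the joint law of (G_n) is arbitrary. *)
definition generalized_random_graph_sequence ::
    "'a measure \<Rightarrow> nat \<Rightarrow> (nat \<Rightarrow> real) \<Rightarrow> real mat \<Rightarrow>
     (nat \<Rightarrow> 'a \<Rightarrow> nat \<Rightarrow> nat) \<Rightarrow> (nat \<Rightarrow> 'a \<Rightarrow> (nat \<times> nat) set) \<Rightarrow> bool" where
  "generalized_random_graph_sequence M k r P c E \<longleftrightarrow>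
     prob_space M \<and>
     (\<forall>n. (\<lambda>\<omega>. (c n \<omega>, E n \<omega>)) \<in> measurable M (count_space UNIV) \<and>
          distr M (count_space UNIV) (\<lambda>\<omega>. (c n \<omega>, E n \<omega>)) = measure_pmf (random_graph_pmf n k r P))"

definition cluster :: "nat \<Rightarrow> (nat \<Rightarrow> nat) \<Rightarrow> nat \<Rightarrow> nat set" where
  "cluster n c i = {v. v < n \<and> c v = i}"


definition adjacency_matrix :: "nat \<Rightarrow> (nat \<times> nat) set \<Rightarrow> real mat" where
  "adjacency_matrix n E = Matrix.mat n n (\<lambda>(u, v). if (u, v) \<in> E then 1 else 0)"

(* Entries scaled to sum to 1; the zero matrix is left unchanged because x / 0 = 0. *)
definition scaled_mat :: "real mat \<Rightarrow> real mat" where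
  "scaled_mat A = (1 / (\<Sum>i<dim_row A. \<Sum>j<dim_col A. A $$ (i, j))) \<cdot>\<^sub>m A"

definition deg :: "real mat \<Rightarrow> nat \<Rightarrow> real" where
  "deg A i = (\<Sum>j<dim_col A. A $$ (i, j))"

definition inv_sqrt_deg :: "real mat \<Rightarrow> real mat" where
  "inv_sqrt_deg A = mat_diag (dim_row A) (\<lambda>i. 1 / sqrt (deg A i))"

definition normalized_modularity :: "real mat \<Rightarrow> real mat" where
  "normalized_modularity A0 =
     (let A = scaled_mat A0; n = dim_row A in
      inv_sqrt_deg A * A * inv_sqrt_deg A - Matrix.mat n n (\<lambda>(i, j). sqrt (deg A i) * sqrt (deg A j)))"

(* Real eigenvalues with multiplicity; for symmetric real matrices these are all of them. *)
definition eigvals_mset :: "real mat \<Rightarrow> real multiset" where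
  "eigvals_mset A = proots (char_poly A)"

(* us is an orthonormal family of eigenvectors whose eigenvalues, with multiplicity, are L. *)
definition orthonormal_eigenvectors :: "real mat \<Rightarrow> real multiset \<Rightarrow> real Matrix.vec list \<Rightarrow> bool" where
  "orthonormal_eigenvectors A L us \<longleftrightarrow>
     (\<exists>ls. mset ls = L \<and> length us = length ls \<and>
           (\<forall>i<length us. eigenvector A (us ! i) (ls ! i)) \<and>
           (\<forall>i<length us. \<forall>j<length us. scalar_prod (us ! i) (us ! j) = (if i = j then 1 else 0)))"


definition parts_of :: "nat \<Rightarrow> nat \<Rightarrow> nat set set set" where
  "parts_of n k = {Q. partition_on {..<n} Q \<and> card Q = k}"

definition centroid :: "(nat \<Rightarrow> real) \<Rightarrow> real mat \<Rightarrow> nat set \<Rightarrow> real Matrix.vec" where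
  "centroid w R X = Matrix.vec (dim_col R) (\<lambda>j. (\<Sum>v\<in>X. w v * R $$ (v, j)) / (\<Sum>v\<in>X. w v))"

definition min_variance :: "nat \<Rightarrow> (nat \<Rightarrow> real) \<Rightarrow> real mat \<Rightarrow> real" where
  "min_variance k w R =
     Min ((\<lambda>Q. \<Sum>X\<in>Q. \<Sum>v\<in>X.
            w v * scalar_prod (Matrix.row R v - centroid w R X) (Matrix.row R v - centroid w R X))
          ` parts_of (dim_row R) k)"

definition k_variance :: "nat \<Rightarrow> nat \<Rightarrow> real Matrix.vec list \<Rightarrow> real" where
  "k_variance k n us = min_variance k (\<lambda>_. 1) (mat_of_cols n us)"

definition weighted_k_variance :: "nat \<Rightarrow> real mat \<Rightarrow> real Matrix.vec list \<Rightarrow> real" where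
  "weighted_k_variance k A0 us =
     (let A = scaled_mat A0 in
      min_variance k (deg A) (inv_sqrt_deg A * mat_of_cols (dim_row A) us))"


definition cut_weight :: "real mat \<Rightarrow> nat set \<Rightarrow> nat set \<Rightarrow> real" where
  "cut_weight A X Y = (\<Sum>i\<in>X. \<Sum>j\<in>Y. A $$ (i, j))"

definition Vol :: "real mat \<Rightarrow> nat set \<Rightarrow> real" where
  "Vol A X = (\<Sum>i\<in>X. deg A i)"

definition rho :: "real mat \<Rightarrow> nat set \<Rightarrow> nat set \<Rightarrow> real" where
  "rho A X Y = cut_weight A X Y / (Vol A X * Vol A Y)"

(* Q is the unordered collection of classes: the discrepancy of a pair of classes is symmetric
   in the pair, so ordered pairs from Q give the same maximum as indices i <= j. Sets X or Y of
   volume zero contribute 0. *)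
definition md :: "real mat \<Rightarrow> nat set set \<Rightarrow> real" where
  "md A0 Q =
     (let A = scaled_mat A0 in
      Max {\<bar>rho A X Y - rho A B C\<bar> * sqrt (Vol A X * Vol A Y) | B C X Y.
             B \<in> Q \<and> C \<in> Q \<and> X \<subseteq> B \<and> Y \<subseteq> C})"

definition md_min :: "nat \<Rightarrow> real mat \<Rightarrow> real" where
  "md_min m A0 = Min (md A0 ` parts_of (dim_row A0) m)"

end

theory Submission
  imports Defs "Jordan_Normal_Form.Spectral_Radius" "HOL-Real_Asymp.Real_Asymp"
begin

text \<open>
Write \<open>A\<close> for the adjacency matrix and \<open>B\<close> for the block matrix with entries \<open>p(c\<^sub>u, c\<^sub>v)\<close>.
Hoeffding's inequality and a union bound over lattice points give \<open>\<parallel>A - B\<parallel> \<le> 15 \<surd>n\<close>, together with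
uniform control of degrees and codegrees, outside an event of summable probability; by Borel--Cantelli
this holds almost surely for all large \<open>n\<close>, whatever the joint law. All claims then follow
deterministically. The matrix \<open>B\<close> has rank \<open>k\<close>, vanishes on vectors orthogonal to the class indicators and is
bounded below by a multiple of \<open>n\<close> on step vectors, so comparing dimensions of subspaces locates the
eigenvalues of \<open>A\<close>; the same argument with the weights \<open>1 / \<surd>d\<^sub>v\<close> handles the modularity matrix, whose kernel
contains \<open>\<surd>d\<close>. An eigenvector \<open>u = (B u + (A - B) u) / \<lambda>\<close> is a step vector up to a small error, which
bounds the \<open>k\<close>-variances. A partition into fewer than \<open>k\<close> classes with small discrepancy would
make two rows of \<open>P\<close> nearly proportional.
Homomorphism counts are compared by exchanging the edges of \<open>F\<close> one at a time.
\<close>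

section \<open>The spectral theorem for real symmetric matrices\<close>

text \<open>Full rank enters through one number: \<open>p0\<close> bounds \<open>P\<close> from
  below in the Euclidean norm. With the least class weight it determines \<open>\<kappa>\<close>,
  \<open>\<sigma>\<close>, \<open>\<delta>\<close> and \<open>\<theta>\<close>, all before a
  probability space is chosen, so the thresholds are uniform in the sample path. The structural
  eigenvalues may be multiple and the orthonormal eigenvectors are arbitrary, so eigenvectors of
  \<open>A\<close> are never matched with those of \<open>B\<close>: each is treated alone through
  its own equation. That needs a lower bound on its eigenvalue, but no gap between structural
  eigenvalues. Closeness of \<open>A\<close> to \<open>B\<close> is kept as a bound on a bilinear
  form. Evaluated at eigenvectors, at indicators of sets or at partial products of edge factors, it
  yields the spectra, the discrepancy and the homomorphism densities. Only vertexwise statements and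
  class sizes need separate tail bounds. Those use deviations \<open>n powr (3/4)\<close>: this is
  \<open>o(n)\<close>, while Hoeffding's exponent \<open>t\<^sup>2 / n\<close> is still
  \<open>sqrt n\<close> and beats the polynomially many events of the union bound.\<close>

lemma symmetric_real_mat_has_eigenvector:
  fixes A :: "real mat"
  assumes A: "A \<in> carrier_mat n n" and sym: "transpose_mat A = A" and n: "n > 0"
  shows "\<exists>v e. eigenvector A v e"
proof -
  let ?C = "map_mat complex_of_real A"
  have C: "?C \<in> carrier_mat n n" using A by auto
  from spectrum_non_empty[OF C n] obtain l where "eigenvalue ?C l"
    by (auto simp: spectrum_def)
  then obtain w where w: "w \<in> carrier_vec n" "w \<noteq> 0\<^sub>v n" "?C *\<^sub>v w = l \<cdot>\<^sub>v w"
    using C unfolding eigenvalue_def eigenvector_def by auto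
  define x where "x i = Re (w $ i)" for i
  define y where "y i = Im (w $ i)" for i
  have sA: "A $$ (i,j) = A $$ (j,i)" if "i < n" "j < n" for i j
    using arg_cong[OF sym, of "\<lambda>B. B $$ (i,j)"] that A by auto
  have ev: "(\<Sum>j<n. complex_of_real (A $$ (i,j)) * w $ j) = l * w $ i" if "i < n" for i
    using arg_cong[OF w(3), of "\<lambda>v. v $ i"] that A w(1)
    by (auto simp: scalar_prod_def lessThan_atLeast0)
  have re: "(\<Sum>j<n. A $$ (i,j) * x j) = Re l * x i - Im l * y i" if "i < n" for i
    using arg_cong[OF ev[OF that], of Re] by (simp add: x_def y_def)
  have im: "(\<Sum>j<n. A $$ (i,j) * y j) = Re l * y i + Im l * x i" if "i < n" for i
    using arg_cong[OF ev[OF that], of Im] by (simp add: x_def y_def)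
  \<comment> \<open>With \<open>w = x + i y\<close>, symmetry equates the two mixed forms of
    \<open>x\<close> and \<open>y\<close>. Their difference is \<open>Im l\<close> times the squared
    norm of \<open>w\<close>, so \<open>l\<close> is real and whichever of \<open>x\<close>,
    \<open>y\<close> is nonzero is a real eigenvector.\<close>
  have "(\<Sum>i<n. y i * (\<Sum>j<n. A $$ (i,j) * x j)) = (\<Sum>i<n. \<Sum>j<n. A $$ (i,j) * y i * x j)"
    by (simp add: sum_distrib_left mult_ac)
  also have "\<dots> = (\<Sum>j<n. \<Sum>i<n. A $$ (j,i) * y i * x j)"
    by (subst sum.swap, intro sum.cong refl) (simp add: sA)
  also have "\<dots> = (\<Sum>i<n. x i * (\<Sum>j<n. A $$ (i,j) * y j))"
    by (simp add: sum_distrib_left mult_ac)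
  finally have "(\<Sum>i<n. y i * (Re l * x i - Im l * y i)) = (\<Sum>i<n. x i * (Re l * y i + Im l * x i))"
    by (simp add: re im)
  hence "(\<Sum>i<n. Im l * ((x i)\<^sup>2 + (y i)\<^sup>2)) = 0"
    by (simp add: algebra_simps sum.distrib sum_subtractf power2_eq_square flip: sum_distrib_left)
  hence *: "Im l * (\<Sum>i<n. (x i)\<^sup>2 + (y i)\<^sup>2) = 0" unfolding sum_distrib_left .
  obtain i0 where i0: "i0 < n" "w $ i0 \<noteq> 0"
    using w(1,2) by (metis carrier_vecD eq_vecI index_zero_vec)
  hence "0 < (x i0)\<^sup>2 + (y i0)\<^sup>2"
    by (auto simp: x_def y_def complex_eq_iff sum_power2_gt_zero_iff)
  also have "\<dots> \<le> (\<Sum>i<n. (x i)\<^sup>2 + (y i)\<^sup>2)"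
    using i0 by (intro member_le_sum) auto
  finally have im0: "Im l = 0" using * by simp
  have "eigenvector A (Matrix.vec n x) (Re l)" if "x i0 \<noteq> 0"
    unfolding eigenvector_def using A i0 that
    by (auto intro!: eq_vecI simp: scalar_prod_def lessThan_atLeast0[symmetric] re im0
        dest!: arg_cong[where f="\<lambda>v. v $ i0"])
  moreover have "eigenvector A (Matrix.vec n y) (Re l)" if "y i0 \<noteq> 0"
    unfolding eigenvector_def using A i0 that
    by (auto intro!: eq_vecI simp: scalar_prod_def lessThan_atLeast0[symmetric] im im0
        dest!: arg_cong[where f="\<lambda>v. v $ i0"])
  moreover have "x i0 \<noteq> 0 \<or> y i0 \<noteq> 0"
    using i0(2) by (auto simp: x_def y_def complex_eq_iff)
  ultimately show ?thesis by blast
qed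

text \<open>The matrix is the Householder reflection exchanging \<open>v\<close> with the first unit vector.\<close>

lemma orthogonal_symmetric_mat_with_first_column:
  fixes v :: "real Matrix.vec"
  assumes v: "v \<in> carrier_vec n" "v \<bullet> v = 1" and n: "n > 0"
  shows "\<exists>H \<in> carrier_mat n n. transpose_mat H = H \<and> H * H = 1\<^sub>m n \<and> col H 0 = v"
proof (cases "v = unit_vec n 0")
  \<comment> \<open>The reflection vector \<open>w\<close> would vanish here, so the identity takes
    its place.\<close>
  case True
  show ?thesis
    by (rule bexI[of _ "1\<^sub>m n"]) (use True n in auto)
next
  case False
  define w where "w i = v $ i - (if i = 0 then 1 else 0)" for i
  define s where "s = (\<Sum>i<n. (w i)\<^sup>2)"
  define H where "H = Matrix.mat n n (\<lambda>(i,j). (if i = j then 1 else 0) - 2 / s * w i * w j)"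
  have vv: "(\<Sum>i<n. (v $ i)\<^sup>2) = 1"
    using v by (simp add: scalar_prod_def lessThan_atLeast0 power2_eq_square)
  have "s = (\<Sum>i<n. (v $ i)\<^sup>2) + (\<Sum>i<n. (if i = 0 then 1 else 0)) - 2 * (\<Sum>i<n. (if i = 0 then v $ i else 0))"
    unfolding s_def w_def sum_distrib_left sum_subtractf[symmetric] sum.distrib[symmetric]
    by (intro sum.cong) (auto simp: power2_eq_square algebra_simps)
  hence s: "s = 2 - 2 * v $ 0" using n by (simp add: vv)
  have "s \<noteq> 0"
  proof
    assume "s = 0"
    hence "\<forall>i<n. w i = 0" unfolding s_def by (subst (asm) sum_nonneg_eq_0_iff) auto
    hence "v = unit_vec n 0" using v by (intro eq_vecI) (auto simp: w_def)
    with False show False by simp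
  qed
  have "(H * H) $$ (i,j) = (if i = j then 1 else 0)" if ij: "i < n" "j < n" for i j
  proof -
    have "(H * H) $$ (i,j) = (\<Sum>l<n. ((if i = l then 1 else 0) - 2 / s * w i * w l)
         * ((if l = j then 1 else 0) - 2 / s * w l * w j))"
      using ij by (simp add: H_def scalar_prod_def lessThan_atLeast0)
    also have "\<dots> = (\<Sum>l<n. (if l = i then (if i = j then 1 else 0) else 0) - (if l = i then 2 / s * w i * w j else 0)
        - (if l = j then 2 / s * w i * w j else 0) + 4 / s / s * w i * w j * (w l)\<^sup>2)"
      by (intro sum.cong) (auto simp: algebra_simps power2_eq_square)
    also have "\<dots> = (if i = j then 1 else 0) - 2 / s * w i * w j - 2 / s * w i * w j
         + 4 / s / s * w i * w j * s"
      using ij by (simp add: sum.distrib sum_subtractf s_def sum_distrib_left)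
    also have "\<dots> = (if i = j then 1 else 0)" using \<open>s \<noteq> 0\<close> by simp
    finally show ?thesis .
  qed
  hence HH: "H * H = 1\<^sub>m n" by (intro eq_matI) (auto simp: H_def)
  have "col H 0 = v"
  proof (rule eq_vecI)
    fix i assume "i < dim_vec v"
    hence i: "i < n" using v by simp
    have "col H 0 $ i = (if i = 0 then 1 else 0) - 2 / s * w i * (v $ 0 - 1)"
      using i n by (simp add: H_def w_def)
    also have "\<dots> = (if i = 0 then 1 else 0) + w i * (s / s)"
      unfolding s by (simp add: field_simps)
    also have "\<dots> = v $ i" using \<open>s \<noteq> 0\<close> by (simp add: w_def)
    finally show "col H 0 $ i = v $ i" .
  qed (use v in \<open>simp add: H_def\<close>)
  moreover have "transpose_mat H = H" by (intro eq_matI) (auto simp: H_def mult_ac)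
  ultimately show ?thesis using HH by (intro bexI[of _ H]) (auto simp: H_def)
qed

text \<open>Induction by deflation: a reflection \<open>H\<close> carries a unit eigenvector to the
  first basis vector. By symmetry the first row of \<open>H * A * H\<close> vanishes along with the
  first column, and a symmetric block of size \<open>n\<close> remains.\<close>

lemma spectral_theorem_mat:
  fixes A :: "real mat"
  assumes "A \<in> carrier_mat n n" "transpose_mat A = A"
  shows "\<exists>Q f. Q \<in> carrier_mat n n \<and> transpose_mat Q * Q = 1\<^sub>m n \<and>
    transpose_mat Q * A * Q = mat_diag n f"
  using assms
proof (induction n arbitrary: A)
  case 0
  have 1: "A = mat_diag 0 (\<lambda>_. 0)" by (rule eq_matI) (use 0 in \<open>auto simp: mat_diag_def\<close>)
  have 2: "transpose_mat (1\<^sub>m 0) * A * 1\<^sub>m 0 = A" using 0 by (simp add: transpose_one)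
  have 3: "transpose_mat (1\<^sub>m 0) * 1\<^sub>m 0 = (1\<^sub>m 0 :: real mat)" by (simp add: transpose_one)
  show ?case
    by (rule exI[of _ "1\<^sub>m 0"], rule exI[of _ "\<lambda>_. 0"], intro conjI one_carrier_mat 3 trans[OF 2 1])
next
  case (Suc n A)
  note A = Suc.prems(1)
  obtain v0 e where ev: "eigenvector A v0 e"
    using symmetric_real_mat_has_eigenvector[OF Suc.prems] by auto
  hence v0: "v0 \<in> carrier_vec (Suc n)" "v0 \<noteq> 0\<^sub>v (Suc n)" "A *\<^sub>v v0 = e \<cdot>\<^sub>v v0"
    using A by (auto simp: eigenvector_def)
  have pos: "v0 \<bullet> v0 > 0"
    using v0 conjugate_square_greater_0_vec[of v0 "Suc n"] by simp
  define v where "v = (1 / sqrt (v0 \<bullet> v0)) \<cdot>\<^sub>v v0"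
  have v: "v \<in> carrier_vec (Suc n)" "A *\<^sub>v v = e \<cdot>\<^sub>v v"
    using v0 A by (auto simp: v_def mult_mat_vec smult_smult_assoc mult.commute)
  have vv: "v \<bullet> v = 1"
    using pos v0(1) by (simp add: v_def)
  obtain H where H: "H \<in> carrier_mat (Suc n) (Suc n)" "transpose_mat H = H"
      "H * H = 1\<^sub>m (Suc n)" "col H 0 = v"
    using orthogonal_symmetric_mat_with_first_column[OF v(1) vv] by auto
  define B where "B = H * A * H"
  have B: "B \<in> carrier_mat (Suc n) (Suc n)" using H A by (auto simp: B_def)
  have symB: "transpose_mat B = B"
    unfolding B_def using transpose_mult[OF mult_carrier_mat[OF H(1) A] H(1)]
      transpose_mult[OF H(1) A] assoc_mult_mat[OF H(1) A H(1)] H(2) Suc.prems(2) by simp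
  have "col B 0 = H *\<^sub>v (A *\<^sub>v col H 0)"
    unfolding B_def assoc_mult_mat[OF H(1) A H(1)]
    using col_mult2[OF H(1) mult_carrier_mat[OF A H(1)], of 0] col_mult2[OF A H(1), of 0] by simp
  also have "\<dots> = e \<cdot>\<^sub>v (H *\<^sub>v col H 0)" using H v by (simp add: mult_mat_vec)
  also have "H *\<^sub>v col H 0 = col (H * H) 0" using col_mult2[OF H(1) H(1), of 0] by simp
  also have "\<dots> = unit_vec (Suc n) 0" using H(3) by simp
  finally have colB: "col B 0 = e \<cdot>\<^sub>v unit_vec (Suc n) 0" .
  have B0: "B $$ (i,0) = (if i = 0 then e else 0)" if "i < Suc n" for i
    using arg_cong[OF colB, of "\<lambda>v. v $ i"] that B by auto
  have B0': "B $$ (0,i) = (if i = 0 then e else 0)" if "i < Suc n" for i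
    using arg_cong[OF symB, of "\<lambda>M. M $$ (i,0)"] B0[OF that] that B by auto
  define A' where "A' = Matrix.mat n n (\<lambda>(i,j). B $$ (Suc i, Suc j))"
  have A': "A' \<in> carrier_mat n n" by (simp add: A'_def)
  have "B $$ (i,j) = B $$ (j,i)" if "i < Suc n" "j < Suc n" for i j
    using arg_cong[OF symB, of "\<lambda>M. M $$ (i,j)"] that B by auto
  hence symA': "transpose_mat A' = A'" by (intro eq_matI) (auto simp: A'_def)
  define E where "E = Matrix.mat 1 1 (\<lambda>_. e)"
  have E: "E \<in> carrier_mat 1 1" by (simp add: E_def)
  have Bblock: "B = four_block_mat E (0\<^sub>m 1 n) (0\<^sub>m n 1) A'"
  proof (rule eq_matI)
    fix i j assume "i < dim_row (four_block_mat E (0\<^sub>m 1 n) (0\<^sub>m n 1) A')"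
      "j < dim_col (four_block_mat E (0\<^sub>m 1 n) (0\<^sub>m n 1) A')"
    hence "i < Suc n" "j < Suc n" using A' E by auto
    thus "B $$ (i, j) = four_block_mat E (0\<^sub>m 1 n) (0\<^sub>m n 1) A' $$ (i, j)"
      using E A' B0 B0' by (cases i; cases j) (auto simp: E_def A'_def)
  qed (use A' E B in auto)
  obtain Q' f where Q': "Q' \<in> carrier_mat n n" "transpose_mat Q' * Q' = 1\<^sub>m n"
      "transpose_mat Q' * A' * Q' = mat_diag n f"
    using Suc.IH[OF A' symA'] by auto
  define R where "R = four_block_mat (1\<^sub>m 1) (0\<^sub>m 1 n) (0\<^sub>m n 1) Q'"
  have R: "R \<in> carrier_mat (Suc n) (Suc n)"
    unfolding R_def using four_block_carrier_mat[OF one_carrier_mat[of 1] Q'(1)] by simp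
  have RT: "transpose_mat R = four_block_mat (1\<^sub>m 1) (0\<^sub>m 1 n) (0\<^sub>m n 1) (transpose_mat Q')"
    unfolding R_def using Q'(1)
    by (subst transpose_four_block_mat) (auto simp: transpose_one)
  have Q'T: "transpose_mat Q' \<in> carrier_mat n n" using Q'(1) by auto
  have RR: "transpose_mat R * R = 1\<^sub>m (Suc n)"
    unfolding RT unfolding R_def
    by (subst mult_four_block_mat[OF one_carrier_mat zero_carrier_mat zero_carrier_mat Q'T
          one_carrier_mat zero_carrier_mat zero_carrier_mat Q'(1)])
      (use Q' Q'T in \<open>auto intro!: eq_matI\<close>)
  have "transpose_mat R * B = four_block_mat E (0\<^sub>m 1 n) (0\<^sub>m n 1) (transpose_mat Q' * A')"
    unfolding RT Bblock
    by (subst mult_four_block_mat[OF one_carrier_mat zero_carrier_mat zero_carrier_mat Q'T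
          E zero_carrier_mat zero_carrier_mat A'])
      (use Q' Q'T E A' in auto)
  hence "transpose_mat R * B * R = four_block_mat E (0\<^sub>m 1 n) (0\<^sub>m n 1) (mat_diag n f)"
    unfolding R_def
    by (simp only:, subst mult_four_block_mat[OF E zero_carrier_mat zero_carrier_mat mult_carrier_mat[OF Q'T A']
          one_carrier_mat zero_carrier_mat zero_carrier_mat Q'(1)])
      (use Q' Q'T E A' in auto)
  also have "\<dots> = mat_diag (Suc n) (\<lambda>i. if i = 0 then e else f (i - 1))"
    by (rule eq_matI) (auto simp: mat_diag_def E_def)
  finally have D: "transpose_mat R * B * R = mat_diag (Suc n) (\<lambda>i. if i = 0 then e else f (i - 1))" .
  define Q where "Q = H * R"
  have Q: "Q \<in> carrier_mat (Suc n) (Suc n)" using H R by (auto simp: Q_def)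
  have RTc: "transpose_mat R \<in> carrier_mat (Suc n) (Suc n)" using R by auto
  have QT: "transpose_mat Q = transpose_mat R * H" unfolding Q_def
    using transpose_mult[OF H(1) R] H(2) by simp
  have RTH: "transpose_mat R * H \<in> carrier_mat (Suc n) (Suc n)" using RTc H(1) by auto
  have "transpose_mat Q * Q = transpose_mat R * (H * H) * R"
    unfolding QT unfolding Q_def using assoc_mult_mat[OF RTH H(1) R] assoc_mult_mat[OF RTc H(1) H(1)]
    by simp
  hence "transpose_mat Q * Q = 1\<^sub>m (Suc n)" using H(3) RR RTc by simp
  moreover have "transpose_mat Q * A * Q = transpose_mat R * B * R"
    unfolding QT B_def unfolding Q_def
    using assoc_mult_mat[OF mult_carrier_mat[OF RTH A] H(1) R]
      assoc_mult_mat[OF RTc H(1) A] assoc_mult_mat[OF RTc mult_carrier_mat[OF H(1) A] H(1)]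
    by simp
  ultimately have "transpose_mat Q * A * Q = mat_diag (Suc n) (\<lambda>i. if i = 0 then e else f (i - 1))"
    "transpose_mat Q * Q = 1\<^sub>m (Suc n)" using D by auto
  thus ?case using Q by blast
qed

lemma proots_prod_linear_factors: "proots (\<Prod>a\<leftarrow>as. [:- a, 1:]) = mset (as :: real list)"
proof -
  have "0 \<notin> set (map (\<lambda>a. [:- a, 1:]) as)" by auto
  from proots_prod_list[OF this] show ?thesis
    by (simp add: o_def)
qed

text \<open>An orthogonal change of basis keeps the characteristic polynomial, so its roots with
  multiplicity are the diagonal entries. The last two facts are orthogonality of \<open>Q\<close>
  read along columns and along rows. Eigenvectors become plain functions, so that sums can be
  handled without carrier conditions.\<close>

lemma spectral_theorem:
  fixes A :: "real mat"
  assumes A: "A \<in> carrier_mat n n" and sym: "transpose_mat A = A"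
  obtains l :: "nat \<Rightarrow> real" and q :: "nat \<Rightarrow> nat \<Rightarrow> real"
  where "eigvals_mset A = image_mset l (mset_set {..<n})"
    and "\<And>i u. i < n \<Longrightarrow> u < n \<Longrightarrow> (\<Sum>v<n. A $$ (u,v) * q i v) = l i * q i u"
    and "\<And>i j. i < n \<Longrightarrow> j < n \<Longrightarrow> (\<Sum>v<n. q i v * q j v) = (if i = j then 1 else 0)"
    and "\<And>u v. u < n \<Longrightarrow> v < n \<Longrightarrow> (\<Sum>i<n. q i u * q i v) = (if u = v then 1 else 0)"
proof -
  obtain Q f where Q: "Q \<in> carrier_mat n n" "transpose_mat Q * Q = 1\<^sub>m n"
    "transpose_mat Q * A * Q = mat_diag n f"
    using spectral_theorem_mat[OF assms] by auto
  have QT: "transpose_mat Q \<in> carrier_mat n n" using Q by auto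
  have QQT: "Q * transpose_mat Q = 1\<^sub>m n"
    using mat_mult_left_right_inverse[OF QT Q(1,2)] .
  have "Q * (transpose_mat Q * A * Q) = (Q * transpose_mat Q) * (A * Q)"
    using assoc_mult_mat[OF QT A Q(1)] assoc_mult_mat[OF Q(1) QT mult_carrier_mat[OF A Q(1)]] by simp
  hence AQ: "A * Q = Q * mat_diag n f" using QQT Q(3) A Q(1) by simp
  have "similar_mat_wit (mat_diag n f) A (transpose_mat Q) Q"
    unfolding similar_mat_wit_def using A Q QT QQT mat_diag_dim[of n f] by (auto simp: Let_def mat_diag_def)
  hence "char_poly (mat_diag n f) = char_poly A"
    by (intro char_poly_similar) (auto simp: similar_mat_def)
  moreover have "char_poly (mat_diag n f) = (\<Prod>a\<leftarrow>diag_mat (mat_diag n f). [:- a, 1:])"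
    by (rule char_poly_upper_triangular[of _ n]) (auto simp: mat_diag_def)
  moreover have "diag_mat (mat_diag n f) = map f [0..<n]"
    unfolding diag_mat_def by (auto simp: mat_diag_def)
  ultimately have cp: "char_poly A = (\<Prod>a\<leftarrow>map f [0..<n]. [:- a, 1:])" by simp
  have "eigvals_mset A = mset (map f [0..<n])"
    unfolding eigvals_mset_def cp by (rule proots_prod_linear_factors)
  hence 1: "eigvals_mset A = image_mset f (mset_set {..<n})"
    by (simp add: lessThan_atLeast0)
  define q where "q i v = Q $$ (v,i)" for i v
  show thesis
  proof (rule that[OF 1, of q])
    fix i u assume iu: "i < n" "u < n"
    have "(A * Q) $$ (u,i) = (\<Sum>v<n. A $$ (u,v) * q i v)"
      using iu A Q(1) by (auto simp: scalar_prod_def q_def lessThan_atLeast0)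
    moreover have "(Q * mat_diag n f) $$ (u,i) = f i * q i u"
      using iu Q(1) by (subst mat_diag_mult_right[of _ n]) (auto simp: q_def)
    ultimately show "(\<Sum>v<n. A $$ (u,v) * q i v) = f i * q i u" using AQ by simp
  next
    fix i j assume ij: "i < n" "j < n"
    have "(transpose_mat Q * Q) $$ (i,j) = (\<Sum>v<n. q i v * q j v)"
      using ij Q(1) by (auto simp: scalar_prod_def q_def lessThan_atLeast0)
    thus "(\<Sum>v<n. q i v * q j v) = (if i = j then 1 else 0)" using ij Q(2) by simp
  next
    fix u v assume uv: "u < n" "v < n"
    have "(Q * transpose_mat Q) $$ (u,v) = (\<Sum>i<n. q i u * q i v)"
      using uv Q(1) by (auto simp: scalar_prod_def q_def lessThan_atLeast0)
    thus "(\<Sum>i<n. q i u * q i v) = (if u = v then 1 else 0)" using uv QQT by simp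
  qed
qed

section \<open>Counting large eigenvalues\<close>

abbreviation nrm :: "nat \<Rightarrow> (nat \<Rightarrow> real) \<Rightarrow> real" where
  "nrm n x \<equiv> L2_set x {..<n}"

definition inner_n :: "nat \<Rightarrow> (nat \<Rightarrow> real) \<Rightarrow> (nat \<Rightarrow> real) \<Rightarrow> real" where
  "inner_n n x y = (\<Sum>i<n. x i * y i)"

definition mvec :: "nat \<Rightarrow> (nat \<Rightarrow> nat \<Rightarrow> real) \<Rightarrow> (nat \<Rightarrow> real) \<Rightarrow> nat \<Rightarrow> real" where
  "mvec n W x u = (\<Sum>v<n. W u v * x v)"

text \<open>The operator norm as a bilinear bound: cuts and homomorphism sums test it at two
  different vectors. The explicit \<open>K \<ge> 0\<close> matters for \<open>n = 0\<close>, where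
  the inequality says nothing.\<close>

definition op_bounded :: "nat \<Rightarrow> (nat \<Rightarrow> nat \<Rightarrow> real) \<Rightarrow> real \<Rightarrow> bool" where
  "op_bounded n W K \<longleftrightarrow> K \<ge> 0 \<and>
     (\<forall>x y. \<bar>\<Sum>u<n. \<Sum>v<n. x u * W u v * y v\<bar> \<le> K * nrm n x * nrm n y)"

lemma nrm_sq: "(nrm n x)\<^sup>2 = (\<Sum>i<n. (x i)\<^sup>2)"
  by (simp add: L2_set_def sum_nonneg)

lemma nrm_sq_inner: "(nrm n x)\<^sup>2 = inner_n n x x"
  unfolding nrm_sq inner_n_def by (simp add: power2_eq_square)

lemma inner_n_commute: "inner_n n x y = inner_n n y x"
  by (simp add: inner_n_def mult.commute)

lemma abs_inner_n_le: "\<bar>inner_n n x y\<bar> \<le> nrm n x * nrm n y"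
proof -
  have "\<bar>inner_n n x y\<bar> \<le> (\<Sum>i<n. \<bar>x i\<bar> * \<bar>y i\<bar>)"
    unfolding inner_n_def by (rule order_trans[OF sum_abs]) (simp add: abs_mult)
  also have "\<dots> \<le> nrm n x * nrm n y" by (rule L2_set_mult_ineq)
  finally show ?thesis .
qed

lemma nrm_triangle: "nrm n (\<lambda>i. x i + y i) \<le> nrm n x + nrm n y"
  by (rule L2_set_triangle_ineq)

lemma nrm_scale: "nrm n (\<lambda>i. a * x i) = \<bar>a\<bar> * nrm n x"
  by (simp add: L2_set_def power_mult_distrib real_sqrt_mult flip: sum_distrib_left)

lemma nrm_triangle_sub: "nrm n (\<lambda>i. x i - y i) \<le> nrm n x + nrm n y"
  using nrm_triangle[of x "\<lambda>i. - y i" n] nrm_scale[of "-1" y n] by simp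

lemma nrm_cong: "(\<And>i. i < n \<Longrightarrow> x i = y i) \<Longrightarrow> nrm n x = nrm n y"
  by (rule L2_set_cong) auto

lemma nrm_leI: "(\<Sum>i<n. (x i)\<^sup>2) \<le> c\<^sup>2 \<Longrightarrow> c \<ge> 0 \<Longrightarrow> nrm n x \<le> c"
  unfolding L2_set_def using real_le_lsqrt sum_nonneg by (metis)

text \<open>Testing the form with \<open>W y\<close> on the left bounds the square of its norm, and
  one factor cancels.\<close>

lemma op_bounded_mvec:
  assumes "op_bounded n W K"
  shows "nrm n (mvec n W y) \<le> K * nrm n y"
proof (cases "nrm n (mvec n W y) = 0")
  case True
  thus ?thesis using assms by (simp add: op_bounded_def)
next
  case False
  have "(nrm n (mvec n W y))\<^sup>2 = (\<Sum>u<n. \<Sum>v<n. mvec n W y u * W u v * y v)"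
    unfolding nrm_sq by (intro sum.cong refl) (simp add: mvec_def power2_eq_square sum_distrib_left mult_ac)
  also have "\<dots> \<le> K * nrm n (mvec n W y) * nrm n y"
    using assms unfolding op_bounded_def by (meson abs_le_D1)
  finally have "nrm n (mvec n W y) * nrm n (mvec n W y) \<le> (K * nrm n y) * nrm n (mvec n W y)"
    by (simp add: power2_eq_square mult_ac)
  moreover have "nrm n (mvec n W y) > 0" using False L2_set_nonneg[of "mvec n W y" "{..<n}"] by linarith
  ultimately show ?thesis by simp
qed

lemma op_bounded_nonneg: "op_bounded n W K \<Longrightarrow> K \<ge> 0"
  by (simp add: op_bounded_def)

lemma op_boundedD: "op_bounded n W K \<Longrightarrow> \<bar>\<Sum>u<n. \<Sum>v<n. x u * W u v * y v\<bar> \<le> K * nrm n x * nrm n y"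
  by (simp add: op_bounded_def)

lemma inner_mvec: "inner_n n x (mvec n W y) = (\<Sum>u<n. \<Sum>v<n. x u * W u v * y v)"
  by (simp add: inner_n_def mvec_def sum_distrib_left mult_ac)

lemma inner_mvec_sym:
  assumes "\<And>u v. u < n \<Longrightarrow> v < n \<Longrightarrow> W u v = W v u"
  shows "inner_n n (mvec n W x) y = inner_n n x (mvec n W y)"
proof -
  have "inner_n n (mvec n W x) y = (\<Sum>u<n. \<Sum>v<n. y u * W u v * x v)"
    by (subst inner_n_commute) (rule inner_mvec)
  also have "\<dots> = (\<Sum>v<n. \<Sum>u<n. x v * W v u * y u)"
    by (subst sum.swap, intro sum.cong refl) (simp add: assms)
  finally show ?thesis by (simp add: inner_mvec)
qed

lemma inner_n_sum_right:
  "inner_n n x (\<lambda>v. \<Sum>s\<in>S. c s * q s v) = (\<Sum>s\<in>S. c s * inner_n n x (q s))"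
  unfolding inner_n_def sum_distrib_left
  by (subst sum.swap) (simp add: mult_ac)

lemma mvec_cong: "(\<And>i. i < n \<Longrightarrow> x i = y i) \<Longrightarrow> mvec n W x u = mvec n W y u"
  by (simp add: mvec_def)

lemma mvec_diff: "mvec n W (\<lambda>v. x v - y v) u = mvec n W x u - mvec n W y u"
  by (simp add: mvec_def algebra_simps sum_subtractf)

lemma mvec_scale: "mvec n W (\<lambda>v. a * x v) u = a * mvec n W x u"
  by (simp add: mvec_def sum_distrib_left mult_ac)

text \<open>Dimension counting enters the eigenvalue bounds only through this fact. Gaussian
  elimination: the pivot unknown \<open>p\<close> is removed from the first \<open>m\<close>
  equations and afterwards solved from equation \<open>m\<close>.\<close>

lemma homogeneous_system_nontrivial_solution:
  fixes a :: "nat \<Rightarrow> 'b \<Rightarrow> real"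
  assumes "finite S" "card S > m"
  shows "\<exists>x. (\<exists>s\<in>S. x s \<noteq> 0) \<and> (\<forall>j<m. (\<Sum>s\<in>S. a j s * x s) = 0)"
  using assms
proof (induction m arbitrary: S a)
  case 0
  hence "S \<noteq> {}" by auto
  thus ?case by (intro exI[of _ "\<lambda>_. 1"]) auto
next
  case (Suc m S a)
  show ?case
  proof (cases "\<forall>s\<in>S. a m s = 0")
    case True
    obtain x where "\<exists>s\<in>S. x s \<noteq> 0" "\<forall>j<m. (\<Sum>s\<in>S. a j s * x s) = 0"
      using Suc.IH[of S a] Suc.prems by auto
    thus ?thesis using True by (intro exI[of _ x]) (auto simp: less_Suc_eq)
  next
    case False
    then obtain p where p: "p \<in> S" "a m p \<noteq> 0" by auto
    define T where "T = S - {p}"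
    have T: "finite T" "p \<notin> T" "S = insert p T" "card T > m"
      using Suc.prems p by (auto simp: T_def)
    obtain x where x: "\<exists>s\<in>T. x s \<noteq> 0" "\<forall>j<m. (\<Sum>s\<in>T. (a j s - a j p * a m s / a m p) * x s) = 0"
      using Suc.IH[of T "\<lambda>j s. a j s - a j p * a m s / a m p"] T by auto
    define z where "z = - (\<Sum>s\<in>T. a m s * x s) / a m p"
    define y where "y = x(p := z)"
    have sumy: "(\<Sum>s\<in>S. a j s * y s) = a j p * z + (\<Sum>s\<in>T. a j s * x s)" for j
    proof -
      have "(\<Sum>s\<in>T. a j s * y s) = (\<Sum>s\<in>T. a j s * x s)"
        using T by (intro sum.cong) (auto simp: y_def)
      thus ?thesis using T by (simp add: y_def)
    qed
    have "(\<Sum>s\<in>S. a j s * y s) = 0" if "j < Suc m" for j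
    proof (cases "j = m")
      case True
      thus ?thesis using p by (simp add: sumy z_def)
    next
      case False
      hence "(\<Sum>s\<in>T. (a j s - a j p * a m s / a m p) * x s) = 0" using x that by auto
      moreover have "(\<Sum>s\<in>T. (a j s - a j p * a m s / a m p) * x s)
          = (\<Sum>s\<in>T. a j s * x s) + a j p * z"
        unfolding z_def
        by (simp add: algebra_simps sum_subtractf sum_distrib_left sum_divide_distrib)
      ultimately show ?thesis by (simp add: sumy)
    qed
    moreover have "\<exists>s\<in>S. y s \<noteq> 0" using x(1) T by (auto simp: y_def)
    ultimately show ?thesis by blast
  qed
qed

section \<open>Eigenvalue counts from test subspaces\<close>

locale spectral_basis =
  fixes n :: nat and W :: "nat \<Rightarrow> nat \<Rightarrow> real" and l :: "nat \<Rightarrow> real" and q :: "nat \<Rightarrow> nat \<Rightarrow> real"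
  assumes eigen: "\<And>i u. i < n \<Longrightarrow> u < n \<Longrightarrow> mvec n W (q i) u = l i * q i u"
    and orthonormal: "\<And>i j. i < n \<Longrightarrow> j < n \<Longrightarrow> inner_n n (q i) (q j) = (if i = j then 1 else 0)"
    and complete: "\<And>u v. u < n \<Longrightarrow> v < n \<Longrightarrow> (\<Sum>i<n. q i u * q i v) = (if u = v then 1 else 0)"
    and symmetric: "\<And>u v. u < n \<Longrightarrow> v < n \<Longrightarrow> W u v = W v u"
begin

lemma parseval: "(nrm n x)\<^sup>2 = (\<Sum>i<n. (inner_n n x (q i))\<^sup>2)"
proof -
  have "(\<Sum>i<n. (inner_n n x (q i))\<^sup>2) = (\<Sum>i<n. \<Sum>u<n. \<Sum>v<n. x u * x v * (q i u * q i v))"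
    by (simp add: inner_n_def power2_eq_square sum_product mult_ac)
  also have "\<dots> = (\<Sum>u<n. \<Sum>v<n. \<Sum>i<n. x u * x v * (q i u * q i v))"
    by (subst sum.swap) (intro sum.cong refl sum.swap)
  also have "\<dots> = (\<Sum>u<n. \<Sum>v<n. if u = v then (x u)\<^sup>2 else 0)"
    by (intro sum.cong refl) (auto simp: complete power2_eq_square simp flip: sum_distrib_left)
  also have "\<dots> = (nrm n x)\<^sup>2" by (simp add: nrm_sq)
  finally show ?thesis by simp
qed

lemma inner_mvec_q: "i < n \<Longrightarrow> inner_n n (mvec n W x) (q i) = l i * inner_n n x (q i)"
  by (subst inner_mvec_sym[OF symmetric])
     (auto simp: inner_n_def eigen sum_distrib_left mult_ac)

lemma nrm_mvec_sq: "(nrm n (mvec n W x))\<^sup>2 = (\<Sum>i<n. (l i)\<^sup>2 * (inner_n n x (q i))\<^sup>2)"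
  unfolding parseval by (intro sum.cong refl) (simp add: inner_mvec_q power_mult_distrib)

text \<open>Half of a Courant-Fischer argument. More than \<open>m\<close> large eigenvalues would
  leave a nonzero combination of their eigenvectors satisfying the \<open>m\<close> constraints, and
  by Parseval \<open>W\<close> stretches it by more than \<open>t\<close>.\<close>

lemma card_large_le:
  assumes bound: "\<And>x. (\<And>j. j < m \<Longrightarrow> inner_n n (f j) x = 0) \<Longrightarrow> nrm n (mvec n W x) \<le> t * nrm n x"
    and t: "t \<ge> 0"
  shows "card {i\<in>{..<n}. \<bar>l i\<bar> > t} \<le> m"
proof (rule ccontr)
  define S where "S = {i\<in>{..<n}. \<bar>l i\<bar> > t}"
  assume "\<not> card {i\<in>{..<n}. \<bar>l i\<bar> > t} \<le> m"
  hence "card S > m" "finite S" by (auto simp: S_def)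
  then obtain c where c: "\<exists>s\<in>S. c s \<noteq> 0" "\<forall>j<m. (\<Sum>s\<in>S. inner_n n (f j) (q s) * c s) = 0"
    using homogeneous_system_nontrivial_solution[of S m "\<lambda>j s. inner_n n (f j) (q s)"] by auto
  define x where "x = (\<lambda>v. \<Sum>s\<in>S. c s * q s v)"
  have "inner_n n (f j) x = 0" if "j < m" for j
    using c(2) that by (simp add: x_def inner_n_sum_right mult.commute)
  hence le: "nrm n (mvec n W x) \<le> t * nrm n x" by (rule bound)
  have coeff: "inner_n n x (q i) = (if i \<in> S then c i else 0)" if "i < n" for i
  proof -
    have "inner_n n x (q i) = (\<Sum>s\<in>S. c s * (if i = s then 1 else 0))"
      unfolding x_def by (subst inner_n_commute, subst inner_n_sum_right)
        (use that in \<open>auto intro!: sum.cong simp: orthonormal S_def\<close>)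
    also have "\<dots> = (\<Sum>s\<in>S. if s = i then c i else 0)" by (intro sum.cong) auto
    finally show ?thesis using \<open>finite S\<close> by simp
  qed
  have S: "S \<subseteq> {..<n}" by (auto simp: S_def)
  have 1: "(nrm n x)\<^sup>2 = (\<Sum>i\<in>S. (c i)\<^sup>2)"
    unfolding parseval using S
    by (intro sum.mono_neutral_cong_right) (auto simp: coeff)
  have 2: "(nrm n (mvec n W x))\<^sup>2 = (\<Sum>i\<in>S. (l i)\<^sup>2 * (c i)\<^sup>2)"
    unfolding nrm_mvec_sq using S
    by (intro sum.mono_neutral_cong_right) (auto simp: coeff)
  have "(\<Sum>i\<in>S. t\<^sup>2 * (c i)\<^sup>2) < (\<Sum>i\<in>S. (l i)\<^sup>2 * (c i)\<^sup>2)"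
  proof (rule sum_strict_mono_ex1)
    have sq: "t\<^sup>2 < (l i)\<^sup>2" if "i \<in> S" for i
      using that t power_strict_mono[of t "\<bar>l i\<bar>" 2] by (auto simp: S_def)
    show "\<forall>i\<in>S. t\<^sup>2 * (c i)\<^sup>2 \<le> (l i)\<^sup>2 * (c i)\<^sup>2"
      by (intro ballI mult_right_mono less_imp_le[OF sq]) auto
    show "\<exists>i\<in>S. t\<^sup>2 * (c i)\<^sup>2 < (l i)\<^sup>2 * (c i)\<^sup>2"
    proof -
      obtain i where "i \<in> S" "c i \<noteq> 0" using c(1) by auto
      thus ?thesis using sq by (intro bexI[of _ i] mult_strict_right_mono) auto
    qed
  qed fact
  hence "(t * nrm n x)\<^sup>2 < (nrm n (mvec n W x))\<^sup>2"
    by (simp add: 1 2 power_mult_distrib sum_distrib_left)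
  moreover have "(nrm n (mvec n W x))\<^sup>2 \<le> (t * nrm n x)\<^sup>2"
    using le by (intro power_mono) auto
  ultimately show False by simp
qed

text \<open>The other half: with fewer than \<open>m\<close> large eigenvalues some nontrivial
  combination of the \<open>g j\<close> is orthogonal to all their eigenvectors, and
  \<open>W\<close> stretches it by at most \<open>t\<close>. Strictness in \<open>bound\<close> also
  forces the \<open>g j\<close> to be independent, since it fails for the zero vector.\<close>

lemma card_large_ge:
  assumes bound: "\<And>c. \<exists>j<m. c j \<noteq> 0 \<Longrightarrow>
      nrm n (mvec n W (\<lambda>v. \<Sum>j<m. c j * g j v)) > t * nrm n (\<lambda>v. \<Sum>j<m. c j * g j v)"
    and t: "t \<ge> 0"
  shows "m \<le> card {i\<in>{..<n}. \<bar>l i\<bar> > t}"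
proof (rule ccontr)
  define S where "S = {i\<in>{..<n}. \<bar>l i\<bar> > t}"
  assume "\<not> m \<le> card {i\<in>{..<n}. \<bar>l i\<bar> > t}"
  hence less: "card S < m" and fin: "finite S" by (auto simp: S_def)
  obtain e where e: "bij_betw e {..<card S} S"
    using ex_bij_betw_nat_finite[OF fin] by (auto simp: lessThan_atLeast0)
  obtain c where c: "\<exists>j\<in>{..<m}. c j \<noteq> 0"
      "\<forall>i<card S. (\<Sum>j\<in>{..<m}. inner_n n (q (e i)) (g j) * c j) = 0"
    using homogeneous_system_nontrivial_solution[of "{..<m}" "card S" "\<lambda>i j. inner_n n (q (e i)) (g j)"] less
    by auto
  define x where "x = (\<lambda>v. \<Sum>j<m. c j * g j v)"
  have zero: "inner_n n x (q s) = 0" if "s \<in> S" for s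
  proof -
    have "s \<in> e ` {..<card S}" using bij_betw_imp_surj_on[OF e] that by simp
    then obtain i where "i < card S" "s = e i" by auto
    thus ?thesis using c(2) unfolding x_def
      by (subst inner_n_commute, subst inner_n_sum_right) (auto simp: mult.commute)
  qed
  have "(nrm n (mvec n W x))\<^sup>2 \<le> (\<Sum>i<n. t\<^sup>2 * (inner_n n x (q i))\<^sup>2)"
    unfolding nrm_mvec_sq
  proof (rule sum_mono)
    fix i assume i: "i \<in> {..<n}"
    show "(l i)\<^sup>2 * (inner_n n x (q i))\<^sup>2 \<le> t\<^sup>2 * (inner_n n x (q i))\<^sup>2"
    proof (cases "i \<in> S")
      case False
      hence "(l i)\<^sup>2 \<le> t\<^sup>2" using i power_mono[of "\<bar>l i\<bar>" t 2] by (auto simp: S_def)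
      thus ?thesis by (intro mult_right_mono) auto
    qed (simp add: zero)
  qed
  also have "\<dots> = (t * nrm n x)\<^sup>2"
    by (simp add: parseval power_mult_distrib sum_distrib_left)
  finally have "nrm n (mvec n W x) \<le> t * nrm n x"
    by (rule power2_le_imp_le) (use t in auto)
  moreover have "nrm n (mvec n W x) > t * nrm n x"
    unfolding x_def using c(1) by (intro bound) auto
  ultimately show False by simp
qed

end

section \<open>Transfer to the multiset of eigenvalues\<close>

lemma symmetric_mat_spectral_basis:
  fixes A :: "real mat"
  assumes A: "A \<in> carrier_mat n n"
    and sym: "\<And>u v. u < n \<Longrightarrow> v < n \<Longrightarrow> A $$ (u,v) = A $$ (v,u)"
  obtains l q where "spectral_basis n (\<lambda>u v. A $$ (u,v)) l q"
    "\<And>p. size (filter_mset p (eigvals_mset A)) = card {i\<in>{..<n}. p (l i)}"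
proof -
  have T: "transpose_mat A = A" using A sym by (intro eq_matI) auto
  show thesis
  proof (rule spectral_theorem[OF A T], goal_cases)
    case (1 l q)
    have "spectral_basis n (\<lambda>u v. A $$ (u,v)) l q"
      by unfold_locales (use 1 sym in \<open>auto simp: mvec_def inner_n_def\<close>)
    moreover have "size (filter_mset p (eigvals_mset A)) = card {i\<in>{..<n}. p (l i)}" for p
      by (simp add: 1(1) filter_mset_image_mset)
    ultimately show ?case by (rule that)
  qed
qed

lemma size_large_eigvals_le:
  fixes A :: "real mat"
  assumes "A \<in> carrier_mat n n"
    and "\<And>u v. u < n \<Longrightarrow> v < n \<Longrightarrow> A $$ (u,v) = A $$ (v,u)"
    and "\<And>x. (\<And>j. j < m \<Longrightarrow> inner_n n (f j) x = 0) \<Longrightarrow>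
      nrm n (mvec n (\<lambda>u v. A $$ (u,v)) x) \<le> t * nrm n x"
    and "t \<ge> 0"
  shows "size {#x \<in># eigvals_mset A. \<bar>x\<bar> > t#} \<le> m"
proof -
  obtain l q where lq: "spectral_basis n (\<lambda>u v. A $$ (u,v)) l q"
    "\<And>p. size (filter_mset p (eigvals_mset A)) = card {i\<in>{..<n}. p (l i)}"
    using symmetric_mat_spectral_basis[OF assms(1,2)] by metis
  show ?thesis unfolding lq(2)
    using spectral_basis.card_large_le[OF lq(1), of m f t] assms(3,4) by blast
qed

lemma size_large_eigvals_ge:
  fixes A :: "real mat"
  assumes "A \<in> carrier_mat n n"
    and "\<And>u v. u < n \<Longrightarrow> v < n \<Longrightarrow> A $$ (u,v) = A $$ (v,u)"
    and "\<And>c. \<exists>j<m. c j \<noteq> 0 \<Longrightarrow>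
      nrm n (mvec n (\<lambda>u v. A $$ (u,v)) (\<lambda>v. \<Sum>j<m. c j * g j v)) > t * nrm n (\<lambda>v. \<Sum>j<m. c j * g j v)"
    and "t \<ge> 0"
  shows "m \<le> size {#x \<in># eigvals_mset A. \<bar>x\<bar> > t#}"
proof -
  obtain l q where lq: "spectral_basis n (\<lambda>u v. A $$ (u,v)) l q"
    "\<And>p. size (filter_mset p (eigvals_mset A)) = card {i\<in>{..<n}. p (l i)}"
    using symmetric_mat_spectral_basis[OF assms(1,2)] by metis
  show ?thesis unfolding lq(2)
    using spectral_basis.card_large_ge[OF lq(1), of m t g] assms(3,4) by blast
qed

text \<open>The upper count with no constraints at all, \<open>m = 0\<close>: every vector is then a
  test vector.\<close>

lemma eigvals_mset_bounded:
  fixes A :: "real mat"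
  assumes "A \<in> carrier_mat n n"
    and "\<And>u v. u < n \<Longrightarrow> v < n \<Longrightarrow> A $$ (u,v) = A $$ (v,u)"
    and "op_bounded n (\<lambda>u v. A $$ (u,v)) t"
    and "x \<in># eigvals_mset A"
  shows "\<bar>x\<bar> \<le> t"
proof -
  have "size {#x \<in># eigvals_mset A. \<bar>x\<bar> > t#} \<le> 0"
    by (rule size_large_eigvals_le[OF assms(1,2)])
       (use assms(3) op_bounded_mvec op_bounded_nonneg in auto)
  hence "{#x \<in># eigvals_mset A. \<bar>x\<bar> > t#} = {#}" by simp
  thus ?thesis using assms(4) by (auto simp: filter_mset_eq_conv simp flip: not_less)
qed

section \<open>Matrices close to a block matrix: adjacency spectrum\<close>

lemma nrm_mult_le:
  assumes h: "\<And>v. v < n \<Longrightarrow> \<bar>h v\<bar> \<le> g" and g: "g \<ge> 0"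
  shows "nrm n (\<lambda>v. h v * x v) \<le> g * nrm n x"
proof (rule nrm_leI)
  have "(\<Sum>i<n. (h i * x i)\<^sup>2) \<le> (\<Sum>i<n. g\<^sup>2 * (x i)\<^sup>2)"
  proof (rule sum_mono)
    fix i assume "i \<in> {..<n}"
    hence "(h i)\<^sup>2 \<le> g\<^sup>2" using h[of i] power_mono[of "\<bar>h i\<bar>" g 2] by simp
    thus "(h i * x i)\<^sup>2 \<le> g\<^sup>2 * (x i)\<^sup>2"
      by (simp add: power_mult_distrib mult_right_mono)
  qed
  thus "(\<Sum>i<n. (h i * x i)\<^sup>2) \<le> (g * nrm n x)\<^sup>2"
    by (simp add: power_mult_distrib nrm_sq sum_distrib_left)
qed (use g in simp)

lemma op_bounded_scale:
  assumes W: "op_bounded n W K" and w: "\<And>v. v < n \<Longrightarrow> \<bar>w v\<bar> \<le> \<omega>" and "\<omega> \<ge> 0"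
  shows "op_bounded n (\<lambda>u v. w u * W u v * w v) (\<omega>\<^sup>2 * K)"
proof -
  have K: "K \<ge> 0" using W by (rule op_bounded_nonneg)
  have nw: "nrm n (\<lambda>v. x v * w v) \<le> \<omega> * nrm n x" for x
    using nrm_mult_le[where h = w and g = \<omega> and n = n and x = x] w \<open>\<omega> \<ge> 0\<close>
    by (simp add: mult.commute)
  have "\<bar>\<Sum>u<n. \<Sum>v<n. x u * (w u * W u v * w v) * y v\<bar> \<le> \<omega>\<^sup>2 * K * nrm n x * nrm n y" for x y
  proof -
    have "(\<Sum>u<n. \<Sum>v<n. x u * (w u * W u v * w v) * y v)
        = (\<Sum>u<n. \<Sum>v<n. (x u * w u) * W u v * (y v * w v))"
      by (simp add: mult_ac)
    also have "\<bar>\<dots>\<bar> \<le> K * nrm n (\<lambda>v. x v * w v) * nrm n (\<lambda>v. y v * w v)"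
      by (rule op_boundedD[OF W])
    also have "\<dots> \<le> K * (\<omega> * nrm n x) * (\<omega> * nrm n y)"
      using K \<open>\<omega> \<ge> 0\<close> by (intro mult_mono nw mult_left_mono) auto
    finally show ?thesis by (simp add: power2_eq_square mult_ac)
  qed
  thus ?thesis using K by (simp add: op_bounded_def)
qed

text \<open>The l1 norm is at most \<open>sqrt n\<close> times the l2 norm. This crude bound
  supplies the upper half of the order \<open>n\<close> of the structural eigenvalues.\<close>

lemma op_bounded_entries:
  assumes "\<And>u v. u < n \<Longrightarrow> v < n \<Longrightarrow> \<bar>W u v\<bar> \<le> 1"
  shows "op_bounded n W (real n)"
proof -
  have s: "(\<Sum>u<n. \<bar>x u\<bar>) \<le> sqrt (real n) * nrm n x" for x
    using L2_set_mult_ineq[of "\<lambda>_. 1" x "{..<n}"] by (simp add: L2_set_def)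
  have "\<bar>\<Sum>u<n. \<Sum>v<n. x u * W u v * y v\<bar> \<le> real n * nrm n x * nrm n y" for x y
  proof -
    have "\<bar>\<Sum>u<n. \<Sum>v<n. x u * W u v * y v\<bar> \<le> (\<Sum>u<n. \<Sum>v<n. \<bar>x u\<bar> * \<bar>y v\<bar>)"
    proof (intro order_trans[OF sum_abs] sum_mono)
      fix u v assume "u \<in> {..<n}" "v \<in> {..<n}"
      hence "\<bar>x u\<bar> * \<bar>W u v\<bar> * \<bar>y v\<bar> \<le> \<bar>x u\<bar> * 1 * \<bar>y v\<bar>"
        using assms by (intro mult_mono) auto
      thus "\<bar>x u * W u v * y v\<bar> \<le> \<bar>x u\<bar> * \<bar>y v\<bar>" by (simp add: abs_mult)
    qed
    also have "\<dots> = (\<Sum>u<n. \<bar>x u\<bar>) * (\<Sum>v<n. \<bar>y v\<bar>)" by (simp add: sum_product)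
    also have "\<dots> \<le> (sqrt (real n) * nrm n x) * (sqrt (real n) * nrm n y)"
      by (intro mult_mono s) (auto intro: sum_nonneg)
    also have "\<dots> = real n * nrm n x * nrm n y" by simp
    finally show ?thesis .
  qed
  thus ?thesis by (simp add: op_bounded_def)
qed

text \<open>Moving the center from the mean \<open>\<mu>\<close> to \<open>b\<close> costs exactly
  \<open>W * (b - \<mu>)\<^sup>2\<close>. Variances may therefore be estimated with any convenient
  centers.\<close>

lemma weighted_variance_le:
  fixes w r :: "'b \<Rightarrow> real"
  assumes "finite X" and "(\<Sum>v\<in>X. w v) > 0"
  shows "(\<Sum>v\<in>X. w v * (r v - (\<Sum>v\<in>X. w v * r v) / (\<Sum>v\<in>X. w v))\<^sup>2) \<le> (\<Sum>v\<in>X. w v * (r v - b)\<^sup>2)"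
proof -
  define W where "W = (\<Sum>v\<in>X. w v)"
  define \<mu> where "\<mu> = (\<Sum>v\<in>X. w v * r v) / W"
  have W: "W > 0" using assms by (simp add: W_def)
  have m: "(\<Sum>v\<in>X. w v * r v) = W * \<mu>" using W by (simp add: \<mu>_def)
  have e: "(\<Sum>v\<in>X. w v * (r v - z)\<^sup>2) = (\<Sum>v\<in>X. w v * (r v)\<^sup>2) - 2 * z * (W * \<mu>) + z\<^sup>2 * W" for z
  proof -
    have "(\<Sum>v\<in>X. w v * (r v - z)\<^sup>2) = (\<Sum>v\<in>X. w v * (r v)\<^sup>2 - 2 * z * (w v * r v) + z\<^sup>2 * w v)"
      by (intro sum.cong) (auto simp: power2_eq_square algebra_simps)
    also have "\<dots> = (\<Sum>v\<in>X. w v * (r v)\<^sup>2) - 2 * z * (\<Sum>v\<in>X. w v * r v) + z\<^sup>2 * (\<Sum>v\<in>X. w v)"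
      by (simp add: sum.distrib sum_subtractf sum_distrib_left)
    finally show ?thesis by (simp add: m W_def)
  qed
  have "(\<Sum>v\<in>X. w v * (r v - b)\<^sup>2) - (\<Sum>v\<in>X. w v * (r v - \<mu>)\<^sup>2) = W * (b - \<mu>)\<^sup>2"
    unfolding e by (simp add: power2_eq_square algebra_simps)
  moreover have "W * (b - \<mu>)\<^sup>2 \<ge> 0" using W by simp
  ultimately show ?thesis unfolding \<mu>_def W_def by linarith
qed

lemma finite_parts_of: "finite (parts_of n k)"
proof (rule finite_subset)
  show "parts_of n k \<subseteq> Pow (Pow {..<n})"
    by (auto simp: parts_of_def partition_on_def)
qed simp

lemma cluster_image_in_parts_of:
  assumes "\<And>v. v < n \<Longrightarrow> f v < m" and "\<And>i. i < m \<Longrightarrow> cluster n f i \<noteq> {}"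
  shows "cluster n f ` {..<m} \<in> parts_of n m"
proof -
  have inj: "inj_on (cluster n f) {..<m}"
    using assms(2) by (fastforce simp: inj_on_def cluster_def)
  have "partition_on {..<n} (cluster n f ` {..<m})"
    unfolding partition_on_def disjoint_def using assms
    by (auto simp: cluster_def)
  thus ?thesis by (simp add: parts_of_def card_image[OF inj])
qed

lemma sum_over_clusters:
  fixes f :: "nat \<Rightarrow> real"
  assumes "\<And>v. v < n \<Longrightarrow> c v < k"
  shows "(\<Sum>v<n. f v) = (\<Sum>i<k. \<Sum>v\<in>cluster n c i. f v)"
proof -
  have "{..<n} = (\<Union>i<k. cluster n c i)" using assms by (auto simp: cluster_def)
  thus ?thesis by (simp only:) (subst sum.UNION_disjoint, auto simp: cluster_def)
qed

lemma orthonormal_eigenvectorsD: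
  assumes "orthonormal_eigenvectors A L us" "A \<in> carrier_mat n n"
  obtains ls where "mset ls = L" "length us = length ls" "set us \<subseteq> carrier_vec n"
    "\<And>j. j < length ls \<Longrightarrow> nrm n (\<lambda>v. us ! j $ v) = 1"
    "\<And>j u. j < length ls \<Longrightarrow> u < n \<Longrightarrow> mvec n (\<lambda>u v. A $$ (u,v)) (\<lambda>v. us ! j $ v) u = ls ! j * us ! j $ u"
proof -
  obtain ls where ls: "mset ls = L" "length us = length ls"
    "\<forall>i<length us. eigenvector A (us ! i) (ls ! i)"
    "\<forall>i<length us. \<forall>j<length us. scalar_prod (us ! i) (us ! j) = (if i = j then 1 else 0)"
    using assms(1) unfolding orthonormal_eigenvectors_def by auto
  have car: "us ! i \<in> carrier_vec n" if "i < length us" for i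
    using ls(3) that assms(2) by (auto simp: eigenvector_def)
  show thesis
  proof (rule that[OF ls(1,2)])
    show "set us \<subseteq> carrier_vec n" using car by (auto simp: in_set_conv_nth)
    fix j assume "j < length ls"
    hence j: "j < length us" using ls(2) by simp
    have "scalar_prod (us ! j) (us ! j) = 1" using ls(4) j by simp
    hence "(\<Sum>v<n. (us ! j $ v)\<^sup>2) = 1"
      using car[OF j] by (simp add: scalar_prod_def lessThan_atLeast0 power2_eq_square)
    thus "nrm n (\<lambda>v. us ! j $ v) = 1" by (simp add: L2_set_def)
    fix u assume u: "u < n"
    have "A *\<^sub>v (us ! j) = ls ! j \<cdot>\<^sub>v us ! j" using ls(3) j by (simp add: eigenvector_def)
    from arg_cong[OF this, of "\<lambda>x. x $ u"]
    show "mvec n (\<lambda>u v. A $$ (u,v)) (\<lambda>v. us ! j $ v) u = ls ! j * us ! j $ u"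
      using u car[OF j] assms(2) by (simp add: mvec_def scalar_prod_def lessThan_atLeast0)
  qed
qed

text \<open>The situation at one large \<open>n\<close>; the constants \<open>K\<close>,
  \<open>\<kappa>\<close>, \<open>\<sigma>\<close> and \<open>p0\<close> will not vary with
  \<open>n\<close>. The block matrix keeps its diagonal \<open>p (c u) (c u)\<close>, so that it is
  constant on pairs of clusters; that the graph has no loops is paid for in
  \<open>K\<close>.\<close>

locale block_approximation =
  fixes n k :: nat and c :: "nat \<Rightarrow> nat" and a p :: "nat \<Rightarrow> nat \<Rightarrow> real"
    and K \<kappa> \<sigma> p0 :: real
  assumes k_pos: "k \<ge> 1" and n_pos: "n > 0"
    and c_less: "\<And>v. v < n \<Longrightarrow> c v < k"
    and a_sym: "\<And>u v. u < n \<Longrightarrow> v < n \<Longrightarrow> a u v = a v u"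
    and a_01: "\<And>u v. u < n \<Longrightarrow> v < n \<Longrightarrow> 0 \<le> a u v \<and> a u v \<le> 1"
    and p_sym: "\<And>i j. i < k \<Longrightarrow> j < k \<Longrightarrow> p i j = p j i"
    and p_01: "\<And>i j. i < k \<Longrightarrow> j < k \<Longrightarrow> 0 \<le> p i j \<and> p i j \<le> 1"
    and close: "op_bounded n (\<lambda>u v. a u v - p (c u) (c v)) (K * sqrt (real n))"
    and \<sigma>_pos: "\<sigma> > 0" and card_ge: "\<And>i. i < k \<Longrightarrow> real (card (cluster n c i)) \<ge> \<sigma> * real n"
    and \<kappa>_pos: "\<kappa> > 0" and deg_ge: "\<And>v. v < n \<Longrightarrow> (\<Sum>u<n. a v u) \<ge> \<kappa> * real n"
    and model_deg_ge: "\<And>i. i < k \<Longrightarrow> (\<Sum>u<n. p i (c u)) \<ge> \<kappa> * real n"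
    and p0_pos: "p0 > 0"
    and p0: "\<And>z. p0\<^sup>2 * (\<Sum>i<k. (z i)\<^sup>2) \<le> (\<Sum>i<k. (\<Sum>j<k. p i j * z j)\<^sup>2)"
begin

abbreviation "U \<equiv> cluster n c"

lemma K_nonneg: "K \<ge> 0"
  using op_bounded_nonneg[OF close] n_pos by (simp add: zero_le_mult_iff)

lemma finite_U [simp, intro]: "finite (U i)" by (simp add: cluster_def)

lemma U_subset: "U i \<subseteq> {..<n}" by (auto simp: cluster_def)

lemma card_U_pos: "i < k \<Longrightarrow> card (U i) > 0"
  using card_ge[of i] \<sigma>_pos n_pos
  by (metis mult_pos_pos of_nat_0_less_iff order_less_le_trans)

lemma U_nonempty: "i < k \<Longrightarrow> U i \<noteq> {}" using card_U_pos by fastforce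

lemma sum_clusters: "(\<Sum>v<n. f v) = (\<Sum>i<k. \<Sum>v\<in>U i. f v :: real)"
  by (rule sum_over_clusters) (rule c_less)

lemma sum_cluster_step: "(\<Sum>v<n. g (c v) * h v) = (\<Sum>i<k. g i * (\<Sum>v\<in>U i. (h v :: real)))"
  unfolding sum_clusters sum_distrib_left
  by (intro sum.cong refl) (simp add: cluster_def)

lemma clusters_in_parts_of: "U ` {..<k} \<in> parts_of n k"
  using c_less U_nonempty by (rule cluster_image_in_parts_of)

lemma inj_on_U: "inj_on U {..<k}"
  using U_nonempty by (fastforce simp: inj_on_def cluster_def)

text \<open>The clusters are one candidate partition, and centers \<open>b\<close> do no better than
  the centroids. A bound on a variance thus reduces to closeness of each column to a function of the
  cluster.\<close>

lemma min_variance_le: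
  assumes R: "R \<in> carrier_mat n m" and w: "\<And>v. v < n \<Longrightarrow> w v > 0"
  shows "min_variance k w R \<le> (\<Sum>j<m. \<Sum>v<n. w v * (R $$ (v,j) - b (c v) j)\<^sup>2)"
proof -
  let ?obj = "\<lambda>Q. \<Sum>X\<in>Q. \<Sum>v\<in>X. w v * ((Matrix.row R v - centroid w R X) \<bullet> (Matrix.row R v - centroid w R X))"
  let ?cen = "\<lambda>i j. (\<Sum>v\<in>U i. w v * R $$ (v,j)) / (\<Sum>v\<in>U i. w v)"
  have "min_variance k w R \<le> ?obj (U ` {..<k})"
    unfolding min_variance_def using R clusters_in_parts_of
    by (intro Min_le finite_imageI finite_parts_of imageI) auto
  also have "\<dots> = (\<Sum>i<k. \<Sum>v\<in>U i. w v * ((Matrix.row R v - centroid w R (U i)) \<bullet> (Matrix.row R v - centroid w R (U i))))"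
    by (subst sum.reindex[OF inj_on_U]) simp
  also have "\<dots> = (\<Sum>i<k. \<Sum>v\<in>U i. \<Sum>j<m. w v * (R $$ (v,j) - ?cen i j)\<^sup>2)"
  proof (intro sum.cong refl)
    fix i v assume "v \<in> U i"
    hence "v < n" by (simp add: cluster_def)
    thus "w v * ((Matrix.row R v - centroid w R (U i)) \<bullet> (Matrix.row R v - centroid w R (U i)))
        = (\<Sum>j<m. w v * (R $$ (v,j) - ?cen i j)\<^sup>2)"
      using R by (simp add: scalar_prod_def centroid_def lessThan_atLeast0 sum_distrib_left power2_eq_square)
  qed
  also have "\<dots> = (\<Sum>i<k. \<Sum>j<m. \<Sum>v\<in>U i. w v * (R $$ (v,j) - ?cen i j)\<^sup>2)"
    by (intro sum.cong refl sum.swap)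
  also have "\<dots> \<le> (\<Sum>i<k. \<Sum>j<m. \<Sum>v\<in>U i. w v * (R $$ (v,j) - b i j)\<^sup>2)"
  proof (rule sum_mono, rule sum_mono, rule weighted_variance_le)
    fix i j :: nat assume "i \<in> {..<k}" "j \<in> {..<m}"
    thus "(\<Sum>v\<in>U i. w v) > 0" using U_nonempty w by (intro sum_pos) (auto simp: cluster_def)
  qed auto
  also have "\<dots> = (\<Sum>j<m. \<Sum>v<n. w v * (R $$ (v,j) - b (c v) j)\<^sup>2)"
    unfolding sum_clusters by (subst sum.swap) (auto intro!: sum.cong simp: cluster_def)
  finally show ?thesis .
qed

text \<open>Constant weight one gives the adjacency matrix and weight \<open>1 / sqrt d\<close> the
  normalized adjacency matrix, so one pair of estimates serves both spectra.\<close>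

definition wmat :: "(nat \<Rightarrow> real) \<Rightarrow> nat \<Rightarrow> nat \<Rightarrow> real" where
  "wmat w u v = w u * a u v * w v"

definition wind :: "(nat \<Rightarrow> real) \<Rightarrow> nat \<Rightarrow> nat \<Rightarrow> real" where
  "wind w i v = (if c v = i then w v else 0)"

lemma mvec_wmat_decomp:
  assumes "u < n"
  shows "mvec n (wmat w) x u = mvec n (\<lambda>u v. w u * (a u v - p (c u) (c v)) * w v) x u
    + w u * (\<Sum>v<n. p (c u) (c v) * (w v * x v))"
  by (simp add: mvec_def wmat_def sum_distrib_left algebra_simps flip: sum.distrib)

lemma inner_wind: "inner_n n (wind w i) x = (\<Sum>v\<in>U i. w v * x v)"
proof -
  have "(\<Sum>v\<in>U i. w v * x v) = (\<Sum>v<n. wind w i v * x v)"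
    by (intro sum.mono_neutral_cong_left) (auto simp: cluster_def wind_def)
  thus ?thesis by (simp add: inner_n_def)
qed

text \<open>Orthogonality to every \<open>wind w i\<close> annihilates the weighted block part, so
  only the error matrix acts on \<open>x\<close>.\<close>

lemma wmat_orth_bound:
  assumes w: "op_bounded n (\<lambda>u v. w u * (a u v - p (c u) (c v)) * w v) \<epsilon>"
    and orth: "\<And>i. i < k \<Longrightarrow> inner_n n (wind w i) x = 0"
  shows "nrm n (mvec n (wmat w) x) \<le> \<epsilon> * nrm n x"
proof -
  have "(\<Sum>v<n. p (c u) (c v) * (w v * x v)) = 0" for u
    using sum_cluster_step[of "p (c u)" "\<lambda>v. w v * x v"] orth by (simp add: inner_wind)
  hence "nrm n (mvec n (wmat w) x) = nrm n (mvec n (\<lambda>u v. w u * (a u v - p (c u) (c v)) * w v) x)"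
    by (intro nrm_cong) (simp add: mvec_wmat_decomp)
  also have "\<dots> \<le> \<epsilon> * nrm n x" by (rule op_bounded_mvec[OF w])
  finally show ?thesis .
qed

lemma nrm_step_sq: "(nrm n (\<lambda>v. w v * \<phi> (c v)))\<^sup>2 = (\<Sum>i<k. (\<phi> i)\<^sup>2 * (\<Sum>v\<in>U i. (w v)\<^sup>2))"
  using sum_cluster_step[of "\<lambda>i. (\<phi> i)\<^sup>2" "\<lambda>v. (w v)\<^sup>2"]
  by (simp add: nrm_sq power_mult_distrib mult.commute)

text \<open>On weighted step vectors the block part acts as \<open>p\<close> after multiplication by
  the class masses \<open>S i\<close>. The bound \<open>s \<le> S i\<close> is used twice, for the
  input coefficients and for the norm of the output, which together give the factor
  \<open>s\<close>; the error matrix costs \<open>\<epsilon>\<close>.\<close>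

lemma wmat_step_bound:
  assumes w: "op_bounded n (\<lambda>u v. w u * (a u v - p (c u) (c v)) * w v) \<epsilon>"
    and s: "\<And>i. i < k \<Longrightarrow> s \<le> (\<Sum>v\<in>U i. (w v)\<^sup>2)" and "s \<ge> 0"
  shows "nrm n (mvec n (wmat w) (\<lambda>v. w v * \<phi> (c v))) \<ge> (s * p0 - \<epsilon>) * nrm n (\<lambda>v. w v * \<phi> (c v))"
proof -
  define x where "x = (\<lambda>v. w v * \<phi> (c v))"
  define S where "S i = (\<Sum>v\<in>U i. (w v)\<^sup>2)" for i
  define \<psi> where "\<psi> i = (\<Sum>j<k. p i j * (\<phi> j * S j))" for i
  have sS: "s \<le> S i" if "i < k" for i using s that by (simp add: S_def)
  have psi: "(\<Sum>v<n. p i (c v) * (w v * x v)) = \<psi> i" for i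
    using sum_cluster_step[of "\<lambda>j. p i j * \<phi> j" "\<lambda>v. (w v)\<^sup>2"]
    by (simp add: \<psi>_def S_def x_def power2_eq_square mult_ac)
  have nx: "(nrm n x)\<^sup>2 = (\<Sum>i<k. (\<phi> i)\<^sup>2 * S i)"
    by (simp add: x_def nrm_step_sq S_def)
  have "(s * p0)\<^sup>2 * (nrm n x)\<^sup>2 = s * p0\<^sup>2 * (\<Sum>i<k. s * ((\<phi> i)\<^sup>2 * S i))"
    unfolding nx by (simp add: power2_eq_square sum_distrib_left mult_ac)
  also have "\<dots> \<le> s * p0\<^sup>2 * (\<Sum>i<k. (\<phi> i * S i)\<^sup>2)"
  proof (intro mult_left_mono sum_mono)
    fix i assume "i \<in> {..<k}"
    hence i: "s \<le> S i" using sS by simp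
    hence "s * ((\<phi> i)\<^sup>2 * S i) \<le> S i * ((\<phi> i)\<^sup>2 * S i)"
      using \<open>s \<ge> 0\<close> by (intro mult_right_mono) auto
    thus "s * ((\<phi> i)\<^sup>2 * S i) \<le> (\<phi> i * S i)\<^sup>2" by (simp add: power2_eq_square mult_ac)
  qed (use \<open>s \<ge> 0\<close> in auto)
  also have "\<dots> \<le> s * (\<Sum>i<k. (\<psi> i)\<^sup>2)"
    using p0[of "\<lambda>i. \<phi> i * S i"] \<open>s \<ge> 0\<close> by (simp add: \<psi>_def mult_left_mono mult.assoc)
  also have "\<dots> \<le> (\<Sum>i<k. (\<psi> i)\<^sup>2 * S i)"
    unfolding sum_distrib_left using sS by (intro sum_mono) (simp add: mult.commute mult_right_mono)
  also have "\<dots> = (nrm n (\<lambda>v. w v * \<psi> (c v)))\<^sup>2" by (simp add: nrm_step_sq S_def)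
  finally have "s * p0 * nrm n x \<le> nrm n (\<lambda>v. w v * \<psi> (c v))"
    by (metis L2_set_nonneg power2_le_imp_le power_mult_distrib)
  also have "\<dots> = nrm n (\<lambda>u. mvec n (wmat w) x u - mvec n (\<lambda>u v. w u * (a u v - p (c u) (c v)) * w v) x u)"
    by (intro nrm_cong) (simp add: mvec_wmat_decomp psi)
  also have "\<dots> \<le> nrm n (mvec n (wmat w) x) + nrm n (mvec n (\<lambda>u v. w u * (a u v - p (c u) (c v)) * w v) x)"
    by (rule nrm_triangle_sub)
  also have "\<dots> \<le> nrm n (mvec n (wmat w) x) + \<epsilon> * nrm n x"
    using op_bounded_mvec[OF w, of x] by simp
  finally show ?thesis by (simp add: x_def left_diff_distrib)
qed

section \<open>Adjacency spectrum and k-variance\<close>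

context
  fixes A :: "real mat"
  assumes A: "A \<in> carrier_mat n n" and A_entries: "\<And>u v. u < n \<Longrightarrow> v < n \<Longrightarrow> A $$ (u,v) = a u v"
    and large: "K * sqrt (real n) < \<sigma> * p0 / 4 * real n"
begin

lemma mvec_A: "u < n \<Longrightarrow> mvec n (\<lambda>u v. A $$ (u,v)) x u = mvec n (wmat (\<lambda>_. 1)) x u"
  by (simp add: mvec_def wmat_def A_entries)

lemma nrm_mvec_A: "nrm n (mvec n (\<lambda>u v. A $$ (u,v)) x) = nrm n (mvec n (wmat (\<lambda>_. 1)) x)"
  by (rule nrm_cong) (simp add: mvec_A)

lemma size_eigvals_adjacency_le: "size {#l \<in># eigvals_mset A. \<bar>l\<bar> > K * sqrt n#} \<le> k"
proof (rule size_large_eigvals_le[OF A, where f = "wind (\<lambda>_. 1)"])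
  fix x assume "\<And>j. j < k \<Longrightarrow> inner_n n (wind (\<lambda>_. 1) j) x = 0"
  thus "nrm n (mvec n (\<lambda>u v. A $$ (u,v)) x) \<le> K * sqrt n * nrm n x"
    unfolding nrm_mvec_A using close by (intro wmat_orth_bound) auto
qed (use A_entries a_sym K_nonneg in auto)

lemma size_eigvals_adjacency_ge: "k \<le> size {#l \<in># eigvals_mset A. \<bar>l\<bar> > \<sigma> * p0 / 4 * n#}"
proof (rule size_large_eigvals_ge[OF A, where g = "wind (\<lambda>_. 1)"])
  fix d :: "nat \<Rightarrow> real" assume d: "\<exists>j<k. d j \<noteq> 0"
  have step: "(\<Sum>j<k. d j * wind (\<lambda>_. 1) j v) = 1 * d (c v)" if "v < n" for v
  proof -
    have "(\<Sum>j<k. d j * wind (\<lambda>_. 1) j v) = (\<Sum>j<k. if j = c v then d j else 0)"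
      by (intro sum.cong) (auto simp: wind_def)
    thus ?thesis using c_less[OF that] by simp
  qed
  let ?x = "\<lambda>v. 1 * d (c v)"
  have n1: "nrm n (\<lambda>v. \<Sum>j<k. d j * wind (\<lambda>_. 1) j v) = nrm n ?x"
    by (rule nrm_cong) (simp add: step)
  have n2: "nrm n (mvec n (\<lambda>u v. A $$ (u,v)) (\<lambda>v. \<Sum>j<k. d j * wind (\<lambda>_. 1) j v)) = nrm n (mvec n (wmat (\<lambda>_. 1)) ?x)"
    unfolding nrm_mvec_A by (intro nrm_cong mvec_cong step)
  have "(\<sigma> * n * p0 - K * sqrt n) * nrm n ?x \<le> nrm n (mvec n (wmat (\<lambda>_. 1)) ?x)"
    using close card_ge \<sigma>_pos by (intro wmat_step_bound) auto
  moreover have "nrm n ?x > 0"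
  proof -
  obtain j where j: "j < k" "d j \<noteq> 0" using d by auto
  have "0 < (d j)\<^sup>2 * card (U j)" using j card_U_pos by simp
  also have "\<dots> \<le> (\<Sum>i<k. (d i)\<^sup>2 * card (U i))"
    using j by (intro member_le_sum) auto
  also have "\<dots> = (nrm n ?x)\<^sup>2"
    using nrm_step_sq[of "\<lambda>_. 1" d] by simp
  finally have "0 < (nrm n ?x)\<^sup>2" .
  hence "nrm n ?x \<noteq> 0" unfolding zero_less_power2 .
  thus ?thesis using L2_set_nonneg[of ?x "{..<n}"] by linarith
  qed
  \<comment> \<open>By \<open>large\<close> the error consumes less than a quarter of
    \<open>\<sigma> * n * p0\<close>; three quarters remain and the threshold asks for one.\<close>
  moreover have "\<sigma> * p0 / 4 * n < \<sigma> * n * p0 - K * sqrt n"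
  proof -
    have "\<sigma> * n * p0 > 0" using \<sigma>_pos p0_pos n_pos by simp
    thus ?thesis using large by (simp add: mult_ac)
  qed
  ultimately show "\<sigma> * p0 / 4 * n * nrm n (\<lambda>v. \<Sum>j<k. d j * wind (\<lambda>_. 1) j v)
      < nrm n (mvec n (\<lambda>u v. A $$ (u,v)) (\<lambda>v. \<Sum>j<k. d j * wind (\<lambda>_. 1) j v))"
    unfolding n1 n2 by (meson mult_strict_right_mono order_less_le_trans)
qed (use A_entries a_sym \<sigma>_pos p0_pos in auto)

text \<open>At most \<open>k\<close> eigenvalues exceed the lower threshold and at least
  \<open>k\<close> exceed the upper one. The filtered multisets are nested, hence equal, and nothing
  lies between the thresholds.\<close>

lemma structural_eigvals_adjacency:
  defines "L \<equiv> {#l \<in># eigvals_mset A. \<sigma> * p0 / 4 * n \<le> \<bar>l\<bar> \<and> \<bar>l\<bar> \<le> 1 * n#}"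
  shows "size L = k" and "\<forall>l \<in># eigvals_mset A - L. \<bar>l\<bar> \<le> K * sqrt n"
proof -
  have op: "op_bounded n (\<lambda>u v. A $$ (u,v)) (real n)"
    by (rule op_bounded_entries) (use a_01 A_entries in auto)
  have le: "\<bar>l\<bar> \<le> n" if "l \<in># eigvals_mset A" for l
    using eigvals_mset_bounded[OF A _ op that] A_entries a_sym by simp
  have L: "L = {#l \<in># eigvals_mset A. \<sigma> * p0 / 4 * n \<le> \<bar>l\<bar>#}"
    unfolding L_def using le by (intro filter_mset_cong) auto
  have 1: "{#l \<in># eigvals_mset A. \<bar>l\<bar> > \<sigma> * p0 / 4 * n#} \<subseteq># L"
    unfolding L by (rule mset_subset_eqI) auto
  have 2: "L \<subseteq># {#l \<in># eigvals_mset A. \<bar>l\<bar> > K * sqrt n#}"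
    unfolding L using large by (intro mset_subset_eqI) auto
  have sz: "k \<le> size L" "size L \<le> k"
    using size_mset_mono[OF 1] size_mset_mono[OF 2] size_eigvals_adjacency_le size_eigvals_adjacency_ge by auto
  thus "size L = k" by simp
  have "L = {#l \<in># eigvals_mset A. \<bar>l\<bar> > K * sqrt n#}"
    using 2 sz size_eigvals_adjacency_le size_mset_mono[OF 2]
    by (metis le_antisym mset_subset_size nat_less_le subset_mset.le_neq_trans)
  hence "eigvals_mset A - L = {#l \<in># eigvals_mset A. \<not> \<bar>l\<bar> > K * sqrt n#}"
    by (metis add_diff_cancel_left' multiset_partition)
  thus "\<forall>l \<in># eigvals_mset A - L. \<bar>l\<bar> \<le> K * sqrt n" by auto
qed

lemma k_variance_le:
  assumes us: "orthonormal_eigenvectors A L us" and sz: "size L = k"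
    and L: "\<And>l. l \<in># L \<Longrightarrow> \<sigma> * p0 / 4 * n \<le> \<bar>l\<bar>"
  shows "k_variance k n us \<le> k * (4 * K / (\<sigma> * p0))\<^sup>2 / n"
proof -
  obtain ls where ls: "mset ls = L" "length us = length ls" "set us \<subseteq> carrier_vec n"
    "\<And>j. j < length ls \<Longrightarrow> nrm n (\<lambda>v. us ! j $ v) = 1"
    "\<And>j u. j < length ls \<Longrightarrow> u < n \<Longrightarrow> mvec n (\<lambda>u v. A $$ (u,v)) (\<lambda>v. us ! j $ v) u = ls ! j * us ! j $ u"
    using orthonormal_eigenvectorsD[OF us A] by blast
  have len: "length ls = k" using ls(1) sz by (metis size_mset)
  define \<alpha> where "\<alpha> = \<sigma> * p0 / 4"
  have \<alpha>: "\<alpha> > 0" using \<sigma>_pos p0_pos by (simp add: \<alpha>_def)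
  \<comment> \<open>The block part of the eigenvector equation depends on a vertex only through its
    cluster, so after division by the eigenvalue it supplies the centers.\<close>
  define b where "b i j = (\<Sum>v<n. p i (c v) * us ! j $ v) / ls ! j" for i j
  have col: "(\<Sum>v<n. 1 * (us ! j $ v - b (c v) j)\<^sup>2) \<le> (K / \<alpha>)\<^sup>2 / n" if j: "j < k" for j
  proof -
    have lj: "\<alpha> * n \<le> \<bar>ls ! j\<bar>" using L ls(1) len j unfolding \<alpha>_def
      by (metis nth_mem_mset)
    have lj0: "\<bar>ls ! j\<bar> > 0" using lj \<alpha> n_pos by (meson mult_pos_pos of_nat_0_less_iff order_less_le_trans)
    have eq: "us ! j $ u - b (c u) j = (1 / ls ! j) * mvec n (\<lambda>u v. a u v - p (c u) (c v)) (\<lambda>v. us ! j $ v) u"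
      if "u < n" for u
    proof -
      have "mvec n (wmat (\<lambda>_. 1)) (\<lambda>v. us ! j $ v) u = ls ! j * us ! j $ u"
        using ls(5)[of j u] j len that by (simp add: mvec_A)
      thus ?thesis using lj0 mvec_wmat_decomp[OF that, of "\<lambda>_. 1" "\<lambda>v. us ! j $ v"]
        by (simp add: b_def field_simps)
    qed
    have "nrm n (\<lambda>v. us ! j $ v - b (c v) j)
        = \<bar>1 / ls ! j\<bar> * nrm n (mvec n (\<lambda>u v. a u v - p (c u) (c v)) (\<lambda>v. us ! j $ v))"
      unfolding nrm_scale[symmetric] by (rule nrm_cong) (rule eq)
    also have "\<dots> \<le> \<bar>1 / ls ! j\<bar> * (K * sqrt n * 1)"
      using op_bounded_mvec[OF close, of "\<lambda>v. us ! j $ v"] ls(4)[of j] j len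
      by (intro mult_left_mono) auto
    also have "\<dots> \<le> (1 / (\<alpha> * n)) * (K * sqrt n * 1)"
      using lj lj0 \<alpha> n_pos K_nonneg by (intro mult_right_mono) (auto simp: frac_le)
    also have "\<dots> = K / \<alpha> / sqrt n" using n_pos \<alpha> by (simp add: field_simps flip: power2_eq_square)
    finally have "(nrm n (\<lambda>v. us ! j $ v - b (c v) j))\<^sup>2 \<le> (K / \<alpha> / sqrt n)\<^sup>2"
      by (intro power_mono) auto
    thus ?thesis by (simp add: nrm_sq power_divide power_mult_distrib)
  qed
  have "k_variance k n us \<le> (\<Sum>j<k. \<Sum>v<n. 1 * (mat_of_cols n us $$ (v,j) - b (c v) j)\<^sup>2)"
    unfolding k_variance_def using len ls(2) by (intro min_variance_le) (auto simp: mat_of_cols_carrier)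
  also have "\<dots> = (\<Sum>j<k. \<Sum>v<n. 1 * (us ! j $ v - b (c v) j)\<^sup>2)"
    using len ls(2) by (intro sum.cong refl) (simp add: mat_of_cols_index)
  also have "\<dots> \<le> (\<Sum>j<k. (K / \<alpha>)\<^sup>2 / n)" by (intro sum_mono col) auto
  finally show ?thesis by (simp add: \<alpha>_def mult_ac)
qed

end

end

section \<open>The normalized modularity matrix\<close>

lemma scaled_mat_carrier [simp]: "A \<in> carrier_mat n m \<Longrightarrow> scaled_mat A \<in> carrier_mat n m"
  by (simp add: scaled_mat_def)

lemma scaled_mat_index:
  assumes "A \<in> carrier_mat n n" "u < n" "v < n"
  shows "scaled_mat A $$ (u,v) = A $$ (u,v) / (\<Sum>v<n. deg A v)"
  using assms by (auto simp: scaled_mat_def deg_def)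

lemma deg_scaled_mat:
  assumes "A \<in> carrier_mat n n" "u < n"
  shows "deg (scaled_mat A) u = deg A u / (\<Sum>v<n. deg A v)"
proof -
  have "deg (scaled_mat A) u = (\<Sum>v<n. scaled_mat A $$ (u,v))"
    using assms(1) by (simp add: deg_def scaled_mat_def)
  also have "\<dots> = (\<Sum>v<n. A $$ (u,v)) / (\<Sum>v<n. deg A v)"
    unfolding sum_divide_distrib using assms by (intro sum.cong refl) (simp add: scaled_mat_index)
  also have "(\<Sum>v<n. A $$ (u,v)) = deg A u" using assms by (simp add: deg_def)
  finally show ?thesis .
qed

lemma normalized_modularity_carrier:
  "A \<in> carrier_mat n n \<Longrightarrow> normalized_modularity A \<in> carrier_mat n n"
  by (intro carrier_matI) (simp_all add: normalized_modularity_def inv_sqrt_deg_def Let_def scaled_mat_def mat_diag_def)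

text \<open>Rescaling to total weight one cancels in the normalized term and leaves a single
  division by the volume in the rank-one term, so unscaled degrees can be used from here on.\<close>

lemma normalized_modularity_index:
  assumes A: "A \<in> carrier_mat n n" and uv: "u < n" "v < n"
    and pos: "\<And>v. v < n \<Longrightarrow> deg A v > 0"
  shows "normalized_modularity A $$ (u,v) =
    1 / sqrt (deg A u) * A $$ (u,v) * (1 / sqrt (deg A v)) -
    sqrt (deg A u) * sqrt (deg A v) / (\<Sum>v<n. deg A v)"
proof -
  define vol where "vol = (\<Sum>v<n. deg A v)"
  have vol: "vol > 0" unfolding vol_def using pos uv by (intro sum_pos) auto
  let ?S = "scaled_mat A"
  have S: "?S \<in> carrier_mat n n" using A by simp
  have dS: "dim_row ?S = n" using S by auto
  let ?f = "\<lambda>i. 1 / sqrt (deg ?S i)"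
  have 1: "mat_diag n ?f * ?S = Matrix.mat n n (\<lambda> (i,j). ?f i * ?S $$ (i,j))"
    by (rule mat_diag_mult_left[OF S])
  have 2: "mat_diag n ?f * ?S * mat_diag n ?f =
      Matrix.mat n n (\<lambda> (i,j). ?f i * ?S $$ (i,j) * ?f j)"
    unfolding 1 by (subst mat_diag_mult_right[of _ n n]) auto
  have "normalized_modularity A $$ (u,v) = ?f u * ?S $$ (u,v) * ?f v - sqrt (deg ?S u) * sqrt (deg ?S v)"
    using uv unfolding normalized_modularity_def Let_def inv_sqrt_deg_def dS 2 by simp
  also have "\<dots> = 1 / sqrt (deg A u) * A $$ (u,v) * (1 / sqrt (deg A v)) - sqrt (deg A u) * sqrt (deg A v) / vol"
    using uv vol A pos[of u] pos[of v] unfolding deg_scaled_mat[OF A uv(1)] deg_scaled_mat[OF A uv(2)]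
      scaled_mat_index[OF A uv] vol_def[symmetric]
    by (simp add: real_sqrt_divide field_simps)
  finally show ?thesis by (simp add: vol_def)
qed

lemma inner_n_diff_scale_right: "inner_n n x (\<lambda>v. y v - b * z v) = inner_n n x y - b * inner_n n x z"
  by (simp add: inner_n_def algebra_simps sum_subtractf sum_distrib_left)

lemma nrm_projection_le:
  assumes "(nrm n e)\<^sup>2 = V" "V > 0"
  shows "nrm n (\<lambda>v. y v - inner_n n e y / V * e v) \<le> nrm n y"
proof (rule power2_le_imp_le)
  let ?b = "inner_n n e y / V"
  have "(nrm n (\<lambda>v. y v - ?b * e v))\<^sup>2 = (nrm n y)\<^sup>2 - 2 * ?b * inner_n n e y + ?b\<^sup>2 * (nrm n e)\<^sup>2"
    unfolding nrm_sq inner_n_def sum_distrib_left sum_subtractf[symmetric] sum.distrib[symmetric]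
    by (intro sum.cong) (auto simp: power2_eq_square algebra_simps)
  also have "\<dots> = (nrm n y)\<^sup>2 - (inner_n n e y)\<^sup>2 / V"
    using assms by (simp add: power2_eq_square field_simps)
  also have "\<dots> \<le> (nrm n y)\<^sup>2" using assms by simp
  finally show "(nrm n (\<lambda>v. y v - ?b * e v))\<^sup>2 \<le> (nrm n y)\<^sup>2" .
qed simp

section \<open>Degree weights and bounds for the modularity form\<close>

context block_approximation
begin

text \<open>Degrees are unscaled, which is why \<open>N\<close> carries an explicit
  \<open>1 / vol\<close>. \<open>D i\<close> is the degree that the block matrix assigns to a vertex
  of cluster \<open>i\<close>.\<close>

definition d :: "nat \<Rightarrow> real" where "d v = (\<Sum>u<n. a v u)"
definition D :: "nat \<Rightarrow> real" where "D i = (\<Sum>u<n. p i (c u))"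
definition vol :: real where "vol = (\<Sum>v<n. d v)"
definition w :: "nat \<Rightarrow> real" where "w v = 1 / sqrt (d v)"
definition e :: "nat \<Rightarrow> real" where "e v = sqrt (d v)"
definition N :: "nat \<Rightarrow> nat \<Rightarrow> real" where "N u v = wmat w u v - e u * e v / vol"

lemma d_ge: "v < n \<Longrightarrow> \<kappa> * n \<le> d v" by (simp add: d_def deg_ge)
lemma D_ge: "i < k \<Longrightarrow> \<kappa> * n \<le> D i" by (simp add: D_def model_deg_ge)
lemma \<kappa>n_pos: "\<kappa> * n > 0" using \<kappa>_pos n_pos by simp
lemma d_pos: "v < n \<Longrightarrow> d v > 0" using d_ge \<kappa>n_pos by fastforce
lemma D_pos: "i < k \<Longrightarrow> D i > 0" using D_ge \<kappa>n_pos by fastforce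

lemma d_le: "v < n \<Longrightarrow> d v \<le> n"
  unfolding d_def using sum_bounded_above[of "{..<n}" "a v" 1] a_01 by simp

lemma D_le: "i < k \<Longrightarrow> D i \<le> n"
  unfolding D_def using sum_bounded_above[of "{..<n}" "\<lambda>u. p i (c u)" 1] p_01 c_less by simp

lemma vol_pos: "vol > 0"
  unfolding vol_def using d_pos n_pos by (intro sum_pos) auto

lemma vol_le: "vol \<le> (real n)\<^sup>2"
  unfolding vol_def using sum_bounded_above[of "{..<n}" d "real n"] d_le by (simp add: power2_eq_square)

lemma nrm_e: "(nrm n e)\<^sup>2 = vol"
  unfolding nrm_sq vol_def by (intro sum.cong) (auto simp: e_def d_pos less_imp_le)

lemma nrm_e_le: "nrm n e \<le> n"
  using nrm_e vol_le by (metis of_nat_0_le_iff power2_le_imp_le)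

lemma w_e: "v < n \<Longrightarrow> w v * e v = 1" using d_pos[of v] by (simp add: w_def e_def)
lemma w_d: "v < n \<Longrightarrow> w v * d v = e v"
  using d_pos[of v] by (simp add: w_def e_def real_div_sqrt)
lemma w_pos: "v < n \<Longrightarrow> w v > 0" using d_pos[of v] by (simp add: w_def)
lemma w_le: "v < n \<Longrightarrow> w v \<le> 1 / sqrt (\<kappa> * n)"
  using d_ge[of v] \<kappa>n_pos by (simp add: w_def frac_le)
lemma w_sq: "v < n \<Longrightarrow> (w v)\<^sup>2 = 1 / d v" using d_pos[of v] by (simp add: w_def power_divide)
lemma w_sq_le: "v < n \<Longrightarrow> (w v)\<^sup>2 \<le> 1 / (\<kappa> * n)"
  using d_ge[of v] \<kappa>n_pos by (simp add: w_sq frac_le)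
lemma w_sq_ge: "v < n \<Longrightarrow> (w v)\<^sup>2 \<ge> 1 / n"
  using d_le[of v] d_pos[of v] by (simp add: w_sq frac_le)

text \<open>Each weight is at most \<open>1 / sqrt (\<kappa> * n)\<close>, so weighting on both
  sides divides the error bound by \<open>\<kappa> * n\<close>.\<close>

lemma close_w: "op_bounded n (\<lambda>u v. w u * (a u v - p (c u) (c v)) * w v) (K / (\<kappa> * sqrt n))"
proof -
  have "op_bounded n (\<lambda>u v. w u * (a u v - p (c u) (c v)) * w v) ((1 / sqrt (\<kappa> * n))\<^sup>2 * (K * sqrt n))"
    by (rule op_bounded_scale[OF close]) (use w_le w_pos \<kappa>n_pos in \<open>auto simp: less_imp_le\<close>)
  also have "(1 / sqrt (\<kappa> * n))\<^sup>2 * (K * sqrt n) = K / (\<kappa> * sqrt n)"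
    using \<kappa>n_pos \<kappa>_pos n_pos by (simp add: power_divide field_simps)
  finally show ?thesis .
qed

lemma wmat_sym: "u < n \<Longrightarrow> v < n \<Longrightarrow> wmat w u v = wmat w v u"
  by (simp add: wmat_def a_sym mult_ac)

lemma N_sym: "u < n \<Longrightarrow> v < n \<Longrightarrow> N u v = N v u"
  by (simp add: N_def wmat_sym mult_ac)

lemma mvec_N: "mvec n N x u = mvec n (wmat w) x u - inner_n n e x / vol * e u"
  by (simp add: mvec_def N_def inner_n_def algebra_simps sum_subtractf sum_distrib_left
      sum_divide_distrib)

lemma mvec_wmat_e:
  assumes "u < n"
  shows "mvec n (wmat w) e u = e u"
proof -
  have "mvec n (wmat w) e u = (\<Sum>v<n. w u * a u v * (w v * e v))"
    by (simp add: mvec_def wmat_def mult_ac)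
  also have "\<dots> = (\<Sum>v<n. w u * a u v)" by (intro sum.cong) (auto simp: w_e)
  also have "\<dots> = e u" using w_d[OF assms] by (simp add: d_def sum_distrib_left)
  finally show ?thesis .
qed

lemma mvec_N_e: "u < n \<Longrightarrow> mvec n N e u = 0"
  using nrm_e vol_pos by (simp add: mvec_N mvec_wmat_e nrm_sq_inner)

text \<open>\<open>w\<close> and \<open>e\<close> are reciprocal, so only the class size survives.
  This is why \<open>contrast\<close> divides by class sizes.\<close>

lemma inner_wind_e: "inner_n n (wind w i) e = card (U i)"
proof -
  have "inner_n n (wind w i) e = (\<Sum>v\<in>U i. w v * e v)" by (simp add: inner_wind)
  also have "\<dots> = (\<Sum>v\<in>U i. 1)" by (intro sum.cong) (auto simp: cluster_def w_e)
  finally show ?thesis by simp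
qed

lemma nrm_wind_le: "nrm n (wind w i) \<le> sqrt (card (U i) / (\<kappa> * n))"
proof (rule nrm_leI)
  have "(\<Sum>v<n. (wind w i v)\<^sup>2) = (\<Sum>v\<in>U i. (w v)\<^sup>2)"
    by (intro sum.mono_neutral_cong_right) (auto simp: cluster_def wind_def)
  also have "\<dots> \<le> (\<Sum>v\<in>U i. 1 / (\<kappa> * n))"
    by (intro sum_mono w_sq_le) (auto simp: cluster_def)
  finally show "(\<Sum>v<n. (wind w i v)\<^sup>2) \<le> (sqrt (card (U i) / (\<kappa> * n)))\<^sup>2"
    using \<kappa>n_pos by simp
qed (use \<kappa>n_pos in auto)

text \<open>These vectors span the weighted step vectors orthogonal to \<open>e\<close>, the kernel vector of the modularity
matrix; they serve as constraints for the upper eigenvalue count and as test vectors for the lower one.\<close>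

definition contrast :: "nat \<Rightarrow> nat \<Rightarrow> real" where
  "contrast j v = wind w j v / card (U j) - wind w (k - 1) v / card (U (k - 1))"

text \<open>Orthogonality to the contrasts makes the products with \<open>wind w i\<close>
  proportional to the class sizes, which are also the products of \<open>wind w i\<close> with
  \<open>e\<close>. Subtracting a multiple \<open>\<beta> * e\<close> therefore reaches
  orthogonality to all \<open>wind w i\<close>, and \<open>N\<close> does not notice since it
  annihilates \<open>e\<close>. The subtraction may lengthen the vector, whence the factor
  \<open>1 + 1 / sqrt (\<kappa> * \<sigma>)\<close>.\<close>

lemma N_bound_on_contrast_complement:
  assumes orth: "\<And>j. j < k - 1 \<Longrightarrow> inner_n n (contrast j) x = 0"
  shows "nrm n (mvec n N x) \<le> K / (\<kappa> * sqrt n) * (1 + 1 / sqrt (\<kappa> * \<sigma>)) * nrm n x"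
proof -
  define \<epsilon> where "\<epsilon> = K / (\<kappa> * sqrt n)"
  have \<epsilon>: "\<epsilon> \<ge> 0" using K_nonneg \<kappa>_pos by (simp add: \<epsilon>_def)
  define m where "m i = real (card (U i))" for i
  have m: "m i > 0" if "i < k" for i using card_U_pos[OF that] by (simp add: m_def)
  have l: "k - 1 < k" using k_pos by simp
  define \<beta> where "\<beta> = inner_n n (wind w (k-1)) x / m (k-1)"
  have b: "inner_n n (wind w i) x = \<beta> * m i" if "i < k" for i
  proof (cases "i = k - 1")
    case True
    thus ?thesis using m[OF l] by (simp add: \<beta>_def)
  next
    case False
    have "inner_n n (contrast i) x = inner_n n (wind w i) x / m i - inner_n n (wind w (k-1)) x / m (k-1)"
      by (simp add: inner_n_def contrast_def m_def left_diff_distrib sum_subtractf sum_divide_distrib)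
    hence "inner_n n (wind w i) x / m i = \<beta>" using orth[of i] False that by (simp add: \<beta>_def)
    thus ?thesis using m[OF that] by (simp add: field_simps)
  qed
  define y where "y = (\<lambda>v. x v - \<beta> * e v)"
  have y_orth: "inner_n n (wind w i) y = 0" if "i < k" for i
    unfolding y_def by (simp add: inner_n_diff_scale_right b[OF that] inner_wind_e m_def)
  have "nrm n (mvec n N x) = nrm n (mvec n N y)"
    unfolding y_def by (rule nrm_cong) (simp add: mvec_diff mvec_scale mvec_N_e)
  also have "\<dots> = nrm n (\<lambda>v. mvec n (wmat w) y v - inner_n n e (mvec n (wmat w) y) / vol * e v)"
  proof -
    \<comment> \<open>The symmetric matrix \<open>wmat w\<close> fixes \<open>e\<close>, so the
      rank-one term of \<open>N\<close> applied to \<open>y\<close> is exactly the projection of the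
      image of \<open>y\<close> onto \<open>e\<close>.\<close>
    have "inner_n n e (mvec n (wmat w) y) = inner_n n (mvec n (wmat w) e) y"
      by (rule inner_mvec_sym[symmetric]) (rule wmat_sym)
    also have "\<dots> = inner_n n e y" by (simp add: inner_n_def mvec_wmat_e)
    finally show ?thesis by (intro nrm_cong) (simp add: mvec_N)
  qed
  also have "\<dots> \<le> nrm n (mvec n (wmat w) y)"
    by (rule nrm_projection_le[OF nrm_e vol_pos])
  also have "\<dots> \<le> \<epsilon> * nrm n y"
    unfolding \<epsilon>_def by (rule wmat_orth_bound[OF close_w y_orth])
  finally have Nx: "nrm n (mvec n N x) \<le> \<epsilon> * nrm n y" .
  have "nrm n y \<le> nrm n x + \<bar>\<beta>\<bar> * nrm n e"
    unfolding y_def by (rule order_trans[OF nrm_triangle_sub]) (simp add: nrm_scale)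
  also have "\<bar>\<beta>\<bar> * nrm n e \<le> 1 / sqrt (\<kappa> * \<sigma>) * nrm n x"
  proof -
    let ?m = "m (k-1)"
    have sm: "\<sigma> * n \<le> ?m" using card_ge[OF l] by (simp add: m_def)
    have ml: "?m > 0" using m[OF l] .
    have "\<bar>\<beta>\<bar> \<le> nrm n (wind w (k-1)) * nrm n x / ?m"
      unfolding \<beta>_def using ml abs_inner_n_le[of n "wind w (k-1)" x] by (simp add: divide_right_mono)
    also have "\<dots> \<le> sqrt (?m / (\<kappa> * n)) * nrm n x / ?m"
      using nrm_wind_le[of "k-1"] ml by (intro divide_right_mono mult_right_mono) (auto simp: m_def)
    also have "\<dots> = (sqrt ?m / ?m) * nrm n x / sqrt (\<kappa> * n)"
      by (simp add: real_sqrt_divide)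
    also have "sqrt ?m / ?m = 1 / sqrt ?m"
      using ml by (simp add: sqrt_divide_self_eq inverse_eq_divide)
    also have "1 / sqrt ?m * nrm n x / sqrt (\<kappa> * n) = nrm n x / sqrt (\<kappa> * n * ?m)"
      by (simp add: real_sqrt_mult mult_ac)
    also have "\<dots> \<le> nrm n x / sqrt (\<kappa> * n * (\<sigma> * n))"
      using sm ml \<kappa>n_pos \<sigma>_pos n_pos \<kappa>_pos
      by (intro divide_left_mono mult_pos_pos real_sqrt_le_mono mult_left_mono) (auto simp: \<kappa>n_pos)
    also have "sqrt (\<kappa> * n * (\<sigma> * n)) = sqrt (\<kappa> * \<sigma>) * n"
      using real_sqrt_mult[of "\<kappa> * \<sigma>" "real n * real n"] by (simp add: mult_ac)
    finally have "\<bar>\<beta>\<bar> * nrm n e \<le> nrm n x / (sqrt (\<kappa> * \<sigma>) * n) * n"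
      using nrm_e_le by (intro mult_mono) auto
    thus ?thesis using n_pos by simp
  qed
  finally have "nrm n y \<le> nrm n x + 1 / sqrt (\<kappa> * \<sigma>) * nrm n x" by simp
  from mult_left_mono[OF this \<epsilon>] Nx show ?thesis
    unfolding \<epsilon>_def[symmetric] by (simp add: algebra_simps)
qed

text \<open>A combination of contrasts is a weighted step vector orthogonal to \<open>e\<close>, on
  which \<open>N\<close> agrees with \<open>wmat w\<close>. Then \<open>wmat_step_bound\<close>
  applies with \<open>s = \<sigma>\<close>, as a cluster has at least \<open>\<sigma> * n\<close>
  vertices of squared weight at least \<open>1 / n\<close>.\<close>

lemma N_bound_on_contrasts:
  assumes x: "x = (\<lambda>v. \<Sum>j<k-1. t j * contrast j v)" and t: "\<exists>j<k-1. t j \<noteq> 0"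
  shows "nrm n (mvec n N x) \<ge> (\<sigma> * p0 - K / (\<kappa> * sqrt n)) * nrm n x" and "nrm n x > 0"
proof -
  define m where "m i = real (card (U i))" for i
  have m: "m i > 0" if "i < k" for i using card_U_pos[OF that] by (simp add: m_def)
  have l: "k - 1 < k" using k_pos by simp
  define \<phi> where "\<phi> i = (if i < k - 1 then t i / m i else - (\<Sum>j<k-1. t j) / m (k-1))" for i
  have x_eq: "x v = w v * \<phi> (c v)" if "v < n" for v
  proof -
    have "x v = (\<Sum>j<k-1. t j * wind w j v / m j) - (\<Sum>j<k-1. t j) * wind w (k-1) v / m (k-1)"
      unfolding x contrast_def m_def
      by (simp add: right_diff_distrib sum_subtractf sum_distrib_right sum_divide_distrib)
    also have "(\<Sum>j<k-1. t j * wind w j v / m j) = (\<Sum>j<k-1. if j = c v then w v * t j / m j else 0)"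
      by (intro sum.cong) (auto simp: wind_def)
    also have "\<dots> = (if c v < k - 1 then w v * t (c v) / m (c v) else 0)" by simp
    finally show ?thesis using c_less[OF that] by (auto simp: \<phi>_def wind_def)
  qed
  have nx: "nrm n x = nrm n (\<lambda>v. w v * \<phi> (c v))" by (rule nrm_cong) (rule x_eq)
  \<comment> \<open>As \<open>e v * w v = 1\<close>, the product with \<open>e\<close> is the sum of
    \<open>\<phi>\<close> weighted by class sizes; the value of \<open>\<phi>\<close> on the last
    cluster balances the others.\<close>
  have "inner_n n e x = (\<Sum>v<n. \<phi> (c v) * 1)"
    unfolding inner_n_def
  proof (rule sum.cong)
    fix v assume "v \<in> {..<n}"
    thus "e v * x v = \<phi> (c v) * 1" using w_e[of v] by (simp add: x_eq mult_ac)
  qed simp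
  also have "\<dots> = (\<Sum>i<k. \<phi> i * m i)" by (subst sum_cluster_step) (simp add: m_def)
  also have "{..<k} = insert (k-1) {..<k-1}" using k_pos by auto
  also have "(\<Sum>i\<in>insert (k-1) {..<k-1}. \<phi> i * m i) = \<phi> (k-1) * m (k-1) + (\<Sum>i<k-1. t i)"
  proof (subst sum.insert)
    have "(\<Sum>i<k-1. \<phi> i * m i) = (\<Sum>i<k-1. t i)"
    proof (rule sum.cong)
      fix i assume "i \<in> {..<k-1}"
      hence "i < k - 1" "i < k" by auto
      thus "\<phi> i * m i = t i" using m[of i] by (simp add: \<phi>_def)
    qed simp
    thus "\<phi> (k-1) * m (k-1) + (\<Sum>i<k-1. \<phi> i * m i) = \<phi> (k-1) * m (k-1) + (\<Sum>i<k-1. t i)" by simp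
  qed auto
  also have "\<dots> = 0" using m[OF l] by (simp add: \<phi>_def)
  finally have ortho: "inner_n n e x = 0" .
  have "nrm n (mvec n N x) = nrm n (mvec n (wmat w) x)" by (intro nrm_cong) (simp add: mvec_N ortho)
  also have "\<dots> = nrm n (mvec n (wmat w) (\<lambda>v. w v * \<phi> (c v)))"
    by (intro nrm_cong mvec_cong x_eq)
  also have "\<dots> \<ge> (\<sigma> * p0 - K / (\<kappa> * sqrt n)) * nrm n x"
    unfolding nx
  proof (rule wmat_step_bound[OF close_w])
    fix i assume i: "i < k"
    have "\<sigma> \<le> card (U i) * (1 / n)" using card_ge[OF i] n_pos by (simp add: field_simps)
    also have "\<dots> \<le> (\<Sum>v\<in>U i. (w v)\<^sup>2)"
      using sum_bounded_below[of "U i" "1 / real n" "\<lambda>v. (w v)\<^sup>2"] w_sq_ge by (auto simp: cluster_def)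
    finally show "\<sigma> \<le> (\<Sum>v\<in>U i. (w v)\<^sup>2)" .
  qed (use \<sigma>_pos in auto)
  finally show "nrm n (mvec n N x) \<ge> (\<sigma> * p0 - K / (\<kappa> * sqrt n)) * nrm n x" .
  obtain j where j: "j < k - 1" "t j \<noteq> 0" using t by auto
  hence "j < k" by simp
  then obtain v where v: "v < n" "c v = j" using U_nonempty[of j] by (auto simp: cluster_def)
  have "x v \<noteq> 0" using x_eq[OF v(1)] w_pos[OF v(1)] v j m[OF \<open>j < k\<close>] by (simp add: \<phi>_def)
  hence "nrm n x \<noteq> 0" using v(1) by (auto simp: L2_set_eq_0_iff)
  thus "nrm n x > 0" using L2_set_nonneg[of x "{..<n}"] by linarith
qed

section \<open>Modularity spectrum and weighted k-variance\<close>

context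
  fixes A :: "real mat" and \<delta> :: real
  assumes A: "A \<in> carrier_mat n n" and A_entries: "\<And>u v. u < n \<Longrightarrow> v < n \<Longrightarrow> A $$ (u,v) = a u v"
    and \<delta>_pos: "\<delta> > 0" and \<delta>_less: "\<delta> < \<sigma> * p0 / 2"
    and large: "K / (\<kappa> * sqrt n) * (1 + 1 / sqrt (\<kappa> * \<sigma>)) \<le> \<delta>"
begin

abbreviation "MD \<equiv> normalized_modularity A"

lemma deg_A: "v < n \<Longrightarrow> deg A v = d v"
  using A by (simp add: deg_def d_def A_entries)

lemma sum_d: "sum d {..<n} = vol" by (simp add: vol_def)

lemma MD: "MD \<in> carrier_mat n n" using A by (rule normalized_modularity_carrier)

lemma MD_entries: "u < n \<Longrightarrow> v < n \<Longrightarrow> MD $$ (u,v) = N u v"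
  by (subst normalized_modularity_index[OF A])
     (auto simp: deg_A sum_d d_pos N_def wmat_def w_def e_def A_entries)

lemma mvec_MD: "u < n \<Longrightarrow> mvec n (\<lambda>u v. MD $$ (u,v)) x u = mvec n N x u"
  by (simp add: mvec_def MD_entries)

lemma nrm_mvec_MD: "nrm n (mvec n (\<lambda>u v. MD $$ (u,v)) x) = nrm n (mvec n N x)"
  by (rule nrm_cong) (simp add: mvec_MD)

lemma MD_sym: "u < n \<Longrightarrow> v < n \<Longrightarrow> MD $$ (u,v) = MD $$ (v,u)"
  by (simp add: MD_entries N_sym)

lemma \<epsilon>_less: "K / (\<kappa> * sqrt n) \<le> \<delta>"
proof -
  have "K / (\<kappa> * sqrt n) * 1 \<le> K / (\<kappa> * sqrt n) * (1 + 1 / sqrt (\<kappa> * \<sigma>))"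
    using K_nonneg \<kappa>_pos \<sigma>_pos by (intro mult_left_mono) auto
  thus ?thesis using large by linarith
qed

lemma size_eigvals_modularity_le:
  "size {#l \<in># eigvals_mset MD. \<bar>l\<bar> > K / (\<kappa> * sqrt n) * (1 + 1 / sqrt (\<kappa> * \<sigma>))#} \<le> k - 1"
proof (rule size_large_eigvals_le[OF MD MD_sym, where f = contrast])
  fix x assume "\<And>j. j < k - 1 \<Longrightarrow> inner_n n (contrast j) x = 0"
  thus "nrm n (mvec n (\<lambda>u v. MD $$ (u,v)) x) \<le> K / (\<kappa> * sqrt n) * (1 + 1 / sqrt (\<kappa> * \<sigma>)) * nrm n x"
    unfolding nrm_mvec_MD by (rule N_bound_on_contrast_complement)
qed (use K_nonneg \<kappa>_pos \<sigma>_pos in auto)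

lemma size_eigvals_modularity_ge: "k - 1 \<le> size {#l \<in># eigvals_mset MD. \<bar>l\<bar> > \<delta>#}"
proof (rule size_large_eigvals_ge[OF MD MD_sym, where g = contrast])
  fix t :: "nat \<Rightarrow> real" assume t: "\<exists>j<k-1. t j \<noteq> 0"
  note N_bound_on_contrasts[OF refl t]
  \<comment> \<open>Both \<open>\<delta>\<close> and the error are below half of
    \<open>\<sigma> * p0\<close>.\<close>
  moreover have "\<delta> < \<sigma> * p0 - K / (\<kappa> * sqrt n)" using \<epsilon>_less \<delta>_less by linarith
  ultimately show "\<delta> * nrm n (\<lambda>v. \<Sum>j<k-1. t j * contrast j v)
      < nrm n (mvec n (\<lambda>u v. MD $$ (u,v)) (\<lambda>v. \<Sum>j<k-1. t j * contrast j v))"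
    unfolding nrm_mvec_MD by (meson mult_strict_right_mono order_less_le_trans)
qed (use \<delta>_pos in auto)

text \<open>The squeeze of the adjacency case again: counts \<open>k - 1\<close> from both sides
  leave no eigenvalue between the bulk bound and \<open>\<delta>\<close>.\<close>

lemma structural_eigvals_modularity:
  defines "L \<equiv> {#l \<in># eigvals_mset MD. \<bar>l\<bar> > \<delta>#}"
  shows "size L = k - 1"
    and "\<forall>l \<in># eigvals_mset MD - L. \<bar>l\<bar> \<le> K / (\<kappa> * sqrt n) * (1 + 1 / sqrt (\<kappa> * \<sigma>))"
proof -
  let ?t = "K / (\<kappa> * sqrt n) * (1 + 1 / sqrt (\<kappa> * \<sigma>))"
  let ?L = "{#l \<in># eigvals_mset MD. \<bar>l\<bar> > ?t#}"
  have 2: "L \<subseteq># ?L"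
    unfolding L_def using large by (intro mset_subset_eqI) auto
  have sz: "k - 1 \<le> size L" "size L \<le> size ?L" "size ?L \<le> k - 1"
    using size_mset_mono[OF 2] size_eigvals_modularity_le size_eigvals_modularity_ge by (auto simp: L_def)
  thus "size L = k - 1" by simp
  have "L = ?L"
  proof (rule ccontr)
    assume "L \<noteq> ?L"
    with 2 have "L \<subset># ?L" by (simp add: subset_mset.le_neq_trans)
    from mset_subset_size[OF this] sz show False by linarith
  qed
  hence "eigvals_mset MD - L = {#l \<in># eigvals_mset MD. \<not> \<bar>l\<bar> > ?t#}"
    by (metis add_diff_cancel_left' multiset_partition)
  thus "\<forall>l \<in># eigvals_mset MD - L. \<bar>l\<bar> \<le> ?t" by auto
qed

text \<open>The eigenvector equation puts \<open>u\<close> near \<open>f\<^sub>c / \<surd>d\<close> with a step vector \<open>f\<close>, while the weighted variance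
measures the distance to vectors \<open>\<surd>d \<beta>\<^sub>c\<close>; the two differ by the relative deviation of \<open>d\<close> from the
model degrees, which is small in \<open>\<ell>\<^sup>2\<close>.\<close>

lemma eigenvector_near_step:
  assumes u1: "nrm n u = 1" and ev: "\<And>v. v < n \<Longrightarrow> mvec n N u v = l * u v" and l: "\<bar>l\<bar> > \<delta>"
  shows "\<exists>\<beta>. (\<Sum>v<n. (u v - e v * \<beta> (c v))\<^sup>2) \<le> ((1 / \<kappa> + 1 / \<kappa>\<^sup>2) * K / \<delta>)\<^sup>2 / n"
proof -
  have l0: "l \<noteq> 0" using l \<delta>_pos by auto
  \<comment> \<open>An eigenvector with nonzero eigenvalue is orthogonal to the kernel vector
    \<open>e\<close>, so the rank-one term vanishes in its equation.\<close>
  have "l * inner_n n e u = inner_n n e (mvec n N u)"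
    by (simp add: inner_n_def ev sum_distrib_left mult_ac)
  also have "\<dots> = inner_n n (mvec n N e) u"
    by (rule inner_mvec_sym[symmetric]) (rule N_sym)
  also have "\<dots> = 0" by (simp add: inner_n_def mvec_N_e)
  finally have eu: "inner_n n e u = 0" using l0 by simp
  have ev': "mvec n (wmat w) u v = l * u v" if "v < n" for v
    using ev[OF that] by (simp add: mvec_N eu)
  define f where "f i = (\<Sum>v<n. p i (c v) * (w v * u v))" for i
  define \<beta> where "\<beta> i = f i / (l * D i)" for i
  define E where "E = mvec n (\<lambda>u v. w u * (a u v - p (c u) (c v)) * w v) u"
  define F where "F = mvec n (\<lambda>u v. a u v - p (c u) (c v)) (\<lambda>_. 1)"
  have F: "F v = d v - D (c v)" for v
    by (simp add: F_def mvec_def d_def D_def sum_subtractf)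
  define h where "h v = w v * f (c v) / D (c v)" for v
  \<comment> \<open>Since \<open>e v = w v * d v\<close>, the block part
    \<open>w v * f (c v)\<close> turns into \<open>l * (e v * \<beta> (c v))\<close> when the model
    degree \<open>D (c v)\<close> is replaced by \<open>d v\<close>; the correction is
    \<open>h v * F v\<close>.\<close>
  have eq: "u v - e v * \<beta> (c v) = (1 / l) * (E v - h v * F v)" if v: "v < n" for v
  proof -
    have "l * u v = E v + w v * f (c v)"
      using ev'[OF v] mvec_wmat_decomp[OF v, of w u] by (simp add: E_def f_def)
    moreover have "h v * F v = w v * d v * f (c v) / D (c v) - w v * f (c v)"
      using D_pos[OF c_less[OF v]] unfolding F h_def by (simp add: right_diff_distrib diff_divide_distrib)
    moreover have "l * (e v * \<beta> (c v)) = w v * d v * f (c v) / D (c v)"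
      using l0 by (simp add: w_d[OF v] \<beta>_def)
    ultimately have "l * (u v - e v * \<beta> (c v)) = E v - h v * F v" by (simp add: right_diff_distrib)
    thus ?thesis using l0 by (simp add: field_simps)
  qed
  have "nrm n w \<le> 1 / sqrt \<kappa>"
  proof (rule nrm_leI)
    have "(\<Sum>v<n. (w v)\<^sup>2) \<le> (\<Sum>v<n. 1 / (\<kappa> * n))" by (intro sum_mono w_sq_le) auto
    thus "(\<Sum>v<n. (w v)\<^sup>2) \<le> (1 / sqrt \<kappa>)\<^sup>2" using n_pos \<kappa>_pos by (simp add: power_divide)
  qed (use \<kappa>_pos in auto)
  have f: "\<bar>f i\<bar> \<le> 1 / sqrt \<kappa>" if "i < k" for i
  proof -
    have "\<bar>f i\<bar> \<le> (\<Sum>v<n. \<bar>w v\<bar> * \<bar>u v\<bar>)"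
      unfolding f_def
    proof (intro order_trans[OF sum_abs] sum_mono)
      fix v assume "v \<in> {..<n}"
      hence "\<bar>p i (c v)\<bar> * (\<bar>w v\<bar> * \<bar>u v\<bar>) \<le> 1 * (\<bar>w v\<bar> * \<bar>u v\<bar>)"
        using p_01[OF that c_less] by (intro mult_right_mono) auto
      thus "\<bar>p i (c v) * (w v * u v)\<bar> \<le> \<bar>w v\<bar> * \<bar>u v\<bar>" by (simp add: abs_mult)
    qed
    also have "\<dots> \<le> nrm n w * nrm n u" by (rule L2_set_mult_ineq)
    finally show ?thesis using \<open>nrm n w \<le> 1 / sqrt \<kappa>\<close> u1 by simp
  qed
  let ?g = "1 / (\<kappa> * sqrt n) * (1 / (\<kappa> * n))"
  have h: "\<bar>h v\<bar> \<le> ?g" if v: "v < n" for v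
  proof -
    have "\<bar>h v\<bar> = w v * \<bar>f (c v)\<bar> * (1 / D (c v))"
      using w_pos[OF v] D_pos[OF c_less[OF v]] by (simp add: h_def abs_mult)
    also have "\<dots> \<le> (1 / sqrt (\<kappa> * n)) * (1 / sqrt \<kappa>) * (1 / (\<kappa> * n))"
      using w_le[OF v] w_pos[OF v] f[OF c_less[OF v]] D_ge[OF c_less[OF v]] D_pos[OF c_less[OF v]] \<kappa>n_pos \<kappa>_pos
      by (intro mult_mono frac_le) auto
    also have "(1 / sqrt (\<kappa> * n)) * (1 / sqrt \<kappa>) = 1 / (\<kappa> * sqrt n)"
      using \<kappa>_pos by (simp add: real_sqrt_mult)
    finally show ?thesis .
  qed
  \<comment> \<open>Degree deviations are the error matrix applied to the all-one vector. Their l2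
    bound of order \<open>n\<close> is better than summing vertexwise bounds
    \<open>n powr (3/4)\<close>, which would give \<open>n powr (5/4)\<close>.\<close>
  have "nrm n F \<le> K * sqrt n * nrm n (\<lambda>_. 1)"
    unfolding F_def by (rule op_bounded_mvec[OF close])
  also have "nrm n (\<lambda>_. 1) = sqrt n" by (simp add: L2_set_def)
  finally have nF: "nrm n F \<le> K * n" by (simp add: mult.assoc)
  have "nrm n (\<lambda>v. E v - h v * F v) \<le> nrm n E + nrm n (\<lambda>v. h v * F v)"
    by (rule nrm_triangle_sub)
  also have "nrm n E \<le> K / (\<kappa> * sqrt n) * nrm n u"
    unfolding E_def by (rule op_bounded_mvec[OF close_w])
  also have "nrm n (\<lambda>v. h v * F v) \<le> ?g * nrm n F"
    using \<kappa>n_pos \<kappa>_pos by (intro nrm_mult_le h) auto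
  also have "\<dots> \<le> ?g * (K * n)"
    using nF \<kappa>n_pos \<kappa>_pos by (intro mult_left_mono) auto
  also have "?g * (K * n) = K / (\<kappa>\<^sup>2 * sqrt n)"
    using n_pos \<kappa>_pos by (simp add: power2_eq_square)
  finally have EF: "nrm n (\<lambda>v. E v - h v * F v) \<le> (1 / \<kappa> + 1 / \<kappa>\<^sup>2) * K / sqrt n"
    using u1 by (simp add: algebra_simps add_divide_distrib)
  have "nrm n (\<lambda>v. u v - e v * \<beta> (c v)) = \<bar>1 / l\<bar> * nrm n (\<lambda>v. E v - h v * F v)"
    unfolding nrm_scale[symmetric] by (rule nrm_cong) (rule eq)
  also have "\<dots> \<le> (1 / \<delta>) * ((1 / \<kappa> + 1 / \<kappa>\<^sup>2) * K / sqrt n)"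
    using l \<delta>_pos EF by (intro mult_mono) (auto intro: frac_le)
  also have "\<dots> = (1 / \<kappa> + 1 / \<kappa>\<^sup>2) * K / \<delta> / sqrt n" by simp
  finally have "(nrm n (\<lambda>v. u v - e v * \<beta> (c v)))\<^sup>2 \<le> ((1 / \<kappa> + 1 / \<kappa>\<^sup>2) * K / \<delta> / sqrt n)\<^sup>2"
    by (intro power_mono) auto
  hence "(\<Sum>v<n. (u v - e v * \<beta> (c v))\<^sup>2) \<le> ((1 / \<kappa> + 1 / \<kappa>\<^sup>2) * K / \<delta>)\<^sup>2 / n"
    unfolding nrm_sq power_divide[of _ "sqrt n"] by simp
  thus ?thesis by blast
qed

lemma weighted_k_variance_le:
  assumes us: "orthonormal_eigenvectors MD L us" and sz: "size L = k - 1"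
    and L: "\<And>l. l \<in># L \<Longrightarrow> \<bar>l\<bar> > \<delta>"
  shows "weighted_k_variance k A us \<le> k * ((1 / \<kappa> + 1 / \<kappa>\<^sup>2) * K / \<delta>)\<^sup>2 / n"
proof -
  obtain ls where ls: "mset ls = L" "length us = length ls" "set us \<subseteq> carrier_vec n"
    "\<And>j. j < length ls \<Longrightarrow> nrm n (\<lambda>v. us ! j $ v) = 1"
    "\<And>j u. j < length ls \<Longrightarrow> u < n \<Longrightarrow> mvec n (\<lambda>u v. MD $$ (u,v)) (\<lambda>v. us ! j $ v) u = ls ! j * us ! j $ u"
    using orthonormal_eigenvectorsD[OF us MD] by blast
  have len: "length ls = k - 1" using ls(1) sz by (metis size_mset)
  define B where "B = ((1 / \<kappa> + 1 / \<kappa>\<^sup>2) * K / \<delta>)\<^sup>2 / n"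
  have "\<exists>\<beta>. (\<Sum>v<n. (us ! j $ v - e v * \<beta> (c v))\<^sup>2) \<le> B" if "j < k - 1" for j
    unfolding B_def
  proof (rule eigenvector_near_step[where l = "ls ! j"])
    show "\<bar>ls ! j\<bar> > \<delta>" using L ls(1) len that by (metis nth_mem_mset)
  qed (use ls(4,5)[of j] len that in \<open>auto simp: mvec_MD\<close>)
  then obtain \<beta> where \<beta>: "\<And>j. j < k - 1 \<Longrightarrow> (\<Sum>v<n. (us ! j $ v - e v * \<beta> j (c v))\<^sup>2) \<le> B"
    by metis
  let ?S = "scaled_mat A"
  let ?R = "inv_sqrt_deg ?S * mat_of_cols n us"
  have dS: "dim_row ?S = n" using A by (simp add: scaled_mat_def)
  have M: "mat_of_cols n us \<in> carrier_mat n (k - 1)" using len ls(2) by (metis mat_of_cols_carrier(1))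
  have R: "?R \<in> carrier_mat n (k - 1)"
    unfolding inv_sqrt_deg_def dS using M mat_diag_dim by (rule mult_carrier_mat[rotated])
  have R_ij: "?R $$ (v,j) = 1 / sqrt (d v / vol) * us ! j $ v" if "v < n" "j < k - 1" for v j
    unfolding inv_sqrt_deg_def dS using that len ls(2)
    by (subst mat_diag_mult_left[OF M]) (simp add: deg_scaled_mat[OF A] deg_A sum_d mat_of_cols_index)
  have degS: "deg ?S v = d v / vol" if "v < n" for v
    using that by (simp add: deg_scaled_mat[OF A] deg_A sum_d)
  have "weighted_k_variance k A us = min_variance k (deg ?S) ?R"
    by (simp add: weighted_k_variance_def Let_def dS)
  \<comment> \<open>The scaled degrees are \<open>d v / vol\<close>, so the centers need a factor
    \<open>sqrt vol\<close>; with it the weighted distances become those of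
    \<open>eigenvector_near_step\<close>.\<close>
  also have "\<dots> \<le> (\<Sum>j<k-1. \<Sum>v<n. deg ?S v * (?R $$ (v,j) - sqrt vol * \<beta> j (c v))\<^sup>2)"
    using d_pos vol_pos degS by (intro min_variance_le[OF R]) auto
  also have "\<dots> = (\<Sum>j<k-1. \<Sum>v<n. (us ! j $ v - e v * \<beta> j (c v))\<^sup>2)"
  proof (intro sum.cong refl)
    fix j v assume jv: "j \<in> {..<k-1}" "v \<in> {..<n}"
    hence v: "v < n" by simp
    have dv: "d v > 0" using d_pos[OF v] .
    have "deg ?S v * (?R $$ (v,j) - sqrt vol * \<beta> j (c v))\<^sup>2
        = (sqrt (d v / vol) * (1 / sqrt (d v / vol) * us ! j $ v - sqrt vol * \<beta> j (c v)))\<^sup>2"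
      using jv dv vol_pos by (simp add: degS R_ij power_mult_distrib)
    also have "sqrt (d v / vol) * (1 / sqrt (d v / vol) * us ! j $ v - sqrt vol * \<beta> j (c v))
        = us ! j $ v - e v * \<beta> j (c v)"
      using dv vol_pos by (simp add: e_def real_sqrt_divide right_diff_distrib)
    finally show "deg ?S v * (?R $$ (v,j) - sqrt vol * \<beta> j (c v))\<^sup>2 = (us ! j $ v - e v * \<beta> j (c v))\<^sup>2" .
  qed
  also have "\<dots> \<le> (\<Sum>j<k-1. B)" by (intro sum_mono \<beta>) auto
  also have "\<dots> \<le> k * B" by (simp add: B_def divide_right_mono mult_right_mono)
  finally show ?thesis by (simp add: B_def)
qed

end

end

section \<open>Discrepancy\<close>

text \<open>Averaging over the \<open>m\<close> classes; dividing by \<open>k\<close> instead of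
  \<open>m\<close> keeps the bound uniform in \<open>m\<close>.\<close>

lemma parts_of_card_le:
  assumes "Q \<in> parts_of n m" "k > 0" "m < k" "X \<subseteq> {..<n}" "X \<noteq> {}"
  shows "\<exists>B\<in>Q. real (card (X \<inter> B)) \<ge> real (card X) / real k"
proof (rule ccontr)
  assume neg: "\<not> ?thesis"
  have Q: "partition_on {..<n} Q" "card Q = m" using assms(1) by (auto simp: parts_of_def)
  have fX: "finite X" using assms(4) finite_subset by blast
  have "finite Q" using Q(1) finite_elements[of "{..<n}" Q] by simp
  have "X = (\<Union>B\<in>Q. X \<inter> B)" using assms(4) Q(1) by (auto simp: partition_on_def)
  hence "card X = card (\<Union>B\<in>Q. X \<inter> B)" by simp
  also have "\<dots> \<le> (\<Sum>B\<in>Q. card (X \<inter> B))" using \<open>finite Q\<close> by (rule card_UN_le)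
  finally have "real (card X) \<le> (\<Sum>B\<in>Q. real (card (X \<inter> B)))"
    by (metis of_nat_le_iff of_nat_sum)
  also have "\<dots> \<le> (\<Sum>B\<in>Q. real (card X) / real k)"
    using neg by (intro sum_mono) (auto simp: not_le less_imp_le)
  also have "\<dots> = real (card X) * (m / k)" using Q(2) by simp
  also have "\<dots> < real (card X) * 1"
    using assms fX by (intro mult_strict_left_mono) (auto simp: card_gt_0_iff)
  finally show False by simp
qed

lemma nrm_indicator:
  assumes "X \<subseteq> {..<n}"
  shows "nrm n (indicator X) = sqrt (card X)"
proof -
  have "(\<Sum>i<n. (indicator X i :: real)\<^sup>2) = (\<Sum>i\<in>X. 1)"
    using assms by (intro sum.mono_neutral_cong_right) (auto simp: indicator_def)
  thus ?thesis by (simp add: L2_set_def)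
qed

text \<open>The form at two indicators: an expander mixing bound for the error matrix.\<close>

lemma op_bounded_cut:
  assumes W: "op_bounded n W T" and XY: "X \<subseteq> {..<n}" "Y \<subseteq> {..<n}"
  shows "\<bar>\<Sum>u\<in>X. \<Sum>v\<in>Y. W u v\<bar> \<le> T * sqrt (card X) * sqrt (card Y)"
proof -
  have "(\<Sum>u\<in>X. \<Sum>v\<in>Y. W u v) = (\<Sum>u<n. \<Sum>v<n. indicator X u * W u v * indicator Y v)"
  proof (rule sum.mono_neutral_cong_left)
    fix u assume u: "u \<in> X"
    show "(\<Sum>v\<in>Y. W u v) = (\<Sum>v<n. indicator X u * W u v * indicator Y v)"
      using XY u by (intro sum.mono_neutral_cong_left) auto
    next show "\<forall>u\<in>{..<n} - X. (\<Sum>v<n. indicator X u * W u v * indicator Y v) = 0" by simp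
  qed (use XY in auto)
  thus ?thesis using op_boundedD[OF W, of "indicator X" "indicator Y"] XY
    by (simp add: nrm_indicator)
qed

section \<open>Cuts and volumes compared with the block model\<close>

context block_approximation
begin

definition E :: "nat set \<Rightarrow> nat set \<Rightarrow> real" where "E X Y = (\<Sum>u\<in>X. \<Sum>v\<in>Y. a u v)"
definition V :: "nat set \<Rightarrow> real" where "V X = (\<Sum>v\<in>X. d v)"
text \<open>The model value of cut over product of volumes: the model volume of
  \<open>X \<subseteq> U i\<close> is \<open>D i * card X\<close>, so the sizes of the two sets
  cancel.\<close>

definition \<beta> :: "nat \<Rightarrow> nat \<Rightarrow> real" where "\<beta> i j = p i j / (D i * D j)"
text \<open>In \<open>cut_volume_close\<close> the \<open>1\<close> pays for the cut and
  \<open>2 / \<kappa>\<^sup>2\<close> for exchanging the two model volumes for actual ones.\<close>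

definition K' :: real where "K' = K * (1 + 2 / \<kappa>\<^sup>2)"
definition disc :: "nat set \<Rightarrow> nat set \<Rightarrow> nat set \<Rightarrow> nat set \<Rightarrow> real" where
  "disc B C X Y = \<bar>E X Y / (V X * V Y) - E B C / (V B * V C)\<bar> * sqrt (V X * V Y)"

lemma K'_nonneg: "K' \<ge> 0" using K_nonneg \<kappa>_pos by (simp add: K'_def)

lemma V_ge: "X \<subseteq> {..<n} \<Longrightarrow> V X \<ge> \<kappa> * n * card X"
  unfolding V_def using sum_bounded_below[of X "\<kappa> * n" d] d_ge by (auto simp: mult_ac)

lemma V_le: "X \<subseteq> {..<n} \<Longrightarrow> V X \<le> n * card X"
  unfolding V_def using sum_bounded_above[of X d "real n"] d_le by (auto simp: mult_ac)

lemma V_nonneg: "X \<subseteq> {..<n} \<Longrightarrow> V X \<ge> 0"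
  unfolding V_def using d_pos by (intro sum_nonneg) (auto intro: less_imp_le)

lemma V_pos: "X \<subseteq> {..<n} \<Longrightarrow> X \<noteq> {} \<Longrightarrow> V X > 0"
  unfolding V_def using d_pos finite_subset[of X "{..<n}"] by (intro sum_pos) auto

lemma V_mono: "X \<subseteq> Y \<Longrightarrow> Y \<subseteq> {..<n} \<Longrightarrow> V X \<le> V Y"
  unfolding V_def using d_pos finite_subset[of Y "{..<n}"] by (intro sum_mono2) (auto intro: less_imp_le)

lemma V_close:
  assumes X: "X \<subseteq> U i"
  shows "\<bar>V X - D i * card X\<bar> \<le> K * n * sqrt (card X)"
proof -
  have Xn: "X \<subseteq> {..<n}" using X U_subset by blast
  have "(\<Sum>u\<in>X. \<Sum>v\<in>{..<n}. a u v - p (c u) (c v)) = (\<Sum>u\<in>X. d u - D i)"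
    using X by (intro sum.cong refl) (auto simp: cluster_def d_def D_def sum_subtractf)
  also have "\<dots> = V X - D i * card X" by (simp add: V_def sum_subtractf)
  finally have "\<bar>V X - D i * card X\<bar> \<le> K * sqrt n * sqrt (card X) * sqrt n"
    using op_bounded_cut[OF close Xn, of "{..<n}"] by simp
  also have "\<dots> = K * (sqrt n * sqrt n) * sqrt (card X)" by (simp only: mult_ac)
  finally show ?thesis by simp
qed

lemma E_close:
  assumes X: "X \<subseteq> U i" and Y: "Y \<subseteq> U j"
  shows "\<bar>E X Y - p i j * card X * card Y\<bar> \<le> K * sqrt n * sqrt (card X) * sqrt (card Y)"
proof -
  have Xn: "X \<subseteq> {..<n}" "Y \<subseteq> {..<n}" using X Y U_subset by blast+
  have "(\<Sum>u\<in>X. \<Sum>v\<in>Y. a u v - p (c u) (c v)) = (\<Sum>u\<in>X. \<Sum>v\<in>Y. a u v - p i j)"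
    using X Y by (intro sum.cong refl) (auto simp: cluster_def)
  also have "\<dots> = E X Y - p i j * card X * card Y"
    by (simp add: E_def sum_subtractf mult_ac)
  finally show ?thesis using op_bounded_cut[OF close Xn] by simp
qed

lemma \<beta>_nonneg: "i < k \<Longrightarrow> j < k \<Longrightarrow> \<beta> i j \<ge> 0"
  using p_01[of i j] D_pos[of i] D_pos[of j] by (simp add: \<beta>_def)

lemma \<beta>_le: "i < k \<Longrightarrow> j < k \<Longrightarrow> \<beta> i j \<le> 1 / (\<kappa> * n)\<^sup>2"
  unfolding \<beta>_def power2_eq_square using p_01[of i j] D_ge[of i] D_ge[of j] \<kappa>n_pos D_pos[of i] D_pos[of j]
  by (intro frac_le mult_mono) auto

text \<open>The error has to scale like \<open>sqrt (card X) * sqrt (card Y)\<close>, since the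
  discrepancy also ranges over tiny sets. The volumes are exchanged one at a time, and
  \<open>sqrt x + sqrt y \<le> 2 * sqrt n\<close> restores this scaling.\<close>

lemma cut_volume_close:
  assumes i: "i < k" and j: "j < k" and X: "X \<subseteq> U i" and Y: "Y \<subseteq> U j"
  shows "\<bar>E X Y - \<beta> i j * V X * V Y\<bar> \<le> K' * sqrt n * sqrt (card X) * sqrt (card Y)"
proof -
  define x where "x = real (card X)"
  define y where "y = real (card Y)"
  have Xn: "X \<subseteq> {..<n}" "Y \<subseteq> {..<n}" using X Y U_subset by blast+
  have xn: "0 \<le> x" "x \<le> n" "0 \<le> y" "y \<le> n"
    using card_mono[OF _ Xn(1)] card_mono[OF _ Xn(2)] by (auto simp: x_def y_def)
  have Dj: "D j * y \<le> n * y" "D j * y \<ge> 0" using D_le[OF j] D_pos[OF j] xn by (auto intro: mult_right_mono)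
  have p: "p i j * x * y = \<beta> i j * (D i * x) * (D j * y)"
    using D_pos[OF i] D_pos[OF j] by (simp add: \<beta>_def)
  have "\<bar>(D i * x) * (D j * y) - V X * V Y\<bar>
      = \<bar>(D i * x - V X) * (D j * y) + V X * (D j * y - V Y)\<bar>" by (simp add: algebra_simps)
  also have "\<dots> \<le> \<bar>D i * x - V X\<bar> * \<bar>D j * y\<bar> + \<bar>V X\<bar> * \<bar>D j * y - V Y\<bar>"
    by (rule order_trans[OF abs_triangle_ineq]) (simp add: abs_mult)
  also have "\<dots> \<le> (K * n * sqrt x) * (n * y) + (n * x) * (K * n * sqrt y)"
    using V_close[OF X] V_close[OF Y] V_le[OF Xn(1)] V_nonneg[OF Xn(1)] Dj K_nonneg xn
    by (intro add_mono mult_mono) (auto simp: x_def y_def abs_minus_commute)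
  also have "\<dots> = K * n * n * (sqrt x * y + x * sqrt y)" by (simp add: algebra_simps)
  also have "sqrt x * y + x * sqrt y = sqrt x * (sqrt y * sqrt y) + (sqrt x * sqrt x) * sqrt y"
    using xn by simp
  also have "\<dots> = sqrt x * sqrt y * (sqrt x + sqrt y)"
    by (simp only: algebra_simps)
  also have "K * n * n * (sqrt x * sqrt y * (sqrt x + sqrt y)) \<le> K * n * n * (sqrt x * sqrt y * (2 * sqrt n))"
  proof -
    have "sqrt x + sqrt y \<le> 2 * sqrt n"
      using real_sqrt_le_mono[OF xn(2)] real_sqrt_le_mono[OF xn(4)] by linarith
    thus ?thesis using xn K_nonneg by (intro mult_left_mono) auto
  qed
  finally have diff: "\<bar>(D i * x) * (D j * y) - V X * V Y\<bar> \<le> K * n * n * (sqrt x * sqrt y * (2 * sqrt n))" .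
  have "\<bar>E X Y - \<beta> i j * V X * V Y\<bar> \<le> \<bar>E X Y - p i j * x * y\<bar> + \<bar>\<beta> i j * ((D i * x) * (D j * y) - V X * V Y)\<bar>"
    unfolding p by (simp add: algebra_simps)
  also have "\<bar>\<beta> i j * ((D i * x) * (D j * y) - V X * V Y)\<bar> \<le>
      1 / (\<kappa> * n)\<^sup>2 * (K * n * n * (sqrt x * sqrt y * (2 * sqrt n)))"
    unfolding abs_mult using \<beta>_nonneg[OF i j] \<beta>_le[OF i j] diff by (intro mult_mono) auto
  also have "\<dots> = K * (2 / \<kappa>\<^sup>2) * sqrt n * sqrt x * sqrt y"
    using n_pos by (simp add: power2_eq_square)
  also have "\<bar>E X Y - p i j * x * y\<bar> \<le> K * sqrt n * sqrt x * sqrt y"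
    unfolding x_def y_def by (rule E_close[OF X Y])
  finally show ?thesis by (simp add: K'_def x_def y_def algebra_simps)
qed

text \<open>\<open>sqrt (V X * V Y)\<close> is at least \<open>\<kappa> * n\<close> times
  \<open>sqrt (card X) * sqrt (card Y)\<close>, so the sizes cancel and the bound is uniform in the
  sets.\<close>

lemma density_close:
  assumes i: "i < k" and j: "j < k" and X: "X \<subseteq> U i" "X \<noteq> {}" and Y: "Y \<subseteq> U j" "Y \<noteq> {}"
  shows "\<bar>E X Y / (V X * V Y) - \<beta> i j\<bar> * sqrt (V X * V Y) \<le> K' / (\<kappa> * sqrt n)"
proof -
  have Xn: "X \<subseteq> {..<n}" "Y \<subseteq> {..<n}" using X Y U_subset by blast+
  define s where "s = sqrt (V X * V Y)"
  have pos: "V X > 0" "V Y > 0" using V_pos Xn X(2) Y(2) by auto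
  hence s: "s > 0" "V X * V Y = s * s" by (auto simp: s_def)
  define t where "t = sqrt (card X) * sqrt (card Y)"
  have "finite X" "finite Y" using Xn finite_subset by blast+
  hence t: "t > 0" using X(2) Y(2) by (auto simp: t_def card_gt_0_iff)
  have "(\<kappa> * n * card X) * (\<kappa> * n * card Y) \<le> V X * V Y"
    using V_ge[OF Xn(1)] V_ge[OF Xn(2)] pos \<kappa>n_pos by (intro mult_mono) auto
  hence "sqrt ((\<kappa> * n * card X) * (\<kappa> * n * card Y)) \<le> s" unfolding s_def by (rule real_sqrt_le_mono)
  also have "(\<kappa> * n * card X) * (\<kappa> * n * card Y) = (\<kappa> * n)\<^sup>2 * (card X * card Y)"
    by (simp add: power2_eq_square mult_ac)
  also have "sqrt \<dots> = \<kappa> * n * t" using \<kappa>n_pos by (simp add: t_def real_sqrt_mult)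
  finally have st: "\<kappa> * n * t \<le> s" .
  have "E X Y / (V X * V Y) - \<beta> i j = (E X Y - \<beta> i j * V X * V Y) / (s * s)"
    unfolding s(2)[symmetric] using pos by (simp add: field_simps)
  hence "\<bar>E X Y / (V X * V Y) - \<beta> i j\<bar> * s = \<bar>E X Y - \<beta> i j * V X * V Y\<bar> / s"
    using s(1) by (simp add: abs_mult)
  also have "\<dots> \<le> (K' * sqrt n * t) / s"
    using cut_volume_close[OF i j X(1) Y(1)] s(1) by (intro divide_right_mono) (auto simp: t_def mult_ac)
  also have "\<dots> \<le> (K' * sqrt n * t) / (\<kappa> * n * t)"
    using st t \<kappa>_pos n_pos K'_nonneg s(1) by (intro divide_left_mono mult_pos_pos) auto
  also have "\<dots> = K' * (sqrt n / n) / \<kappa>" using t by simp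
  also have "\<dots> = K' / (\<kappa> * sqrt n)" using n_pos by (simp add: sqrt_divide_self_eq inverse_eq_divide mult_ac)
  finally show ?thesis by (simp add: s_def)
qed

text \<open>Both densities are near \<open>\<beta> i j\<close>. The reference pair has the larger
  volumes, so its own bound remains valid with the smaller root of \<open>V X * V Y\<close>. If a
  set is empty, the volume factor is zero.\<close>

lemma disc_clusters_le:
  assumes i: "i < k" and j: "j < k" and X: "X \<subseteq> U i" and Y: "Y \<subseteq> U j"
  shows "disc (U i) (U j) X Y \<le> 2 * K' / (\<kappa> * sqrt n)"
proof (cases "X = {} \<or> Y = {}")
  case True
  thus ?thesis using K'_nonneg \<kappa>_pos by (auto simp: disc_def V_def)
next
  case False
  let ?R = "E X Y / (V X * V Y)" and ?R' = "E (U i) (U j) / (V (U i) * V (U j))"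
  let ?s = "sqrt (V X * V Y)" and ?s' = "sqrt (V (U i) * V (U j))"
  have Xn: "X \<subseteq> {..<n}" "Y \<subseteq> {..<n}" using X Y U_subset by blast+
  have "?s \<le> ?s'"
    using V_mono[OF X U_subset] V_mono[OF Y U_subset] V_nonneg[OF Xn(1)] V_nonneg[OF Xn(2)]
    by (intro real_sqrt_le_mono mult_mono) (auto intro: order_trans)
  have "disc (U i) (U j) X Y \<le> (\<bar>?R - \<beta> i j\<bar> + \<bar>?R' - \<beta> i j\<bar>) * ?s"
    unfolding disc_def using V_nonneg[OF Xn(1)] V_nonneg[OF Xn(2)] by (intro mult_right_mono) auto
  also have "\<dots> \<le> \<bar>?R - \<beta> i j\<bar> * ?s + \<bar>?R' - \<beta> i j\<bar> * ?s'"
    using \<open>?s \<le> ?s'\<close> by (simp add: distrib_right mult_left_mono)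
  also have "\<dots> \<le> K' / (\<kappa> * sqrt n) + K' / (\<kappa> * sqrt n)"
    using False U_nonempty i j X Y by (intro add_mono density_close) auto
  finally show ?thesis by simp
qed

section \<open>Multiway discrepancy of the clusters and of coarser partitions\<close>

context
  fixes A :: "real mat"
  assumes A: "A \<in> carrier_mat n n" and A_entries: "\<And>u v. u < n \<Longrightarrow> v < n \<Longrightarrow> A $$ (u,v) = a u v"
begin

lemma degree_A: "v < n \<Longrightarrow> deg A v = d v"
  using A by (simp add: deg_def d_def A_entries)

lemma sum_degree_A: "(\<Sum>v<n. deg A v) = vol" by (simp add: vol_def degree_A)

lemma rho_scaled:
  assumes X: "X \<subseteq> {..<n}" and Y: "Y \<subseteq> {..<n}"
  shows "cut_weight (scaled_mat A) X Y = E X Y / vol" and "Vol (scaled_mat A) X = V X / vol"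
    and "rho (scaled_mat A) X Y = vol * (E X Y / (V X * V Y))"
proof -
  have XY: "v < n" if "v \<in> X \<or> v \<in> Y" for v using X Y that by auto
  show 1: "cut_weight (scaled_mat A) X Y = E X Y / vol"
    unfolding cut_weight_def E_def sum_divide_distrib
    by (intro sum.cong refl) (simp add: scaled_mat_index[OF A] XY A_entries vol_def degree_A)
  have 2: "Vol (scaled_mat A) X = V X / vol" if "X \<subseteq> {..<n}" for X
    unfolding Vol_def V_def sum_divide_distrib
  proof (intro sum.cong refl)
    fix v assume "v \<in> X"
    hence "v < n" using that by auto
    thus "deg (scaled_mat A) v = d v / vol"
      using deg_scaled_mat[OF A, of v] sum_degree_A by (simp add: degree_A)
  qed
  show "Vol (scaled_mat A) X = V X / vol" by (rule 2[OF X])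
  show "rho (scaled_mat A) X Y = vol * (E X Y / (V X * V Y))"
    unfolding rho_def 1 2[OF X] 2[OF Y] using vol_pos by simp
qed

text \<open>Scaling multiplies densities by \<open>vol\<close> and divides the root of the volumes
  by \<open>vol\<close>, so the discrepancy can be computed from unscaled quantities.\<close>

lemma disc_eq:
  assumes "B \<subseteq> {..<n}" "C \<subseteq> {..<n}" "X \<subseteq> {..<n}" "Y \<subseteq> {..<n}"
  shows "\<bar>rho (scaled_mat A) X Y - rho (scaled_mat A) B C\<bar> *
     sqrt (Vol (scaled_mat A) X * Vol (scaled_mat A) Y) = disc B C X Y"
proof -
  have "sqrt (Vol (scaled_mat A) X * Vol (scaled_mat A) Y) = sqrt (V X * V Y) / vol"
    using vol_pos assms by (simp add: rho_scaled real_sqrt_divide real_sqrt_mult)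
  moreover have "\<bar>rho (scaled_mat A) X Y - rho (scaled_mat A) B C\<bar> =
      vol * \<bar>E X Y / (V X * V Y) - E B C / (V B * V C)\<bar>"
    unfolding rho_scaled(3)[OF assms(1,2)] rho_scaled(3)[OF assms(3,4)]
      right_diff_distrib[symmetric] abs_mult using vol_pos by simp
  ultimately show ?thesis using vol_pos by (simp add: disc_def)
qed

lemma md_eq:
  assumes Q: "partition_on {..<n} Q"
  shows "md A Q = Max ((\<lambda>(B,C,X,Y). disc B C X Y) ` {(B,C,X,Y). B \<in> Q \<and> C \<in> Q \<and> X \<subseteq> B \<and> Y \<subseteq> C})"
    and "finite {(B,C,X,Y). B \<in> Q \<and> C \<in> Q \<and> X \<subseteq> B \<and> Y \<subseteq> C}"
    and "{(B,C,X,Y). B \<in> Q \<and> C \<in> Q \<and> X \<subseteq> B \<and> Y \<subseteq> C} \<noteq> {}"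
proof -
  have sub: "B \<subseteq> {..<n}" if "B \<in> Q" for B using Q that by (auto simp: partition_on_def)
  have "{\<bar>rho (scaled_mat A) X Y - rho (scaled_mat A) B C\<bar> *
      sqrt (Vol (scaled_mat A) X * Vol (scaled_mat A) Y) | B C X Y. B \<in> Q \<and> C \<in> Q \<and> X \<subseteq> B \<and> Y \<subseteq> C}
    = {disc B C X Y | B C X Y. B \<in> Q \<and> C \<in> Q \<and> X \<subseteq> B \<and> Y \<subseteq> C}"
  proof (rule Collect_cong)
    fix z
    have "\<bar>rho (scaled_mat A) X Y - rho (scaled_mat A) B C\<bar> *
      sqrt (Vol (scaled_mat A) X * Vol (scaled_mat A) Y) = disc B C X Y"
      if "B \<in> Q \<and> C \<in> Q \<and> X \<subseteq> B \<and> Y \<subseteq> C" for B C X Y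
      using that sub by (intro disc_eq) blast+
    thus "(\<exists>B C X Y. z = \<bar>rho (scaled_mat A) X Y - rho (scaled_mat A) B C\<bar> *
      sqrt (Vol (scaled_mat A) X * Vol (scaled_mat A) Y) \<and> B \<in> Q \<and> C \<in> Q \<and> X \<subseteq> B \<and> Y \<subseteq> C)
      = (\<exists>B C X Y. z = disc B C X Y \<and> B \<in> Q \<and> C \<in> Q \<and> X \<subseteq> B \<and> Y \<subseteq> C)"
      by metis
  qed
  also have "\<dots> = (\<lambda>(B,C,X,Y). disc B C X Y) ` {(B,C,X,Y). B \<in> Q \<and> C \<in> Q \<and> X \<subseteq> B \<and> Y \<subseteq> C}"
    by (auto simp: image_iff, blast)
  finally show "md A Q = Max ((\<lambda>(B,C,X,Y). disc B C X Y) ` {(B,C,X,Y). B \<in> Q \<and> C \<in> Q \<and> X \<subseteq> B \<and> Y \<subseteq> C})"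
    by (simp add: md_def Let_def)
  have "{(B,C,X,Y). B \<in> Q \<and> C \<in> Q \<and> X \<subseteq> B \<and> Y \<subseteq> C} \<subseteq>
      Pow {..<n} \<times> Pow {..<n} \<times> Pow {..<n} \<times> Pow {..<n}" using sub by auto
  thus "finite {(B,C,X,Y). B \<in> Q \<and> C \<in> Q \<and> X \<subseteq> B \<and> Y \<subseteq> C}"
    by (rule finite_subset) simp
  have "Q \<noteq> {}" using Q n_pos by (auto simp: partition_on_def)
  thus "{(B,C,X,Y). B \<in> Q \<and> C \<in> Q \<and> X \<subseteq> B \<and> Y \<subseteq> C} \<noteq> {}" by auto
qed

lemma disc_le_md:
  assumes Q: "partition_on {..<n} Q" and "B \<in> Q" "C \<in> Q" "X \<subseteq> B" "Y \<subseteq> C"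
  shows "disc B C X Y \<le> md A Q"
  unfolding md_eq(1)[OF Q] using assms md_eq(2)[OF Q]
  by (intro Max_ge) (auto intro!: image_eqI[of _ _ "(B,C,X,Y)"])

lemma md_clusters_le: "md A (U ` {..<k}) \<le> 2 * K' / (\<kappa> * sqrt n)"
proof -
  have Q: "partition_on {..<n} (U ` {..<k})" using clusters_in_parts_of by (simp add: parts_of_def)
  show ?thesis
    unfolding md_eq(1)[OF Q] using md_eq(2,3)[OF Q] disc_clusters_le
    by (subst Max_le_iff) auto
qed

lemma md_clusters_nonneg: "md A (U ` {..<k}) \<ge> 0"
proof -
  have Q: "partition_on {..<n} (U ` {..<k})" using clusters_in_parts_of by (simp add: parts_of_def)
  have "disc (U 0) (U 0) {} {} \<le> md A (U ` {..<k})"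
    using k_pos by (intro disc_le_md[OF Q]) auto
  thus ?thesis by (simp add: disc_def V_def)
qed

text \<open>With fewer than \<open>k\<close> classes, two clusters \<open>i \<noteq> j\<close> have large parts in the same class. Small discrepancy
makes the densities from both parts to a large part of every cluster \<open>l\<close> nearly equal, so rows \<open>i\<close> and \<open>j\<close>
of \<open>p\<close>, divided by their degrees, almost agree.\<close>

lemma md_coarse_greater:
  assumes Q: "Q \<in> parts_of n m" and m: "m < k"
    and \<theta>: "K' / (\<kappa> * sqrt n) \<le> \<theta>" "4 * (real k)\<^sup>2 * \<theta> / (\<kappa> * \<sigma>) < p0"
  shows "md A Q > \<theta>"
proof (rule ccontr)
  assume "\<not> md A Q > \<theta>"
  hence md: "md A Q \<le> \<theta>" by simp
  have Q': "partition_on {..<n} Q" "card Q = m" using Q by (auto simp: parts_of_def)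
  have sub: "B \<subseteq> {..<n}" if "B \<in> Q" for B using Q'(1) that by (auto simp: partition_on_def)
  have "\<forall>i\<in>{..<k}. \<exists>B\<in>Q. real (card (U i \<inter> B)) \<ge> real (card (U i)) / real k"
    using parts_of_card_le[OF Q _ m U_subset] m U_nonempty by auto
  then obtain b where b: "\<And>i. i < k \<Longrightarrow> b i \<in> Q"
      "\<And>i. i < k \<Longrightarrow> real (card (U i \<inter> b i)) \<ge> real (card (U i)) / real k"
    by (metis lessThan_iff)
  have "finite Q" using Q'(1) finite_elements[of "{..<n}" Q] by simp
  hence "card (b ` {..<k}) \<le> m" using b(1) Q'(2) by (metis card_mono image_subsetI lessThan_iff)
  hence "\<not> inj_on b {..<k}" using m by (intro pigeonhole) simp
  then obtain i j where ij: "i < k" "j < k" "i \<noteq> j" "b i = b j" by (auto simp: inj_on_def)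
  define X where "X l = U l \<inter> b l" for l
  \<comment> \<open>At least \<open>\<sigma> * n / k\<close> vertices of degree at least
    \<open>\<kappa> * n\<close>: a lower bound for the volume of every \<open>X l\<close>.\<close>
  define v0 where "v0 = \<kappa> * n * (\<sigma> * n / k)"
  have v0: "v0 > 0" using \<kappa>n_pos \<sigma>_pos n_pos k_pos by (simp add: v0_def)
  have XU: "X l \<subseteq> U l" "X l \<subseteq> b l" for l by (auto simp: X_def)
  have Xn: "X l \<subseteq> {..<n}" for l using XU(1) U_subset by blast
  have cX: "card (X l) \<ge> \<sigma> * n / k" if "l < k" for l
    using b(2)[OF that] card_ge[OF that] k_pos unfolding X_def
    by (meson divide_right_mono of_nat_0_le_iff order_trans)
  have X0: "X l \<noteq> {}" if "l < k" for l
  proof -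
    have "card (X l) > 0" using cX[OF that] \<sigma>_pos n_pos k_pos
      by (metis divide_pos_pos less_le_trans mult_pos_pos of_nat_0_less_iff less_eq_Suc_le One_nat_def)
    thus ?thesis by auto
  qed
  have VX: "V (X l) \<ge> v0" if "l < k" for l
  proof -
    have "v0 \<le> \<kappa> * n * card (X l)" unfolding v0_def using cX[OF that] \<kappa>n_pos by (intro mult_left_mono) auto
    thus ?thesis using V_ge[OF Xn[of l]] by linarith
  qed
  have sV: "sqrt (V (X l) * V (X l')) \<ge> v0" if "l < k" "l' < k" for l l'
  proof -
    have "v0 * v0 \<le> V (X l) * V (X l')" using VX that v0 by (intro mult_mono) (auto intro: order_trans less_imp_le)
    from real_sqrt_le_mono[OF this] v0 show ?thesis by simp
  qed
  let ?R = "\<lambda>i l. E (X i) (X l) / (V (X i) * V (X l))"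
  have div: "z \<le> \<theta> / v0" if "z * s \<le> \<theta>" "s \<ge> v0" "z \<ge> 0" for z s
  proof -
    have "z * v0 \<le> \<theta>" using that mult_left_mono[of v0 s z] by linarith
    thus ?thesis using v0 by (simp add: field_simps)
  qed
  have close_\<beta>: "\<bar>?R i l - \<beta> i l\<bar> \<le> \<theta> / v0" if "i < k" "l < k" for i l
    using density_close[OF that XU(1) X0[OF that(1)] XU(1) X0[OF that(2)]] \<theta>(1) sV[OF that]
    by (intro div[of _ "sqrt (V (X i) * V (X l))"]) auto
  have close_\<rho>: "\<bar>?R i l - E (b i) (b l) / (V (b i) * V (b l))\<bar> \<le> \<theta> / v0" if "i < k" "l < k" for i l
    using disc_le_md[OF Q'(1) b(1)[OF that(1)] b(1)[OF that(2)] XU(2) XU(2)] md sV[OF that]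
    by (intro div[of _ "sqrt (V (X i) * V (X l))"]) (auto simp: disc_def)
  \<comment> \<open>This vector makes \<open>p\<close> return the difference of rows
    \<open>i\<close> and \<open>j\<close> over their model degrees. The factor \<open>n\<close>
    ensures \<open>z i \<ge> 1\<close>, because \<open>D i \<le> n\<close>.\<close>
  define z where "z l = (if l = i then n / D i else if l = j then - (n / D j) else 0)" for l
  have z: "(\<Sum>j'<k. p l j' * z j') = p i l * (n / D i) - p j l * (n / D j)" if l: "l < k" for l
  proof -
    have "(\<Sum>j'<k. p l j' * z j') = (\<Sum>j'\<in>{i,j}. p l j' * z j')"
      using ij by (intro sum.mono_neutral_right) (auto simp: z_def)
    thus ?thesis using ij l by (simp add: z_def p_sym)
  qed
  have entry: "\<bar>p i l * (n / D i) - p j l * (n / D j)\<bar> \<le> 4 * k * \<theta> / (\<kappa> * \<sigma>)" if l: "l < k" for l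
  proof -
    \<comment> \<open>Four moves of size at most \<open>\<theta> / v0\<close>: from the model
      density of \<open>i\<close> to the observed one, to the density of the pair of classes, which
      \<open>i\<close> and \<open>j\<close> share, and back for \<open>j\<close>.\<close>
    have "\<bar>\<beta> i l - \<beta> j l\<bar> \<le> 4 * (\<theta> / v0)"
      using close_\<beta>[OF ij(1) l] close_\<beta>[OF ij(2) l] close_\<rho>[OF ij(1) l] close_\<rho>[OF ij(2) l]
      unfolding ij(4) by linarith
    moreover have "p i l * (n / D i) - p j l * (n / D j) = (n * D l) * (\<beta> i l - \<beta> j l)"
      using D_pos[OF l] by (simp add: \<beta>_def right_diff_distrib mult.commute)
    moreover have "\<bar>n * D l\<bar> = n * D l" using D_pos[OF l] by simp
    ultimately have "\<bar>p i l * (n / D i) - p j l * (n / D j)\<bar> \<le> (real n * D l) * (4 * (\<theta> / v0))"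
      using D_pos[OF l] by (simp only: abs_mult[of "n * D l"]) (intro mult_left_mono, auto)
    also have "\<dots> \<le> (real n * n) * (4 * (\<theta> / v0))"
    proof (intro mult_right_mono mult_left_mono D_le l)
      have "\<theta> \<ge> 0" using \<theta>(1) K'_nonneg \<kappa>_pos by (smt (verit) divide_nonneg_nonneg mult_nonneg_nonneg of_nat_0_le_iff real_sqrt_ge_zero)
      thus "4 * (\<theta> / v0) \<ge> 0" using v0 by simp
    qed simp
    also have "\<dots> = 4 * k * \<theta> / (\<kappa> * \<sigma>)"
      using n_pos k_pos \<kappa>_pos \<sigma>_pos by (simp add: v0_def field_simps)
    finally show ?thesis .
  qed
  have "1 \<le> z i" using D_le[OF ij(1)] D_pos[OF ij(1)] by (simp add: z_def)
  hence "1 \<le> (z i)\<^sup>2" by simp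
  also have "\<dots> \<le> (\<Sum>l<k. (z l)\<^sup>2)" using ij(1) by (intro member_le_sum) auto
  finally have "p0\<^sup>2 * 1 \<le> p0\<^sup>2 * (\<Sum>l<k. (z l)\<^sup>2)" by (intro mult_left_mono) auto
  also have "\<dots> \<le> (\<Sum>l<k. (\<Sum>j'<k. p l j' * z j')\<^sup>2)" by (rule p0)
  also have "\<dots> \<le> (\<Sum>l<k. (4 * k * \<theta> / (\<kappa> * \<sigma>))\<^sup>2)"
  proof (rule sum_mono)
    fix l assume "l \<in> {..<k}"
    hence l: "l < k" by simp
    show "(\<Sum>j'<k. p l j' * z j')\<^sup>2 \<le> (4 * k * \<theta> / (\<kappa> * \<sigma>))\<^sup>2"
      unfolding z[OF l] using power_mono[OF entry[OF l], of 2] by simp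
  qed
  also have "\<dots> = k * (4 * k * \<theta> / (\<kappa> * \<sigma>))\<^sup>2" by simp
  \<comment> \<open>Enlarging \<open>k\<close> to \<open>k * k\<close> makes the right side the
    square of the quantity that the hypothesis on \<open>\<theta>\<close> bounds.\<close>
  also have "\<dots> \<le> (k * k) * (4 * k * \<theta> / (\<kappa> * \<sigma>))\<^sup>2"
    using k_pos by (intro mult_right_mono) (auto simp flip: of_nat_mult)
  also have "\<dots> = (4 * (real k)\<^sup>2 * \<theta> / (\<kappa> * \<sigma>))\<^sup>2" by (simp add: power2_eq_square)
  finally have "p0\<^sup>2 \<le> (4 * (real k)\<^sup>2 * \<theta> / (\<kappa> * \<sigma>))\<^sup>2" by simp
  moreover have "0 \<le> 4 * (real k)\<^sup>2 * \<theta> / (\<kappa> * \<sigma>)"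
  proof -
    have "\<theta> \<ge> 0" using \<theta>(1) K'_nonneg \<kappa>_pos by (smt (verit) divide_nonneg_nonneg mult_nonneg_nonneg of_nat_0_le_iff real_sqrt_ge_zero)
    thus ?thesis using \<kappa>_pos \<sigma>_pos by simp
  qed
  ultimately have "p0 \<le> 4 * (real k)\<^sup>2 * \<theta> / (\<kappa> * \<sigma>)" by (rule power2_le_imp_le)
  thus False using \<theta>(2) by simp
qed

lemma md_min_greater:
  assumes m: "1 \<le> m" "m < k"
    and \<theta>: "K' / (\<kappa> * sqrt n) \<le> \<theta>" "4 * (real k)\<^sup>2 * \<theta> / (\<kappa> * \<sigma>) < p0"
  shows "md_min m A > \<theta>"
proof -
  \<comment> \<open>Merging the clusters from \<open>m - 1\<close> on gives one partition into
    \<open>m\<close> classes; a minimum must range over a nonempty set.\<close>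
  define f where "f v = min (c v) (m - 1)" for v
  have "cluster n f ` {..<m} \<in> parts_of n m"
  proof (rule cluster_image_in_parts_of)
    fix i assume i: "i < m"
    hence "U i \<noteq> {}" using m by (intro U_nonempty) simp
    thus "cluster n f i \<noteq> {}" using i by (fastforce simp: cluster_def f_def)
  qed (use m in \<open>auto simp: f_def\<close>)
  hence ne: "parts_of n m \<noteq> {}" by auto
  have "dim_row A = n" using A by simp
  thus ?thesis unfolding md_min_def
    using ne finite_parts_of md_coarse_greater[OF _ m(2) \<theta>] by (subst Min_gr_iff) auto
qed

end

end

section \<open>Homomorphism densities\<close>

lemma sum_PiE_insert:
  fixes F :: "('b \<Rightarrow> 'c) \<Rightarrow> real"
  assumes "x \<notin> S"
  shows "(\<Sum>\<phi>\<in>insert x S \<rightarrow>\<^sub>E T. F \<phi>) = (\<Sum>u\<in>T. \<Sum>g\<in>S \<rightarrow>\<^sub>E T. F (g(x := u)))"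
proof -
  have "(\<Sum>\<phi>\<in>insert x S \<rightarrow>\<^sub>E T. F \<phi>) = (\<Sum>(u,g)\<in>T \<times> (S \<rightarrow>\<^sub>E T). F (g(x := u)))"
    unfolding PiE_insert_eq
    by (subst sum.reindex) (use inj_combinator[OF assms, of "\<lambda>_. T"] in \<open>auto simp: case_prod_unfold\<close>)
  thus ?thesis by (simp add: sum.cartesian_product)
qed

lemma prod_01:
  fixes f :: "'b \<Rightarrow> real"
  assumes "\<And>x. x \<in> S \<Longrightarrow> 0 \<le> f x \<and> f x \<le> 1"
  shows "0 \<le> prod f S \<and> prod f S \<le> 1"
  using prod_nonneg[of S f] prod_le_1[of S f] assms by auto

lemma nrm_unit_interval_le:
  assumes "\<And>u. u < n \<Longrightarrow> 0 \<le> x u \<and> x u \<le> 1"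
  shows "nrm n x \<le> sqrt n"
proof (rule nrm_leI)
  have "(\<Sum>i<n. (x i)\<^sup>2) \<le> (\<Sum>i<n. 1)"
    using assms by (intro sum_mono) (auto intro: power_le_one)
  thus "(\<Sum>i<n. (x i)\<^sup>2) \<le> (sqrt n)\<^sup>2" by simp
qed simp

text \<open>With the images of all vertices other than \<open>i\<close> and \<open>j\<close> fixed,
  no remaining factor sees both ends. The product splits into \<open>x\<close> at the image of
  \<open>i\<close> and \<open>y\<close> at the image of \<open>j\<close>, with values in the unit
  interval and so of norm at most \<open>sqrt n\<close>. Factors touching neither end go into
  \<open>x\<close>.\<close>

lemma hom_sum_single_edge_bound:
  fixes h :: "nat \<times> nat \<Rightarrow> nat \<Rightarrow> nat \<Rightarrow> real"
  assumes VF: "finite VF" "i \<in> VF" "j \<in> VF" "i \<noteq> j"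
    and W: "op_bounded n W T"
    and S: "finite S" "S \<subseteq> VF \<times> VF"
    and no_edge: "\<And>e. e \<in> S \<Longrightarrow> \<not> (i \<in> {fst e, snd e} \<and> j \<in> {fst e, snd e})"
    and h: "\<And>e u v. e \<in> S \<Longrightarrow> u < n \<Longrightarrow> v < n \<Longrightarrow> 0 \<le> h e u v \<and> h e u v \<le> 1"
  shows "\<bar>\<Sum>\<phi>\<in>VF \<rightarrow>\<^sub>E {..<n}. (\<Prod>e\<in>S. h e (\<phi> (fst e)) (\<phi> (snd e))) * W (\<phi> i) (\<phi> j)\<bar>
    \<le> T * real n ^ (card VF - 1)"
proof -
  define V' where "V' = VF - {i,j}"
  have V': "VF = insert i (insert j V')" "i \<notin> insert j V'" "j \<notin> V'" "finite V'"
    using VF by (auto simp: V'_def)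
  have cV: "card VF = card V' + 2" using V' by simp
  have T: "T \<ge> 0" using W by (rule op_bounded_nonneg)
  let ?F = "\<lambda>\<phi>. (\<Prod>e\<in>S. h e (\<phi> (fst e)) (\<phi> (snd e))) * W (\<phi> i) (\<phi> j)"
  define S2 where "S2 = {e\<in>S. j \<in> {fst e, snd e}}"
  define S1 where "S1 = S - S2"
  have S12: "S = S1 \<union> S2" "S1 \<inter> S2 = {}" "finite S1" "finite S2"
    using S by (auto simp: S1_def S2_def)
  have "(\<Sum>\<phi>\<in>VF \<rightarrow>\<^sub>E {..<n}. ?F \<phi>)
      = (\<Sum>u<n. \<Sum>v<n. \<Sum>g\<in>V' \<rightarrow>\<^sub>E {..<n}. ?F (g(j := v, i := u)))"
    unfolding V'(1) sum_PiE_insert[OF V'(2)] sum_PiE_insert[OF V'(3)] ..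
  also have "\<dots> = (\<Sum>u<n. \<Sum>g\<in>V' \<rightarrow>\<^sub>E {..<n}. \<Sum>v<n. ?F (g(j := v, i := u)))"
    by (intro sum.cong refl sum.swap)
  also have "\<dots> = (\<Sum>g\<in>V' \<rightarrow>\<^sub>E {..<n}. \<Sum>u<n. \<Sum>v<n. ?F (g(j := v, i := u)))"
    by (rule sum.swap)
  finally have eq: "(\<Sum>\<phi>\<in>VF \<rightarrow>\<^sub>E {..<n}. ?F \<phi>) =
      (\<Sum>g\<in>V' \<rightarrow>\<^sub>E {..<n}. \<Sum>u<n. \<Sum>v<n. ?F (g(j := v, i := u)))" .
  have "\<bar>\<Sum>g\<in>V' \<rightarrow>\<^sub>E {..<n}. \<Sum>u<n. \<Sum>v<n. ?F (g(j := v, i := u))\<bar> \<le> (\<Sum>g\<in>V' \<rightarrow>\<^sub>E {..<n}. T * n)"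
  proof (rule order_trans[OF sum_abs], rule sum_mono)
    fix g assume g: "g \<in> V' \<rightarrow>\<^sub>E {..<n}"
    define x where "x u = (\<Prod>e\<in>S1. h e ((g(i := u)) (fst e)) ((g(i := u)) (snd e)))" for u
    define y where "y v = (\<Prod>e\<in>S2. h e ((g(j := v)) (fst e)) ((g(j := v)) (snd e)))" for v
    have gn: "g l < n" if "l \<in> V'" for l using g that by auto
    have x01: "0 \<le> x u \<and> x u \<le> 1" if "u < n" for u
      unfolding x_def
    proof (intro prod_01 h)
      fix e assume e: "e \<in> S1"
      have "fst e \<in> VF" "snd e \<in> VF" using e S(2) by (auto simp: S1_def)
      moreover have "fst e \<noteq> j" "snd e \<noteq> j" using e by (auto simp: S1_def S2_def)
      ultimately show "(g(i := u)) (fst e) < n" "(g(i := u)) (snd e) < n"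
        using gn that V'(1) by auto
      show "e \<in> S" using e by (auto simp: S1_def)
    qed
    have S2i: "fst e \<noteq> i" "snd e \<noteq> i" "fst e \<in> VF" "snd e \<in> VF" if "e \<in> S2" for e
    proof -
      have "e \<in> S" "j \<in> {fst e, snd e}" using that by (auto simp: S2_def)
      thus "fst e \<noteq> i" "snd e \<noteq> i" "fst e \<in> VF" "snd e \<in> VF" using no_edge[of e] S(2) by auto
    qed
    have y01: "0 \<le> y v \<and> y v \<le> 1" if "v < n" for v
      unfolding y_def
    proof (intro prod_01 h)
      fix e assume e: "e \<in> S2"
      show "(g(j := v)) (fst e) < n" "(g(j := v)) (snd e) < n"
        using gn that V'(1) S2i[OF e] by auto
      show "e \<in> S" using e by (auto simp: S2_def)
    qed
    have F: "?F (g(j := v, i := u)) = x u * W u v * y v" for u v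
    proof -
      let ?\<phi> = "g(j := v, i := u)"
      have "(\<Prod>e\<in>S1. h e (?\<phi> (fst e)) (?\<phi> (snd e))) = x u"
        unfolding x_def by (rule prod.cong) (auto simp: S1_def S2_def)
      moreover have "(\<Prod>e\<in>S2. h e (?\<phi> (fst e)) (?\<phi> (snd e))) = y v"
        unfolding y_def using S2i by (intro prod.cong) auto
      moreover have "(\<Prod>e\<in>S. h e (?\<phi> (fst e)) (?\<phi> (snd e))) =
        (\<Prod>e\<in>S1. h e (?\<phi> (fst e)) (?\<phi> (snd e))) * (\<Prod>e\<in>S2. h e (?\<phi> (fst e)) (?\<phi> (snd e)))"
        unfolding S12(1) by (rule prod.union_disjoint) (use S12 in auto)
      ultimately show ?thesis using VF(4) by (simp add: mult_ac)
    qed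
    have "\<bar>\<Sum>u<n. \<Sum>v<n. ?F (g(j := v, i := u))\<bar> \<le> T * nrm n x * nrm n y"
      unfolding F by (rule op_boundedD[OF W])
    also have "\<dots> \<le> T * sqrt n * sqrt n"
      using T nrm_unit_interval_le[OF x01] nrm_unit_interval_le[OF y01]
      by (intro mult_mono) auto
    also have "\<dots> = T * n" by (simp add: mult.assoc)
    finally show "\<bar>\<Sum>u<n. \<Sum>v<n. ?F (g(j := v, i := u))\<bar> \<le> T * n" .
  qed
  also have "\<dots> = T * real n ^ (card VF - 1)"
    using V'(4) by (simp add: cV card_PiE)
  finally show ?thesis unfolding eq .
qed

text \<open>\<open>R\<close> collects the edges already exchanged, and the induction generalizes
  over it because each exchanged edge moves there. Orienting pairs by \<open>i < j\<close>
  guarantees that no other factor contains both ends of the edge under exchange.\<close>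

lemma hom_sum_swap_edges:
  fixes a b :: "nat \<Rightarrow> nat \<Rightarrow> real" and S R :: "(nat \<times> nat) set"
  assumes VF: "finite VF" and W: "op_bounded n (\<lambda>u v. a u v - b u v) T"
    and a: "\<And>u v. u < n \<Longrightarrow> v < n \<Longrightarrow> 0 \<le> a u v \<and> a u v \<le> 1"
    and b: "\<And>u v. u < n \<Longrightarrow> v < n \<Longrightarrow> 0 \<le> b u v \<and> b u v \<le> 1"
    and "finite S" "finite R" "S \<inter> R = {}" "S \<union> R \<subseteq> {(i,j). i \<in> VF \<and> j \<in> VF \<and> i < j}"
  shows "\<bar>(\<Sum>\<phi>\<in>VF \<rightarrow>\<^sub>E {..<n}. (\<Prod>(i,j)\<in>S. a (\<phi> i) (\<phi> j)) * (\<Prod>(i,j)\<in>R. b (\<phi> i) (\<phi> j)))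
     - (\<Sum>\<phi>\<in>VF \<rightarrow>\<^sub>E {..<n}. (\<Prod>(i,j)\<in>S. b (\<phi> i) (\<phi> j)) * (\<Prod>(i,j)\<in>R. b (\<phi> i) (\<phi> j)))\<bar>
     \<le> card S * (T * real n ^ (card VF - 1))"
  using assms(5-8)
proof (induction S arbitrary: R rule: finite_induct)
  case empty
  thus ?case by simp
next
  case (insert e S)
  let ?pa = "\<lambda>S \<phi>. \<Prod>(i,j)\<in>S. a (\<phi> i) (\<phi> j)"
  let ?pb = "\<lambda>S \<phi>. \<Prod>(i,j)\<in>S. b (\<phi> i) (\<phi> j)"
  let ?B = "T * real n ^ (card VF - 1)"
  obtain i j where e: "e = (i,j)" by (cases e)
  have ij: "i \<in> VF" "j \<in> VF" "i < j" using insert.prems e by auto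
  have eR: "e \<notin> R" using insert.prems by auto
  have "(\<Sum>\<phi>\<in>VF \<rightarrow>\<^sub>E {..<n}. ?pa (insert e S) \<phi> * ?pb R \<phi>) - (\<Sum>\<phi>\<in>VF \<rightarrow>\<^sub>E {..<n}. ?pb (insert e S) \<phi> * ?pb R \<phi>)
    = (\<Sum>\<phi>\<in>VF \<rightarrow>\<^sub>E {..<n}. (?pa S \<phi> * ?pb R \<phi>) * (a (\<phi> i) (\<phi> j) - b (\<phi> i) (\<phi> j)))
    + ((\<Sum>\<phi>\<in>VF \<rightarrow>\<^sub>E {..<n}. ?pa S \<phi> * ?pb (insert e R) \<phi>) - (\<Sum>\<phi>\<in>VF \<rightarrow>\<^sub>E {..<n}. ?pb S \<phi> * ?pb (insert e R) \<phi>))"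
    unfolding sum_subtractf[symmetric] sum.distrib[symmetric]
    using insert.hyps insert.prems eR by (intro sum.cong refl) (simp add: e algebra_simps)
  moreover have "\<bar>(\<Sum>\<phi>\<in>VF \<rightarrow>\<^sub>E {..<n}. ?pa S \<phi> * ?pb (insert e R) \<phi>) - (\<Sum>\<phi>\<in>VF \<rightarrow>\<^sub>E {..<n}. ?pb S \<phi> * ?pb (insert e R) \<phi>)\<bar>
      \<le> card S * ?B"
    using insert.hyps insert.prems by (intro insert.IH) auto
  moreover have "\<bar>\<Sum>\<phi>\<in>VF \<rightarrow>\<^sub>E {..<n}. (?pa S \<phi> * ?pb R \<phi>) * (a (\<phi> i) (\<phi> j) - b (\<phi> i) (\<phi> j))\<bar> \<le> ?B"
  proof -
    define h where "h e' = (if e' \<in> S then a else b)" for e' :: "nat \<times> nat"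
    have "?pa S \<phi> * ?pb R \<phi> = (\<Prod>e\<in>S \<union> R. h e (\<phi> (fst e)) (\<phi> (snd e)))" for \<phi>
    proof -
      have "(\<Prod>e\<in>S \<union> R. h e (\<phi> (fst e)) (\<phi> (snd e)))
        = (\<Prod>e\<in>S. h e (\<phi> (fst e)) (\<phi> (snd e))) * (\<Prod>e\<in>R. h e (\<phi> (fst e)) (\<phi> (snd e)))"
        using insert.hyps insert.prems by (intro prod.union_disjoint) auto
      also have "(\<Prod>e\<in>S. h e (\<phi> (fst e)) (\<phi> (snd e))) = ?pa S \<phi>"
        by (intro prod.cong) (auto simp: h_def)
      also have "(\<Prod>e\<in>R. h e (\<phi> (fst e)) (\<phi> (snd e))) = ?pb R \<phi>"
        using insert.prems by (intro prod.cong) (auto simp: h_def)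
      finally show ?thesis by simp
    qed
    moreover have "\<bar>\<Sum>\<phi>\<in>VF \<rightarrow>\<^sub>E {..<n}. (\<Prod>e\<in>S \<union> R. h e (\<phi> (fst e)) (\<phi> (snd e))) * (a (\<phi> i) (\<phi> j) - b (\<phi> i) (\<phi> j))\<bar> \<le> ?B"
    proof (rule hom_sum_single_edge_bound[OF VF ij(1,2) _ W])
      fix e' assume e': "e' \<in> S \<union> R"
      hence "fst e' < snd e'" "e' \<noteq> (i,j)" using insert.hyps insert.prems e by auto
      thus "\<not> (i \<in> {fst e', snd e'} \<and> j \<in> {fst e', snd e'})"
        using ij(3) by (cases e') auto
    next
      fix e' u v assume "u < n" "v < n"
      thus "0 \<le> h e' u v \<and> h e' u v \<le> 1" using a b by (simp add: h_def)
    qed (use insert.hyps insert.prems ij in auto)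
    ultimately show ?thesis by simp
  qed
  ultimately have "\<bar>(\<Sum>\<phi>\<in>VF \<rightarrow>\<^sub>E {..<n}. ?pa (insert e S) \<phi> * ?pb R \<phi>) - (\<Sum>\<phi>\<in>VF \<rightarrow>\<^sub>E {..<n}. ?pb (insert e S) \<phi> * ?pb R \<phi>)\<bar>
    \<le> ?B + card S * ?B" by linarith
  also have "\<dots> = card (insert e S) * ?B" using insert.hyps by (simp add: algebra_simps)
  finally show ?case .
qed

text \<open>Symmetry of both graphs lets one orientation stand for each edge, and irreflexivity of
  \<open>EF\<close> ensures that every edge has an orientation with \<open>i < j\<close>.\<close>

lemma hom_count_eq_sum:
  assumes F: "simple_graph VF EF" and E: "sym E"
  shows "real (hom_count VF EF {..<n} E) =
    (\<Sum>\<phi>\<in>VF \<rightarrow>\<^sub>E {..<n}. \<Prod>(i,j)\<in>{(i,j)\<in>EF. i < j}. if (\<phi> i, \<phi> j) \<in> E then 1 else 0)"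
proof -
  have VF: "finite VF" "EF \<subseteq> VF \<times> VF" "sym EF" "irrefl EF" using F by (auto simp: simple_graph_def)
  have fE: "finite {(i,j)\<in>EF. i < j}"
    by (rule finite_subset[of _ "VF \<times> VF"]) (use VF in auto)
  have fV: "finite (VF \<rightarrow>\<^sub>E {..<n})" using VF(1) by (intro finite_PiE) auto
  have "(\<Prod>(i,j)\<in>{(i,j)\<in>EF. i < j}. if (\<phi> i, \<phi> j) \<in> E then 1 else 0) =
      (if \<forall>(i,j)\<in>EF. (\<phi> i, \<phi> j) \<in> E then 1 else (0::real))" for \<phi>
  proof (cases "\<forall>(i,j)\<in>EF. (\<phi> i, \<phi> j) \<in> E")
    case True
    thus ?thesis by (auto intro!: prod.neutral)
  next
    case False
    then obtain i j where ij: "(i,j) \<in> EF" "(\<phi> i, \<phi> j) \<notin> E" by auto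
    have "i \<noteq> j" using ij(1) VF(4) by (auto simp: irrefl_def)
    have "(j,i) \<in> EF" "(\<phi> j, \<phi> i) \<notin> E" using ij VF(3) E by (auto simp: sym_def)
    hence "\<exists>e\<in>{(i,j)\<in>EF. i < j}. (case e of (i,j) \<Rightarrow> if (\<phi> i, \<phi> j) \<in> E then 1 else (0::real)) = 0"
    proof (cases "i < j")
      case True
      thus ?thesis using ij by (intro bexI[of _ "(i,j)"]) auto
    next
      case False
      hence "j < i" using \<open>i \<noteq> j\<close> by simp
      thus ?thesis using \<open>(j,i) \<in> EF\<close> \<open>(\<phi> j, \<phi> i) \<notin> E\<close> by (intro bexI[of _ "(j,i)"]) auto
    qed
    thus ?thesis using False fE by (simp only: prod_zero if_False)
  qed
  hence "(\<Sum>\<phi>\<in>VF \<rightarrow>\<^sub>E {..<n}. \<Prod>(i,j)\<in>{(i,j)\<in>EF. i < j}. if (\<phi> i, \<phi> j) \<in> E then 1 else 0)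
    = (\<Sum>\<phi>\<in>VF \<rightarrow>\<^sub>E {..<n}. if \<forall>(i,j)\<in>EF. (\<phi> i, \<phi> j) \<in> E then 1 else (0::real))"
    by (intro sum.cong refl) simp
  also have "\<dots> = real (hom_count VF EF {..<n} E)"
    unfolding hom_count_def using fV by (simp add: sum.If_cases Int_def)
  finally show ?thesis by simp
qed

text \<open>Maps are grouped by the clusters of their values; the maps with cluster pattern
  \<open>\<psi>\<close> form a product of clusters.\<close>

lemma sum_PiE_clusters:
  fixes G :: "(nat \<Rightarrow> nat) \<Rightarrow> real"
  assumes VF: "finite VF" and c: "\<And>v. v < n \<Longrightarrow> c v < k"
    and G: "\<And>\<phi> \<psi>. (\<And>i. i \<in> VF \<Longrightarrow> \<phi> i = \<psi> i) \<Longrightarrow> G \<phi> = G \<psi>"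
  shows "(\<Sum>\<phi>\<in>VF \<rightarrow>\<^sub>E {..<n}. G (\<lambda>i. c (\<phi> i))) =
    (\<Sum>\<psi>\<in>VF \<rightarrow>\<^sub>E {..<k}. (\<Prod>i\<in>VF. real (card (cluster n c (\<psi> i)))) * G \<psi>)"
proof -
  let ?r = "\<lambda>\<phi>. restrict (\<lambda>i. c (\<phi> i)) VF"
  have f: "finite (VF \<rightarrow>\<^sub>E {..<n})" "finite (VF \<rightarrow>\<^sub>E {..<k})" using VF by (auto intro: finite_PiE)
  have img: "?r ` (VF \<rightarrow>\<^sub>E {..<n}) \<subseteq> VF \<rightarrow>\<^sub>E {..<k}"
    by (auto intro!: c simp: PiE_iff)
  have "(\<Sum>\<phi>\<in>VF \<rightarrow>\<^sub>E {..<n}. G (\<lambda>i. c (\<phi> i))) =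
      (\<Sum>\<psi>\<in>VF \<rightarrow>\<^sub>E {..<k}. \<Sum>\<phi>\<in>{\<phi>\<in>VF \<rightarrow>\<^sub>E {..<n}. ?r \<phi> = \<psi>}. G (\<lambda>i. c (\<phi> i)))"
    by (rule sum.group[OF f img, symmetric])
  also have "\<dots> = (\<Sum>\<psi>\<in>VF \<rightarrow>\<^sub>E {..<k}. (\<Prod>i\<in>VF. real (card (cluster n c (\<psi> i)))) * G \<psi>)"
  proof (rule sum.cong)
    fix \<psi> assume \<psi>: "\<psi> \<in> VF \<rightarrow>\<^sub>E {..<k}"
    have set: "{\<phi>\<in>VF \<rightarrow>\<^sub>E {..<n}. ?r \<phi> = \<psi>} = PiE VF (\<lambda>i. cluster n c (\<psi> i))"
    proof (intro equalityI subsetI)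
      fix \<phi> assume \<phi>: "\<phi> \<in> {\<phi>\<in>VF \<rightarrow>\<^sub>E {..<n}. ?r \<phi> = \<psi>}"
      hence "c (\<phi> i) = \<psi> i" if "i \<in> VF" for i using that by (metis (mono_tags, lifting) mem_Collect_eq restrict_apply')
      thus "\<phi> \<in> PiE VF (\<lambda>i. cluster n c (\<psi> i))" using \<phi> by (auto simp: PiE_iff cluster_def)
    next
      fix \<phi> assume \<phi>: "\<phi> \<in> PiE VF (\<lambda>i. cluster n c (\<psi> i))"
      hence "?r \<phi> = \<psi>" using \<psi> by (auto simp: PiE_iff cluster_def extensional_def)
      thus "\<phi> \<in> {\<phi>\<in>VF \<rightarrow>\<^sub>E {..<n}. ?r \<phi> = \<psi>}" using \<phi> by (auto simp: PiE_iff cluster_def)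
    qed
    have "(\<Sum>\<phi>\<in>{\<phi>\<in>VF \<rightarrow>\<^sub>E {..<n}. ?r \<phi> = \<psi>}. G (\<lambda>i. c (\<phi> i))) = (\<Sum>\<phi>\<in>PiE VF (\<lambda>i. cluster n c (\<psi> i)). G \<psi>)"
      unfolding set by (intro sum.cong G) (auto simp: PiE_iff cluster_def)
    also have "\<dots> = (\<Prod>i\<in>VF. real (card (cluster n c (\<psi> i)))) * G \<psi>"
      using VF by (simp add: card_PiE)
    finally show "(\<Sum>\<phi>\<in>{\<phi>\<in>VF \<rightarrow>\<^sub>E {..<n}. ?r \<phi> = \<psi>}. G (\<lambda>i. c (\<phi> i))) =
      (\<Prod>i\<in>VF. real (card (cluster n c (\<psi> i)))) * G \<psi>" .
  qed simp
  finally show ?thesis .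
qed

lemma hom_density_close:
  fixes p :: "nat \<Rightarrow> nat \<Rightarrow> real" and T :: real
  assumes F: "simple_graph VF EF" and E: "sym E" and n: "n > 0"
    and c: "\<And>v. v < n \<Longrightarrow> c v < k"
    and p: "\<And>i j. i < k \<Longrightarrow> j < k \<Longrightarrow> 0 \<le> p i j \<and> p i j \<le> 1"
    and W: "op_bounded n (\<lambda>u v. (if (u,v) \<in> E then 1 else 0) - p (c u) (c v)) T"
  shows "\<bar>real (hom_count VF EF {..<n} E) / real n ^ card VF
    - (\<Sum>\<psi>\<in>VF \<rightarrow>\<^sub>E {..<k}. (\<Prod>i\<in>VF. real (card (cluster n c (\<psi> i))) / n) *
        (\<Prod>(i,j)\<in>{(i,j)\<in>EF. i < j}. p (\<psi> i) (\<psi> j)))\<bar>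
    \<le> card EF * T / n"
proof -
  let ?EF = "{(i,j)\<in>EF. i < j}"
  have VF: "finite VF" "EF \<subseteq> VF \<times> VF" "sym EF" "irrefl EF" using F by (auto simp: simple_graph_def)
  have fEF: "finite EF" using VF(1,2) finite_subset by blast
  have fE: "finite ?EF" by (rule finite_subset[OF _ fEF]) auto
  have cE: "card ?EF \<le> card EF" by (rule card_mono[OF fEF]) auto
  have T: "T \<ge> 0" using W by (rule op_bounded_nonneg)
  define m where "m = card VF"
  have "\<bar>(\<Sum>\<phi>\<in>VF \<rightarrow>\<^sub>E {..<n}. (\<Prod>(i,j)\<in>?EF. if (\<phi> i, \<phi> j) \<in> E then 1 else 0) * (\<Prod>(i,j)\<in>{}. p (c (\<phi> i)) (c (\<phi> j))))
     - (\<Sum>\<phi>\<in>VF \<rightarrow>\<^sub>E {..<n}. (\<Prod>(i,j)\<in>?EF. p (c (\<phi> i)) (c (\<phi> j))) * (\<Prod>(i,j)\<in>{}. p (c (\<phi> i)) (c (\<phi> j))))\<bar>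
     \<le> card ?EF * (T * real n ^ (card VF - 1))"
    by (rule hom_sum_swap_edges[OF VF(1) W]) (use p c VF fE in auto)
  hence "\<bar>real (hom_count VF EF {..<n} E) - (\<Sum>\<phi>\<in>VF \<rightarrow>\<^sub>E {..<n}. \<Prod>(i,j)\<in>?EF. p (c (\<phi> i)) (c (\<phi> j)))\<bar>
     \<le> card ?EF * (T * real n ^ (m - 1))"
    by (simp add: hom_count_eq_sum[OF F E] m_def)
  also have "\<dots> \<le> card EF * (T * real n ^ (m - 1))"
    using cE T by (intro mult_right_mono) auto
  also have "(\<Sum>\<phi>\<in>VF \<rightarrow>\<^sub>E {..<n}. \<Prod>(i,j)\<in>?EF. p (c (\<phi> i)) (c (\<phi> j))) =
     (\<Sum>\<psi>\<in>VF \<rightarrow>\<^sub>E {..<k}. (\<Prod>i\<in>VF. real (card (cluster n c (\<psi> i)))) * (\<Prod>(i,j)\<in>?EF. p (\<psi> i) (\<psi> j)))"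
  proof (rule sum_PiE_clusters[OF VF(1) c, where G = "\<lambda>\<psi>. \<Prod>(i,j)\<in>?EF. p (\<psi> i) (\<psi> j)"])
    fix \<phi> \<psi> :: "nat \<Rightarrow> nat" assume "\<And>i. i \<in> VF \<Longrightarrow> \<phi> i = \<psi> i"
    thus "(\<Prod>(i,j)\<in>?EF. p (\<phi> i) (\<phi> j)) = (\<Prod>(i,j)\<in>?EF. p (\<psi> i) (\<psi> j))"
      using VF(2) by (intro prod.cong) auto
  qed auto
  also have "\<dots> = (\<Sum>\<psi>\<in>VF \<rightarrow>\<^sub>E {..<k}. (\<Prod>i\<in>VF. real (card (cluster n c (\<psi> i))) / n) *
        (\<Prod>(i,j)\<in>?EF. p (\<psi> i) (\<psi> j))) * real n ^ m"
    using n by (simp add: sum_distrib_right prod_dividef m_def)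
  finally have main: "\<bar>real (hom_count VF EF {..<n} E) - (\<Sum>\<psi>\<in>VF \<rightarrow>\<^sub>E {..<k}. (\<Prod>i\<in>VF. real (card (cluster n c (\<psi> i))) / n) *
        (\<Prod>(i,j)\<in>?EF. p (\<psi> i) (\<psi> j))) * real n ^ m\<bar> \<le> card EF * (T * real n ^ (m - 1))"
    (is "\<bar>?H - ?M * _\<bar> \<le> _") .
  have "\<bar>?H / real n ^ m - ?M\<bar> = \<bar>?H - ?M * real n ^ m\<bar> / real n ^ m"
  proof -
    have "?H / real n ^ m - ?M = (?H - ?M * real n ^ m) / real n ^ m"
      using n by (simp add: diff_divide_distrib)
    thus ?thesis by (simp only: abs_divide power_abs abs_of_nat)
  qed
  also have "\<dots> \<le> card EF * (T * real n ^ (m - 1)) / real n ^ m"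
    using main by (intro divide_right_mono) auto
  also have "\<dots> = card EF * T / n"
  proof (cases "m = 0")
    \<comment> \<open>Here \<open>m - 1\<close> is truncated to zero, but a graph without vertices
      has no edges and the bound is zero as well.\<close>
    case True
    hence "EF = {}" using VF(1,2) by (auto simp: m_def)
    thus ?thesis by simp
  next
    case False
    hence "real n ^ m = real n ^ (m - 1) * n" by (simp add: power_eq_if)
    thus ?thesis using n by simp
  qed
  finally show ?thesis by (simp add: m_def)
qed

section \<open>A lattice net and Hoeffding bounds\<close>

text \<open>A point \<open>z\<close> stands for the vector \<open>z / (4 \<surd>n)\<close> of norm at most 1.\<close>

definition int_net :: "nat \<Rightarrow> (nat \<Rightarrow> int) set" where
  "int_net n = {z \<in> {..<n} \<rightarrow>\<^sub>E {- 4 * int n..4 * int n}. (\<Sum>i<n. (real_of_int (z i))\<^sup>2) \<le> 16 * real n}"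

lemma finite_int_net: "finite (int_net n)"
  unfolding int_net_def by (rule finite_subset[of _ "{..<n} \<rightarrow>\<^sub>E {- 4 * int n..4 * int n}"]) (auto intro: finite_PiE)

text \<open>The subtracted term closes the induction: the new pair contributes at most
  \<open>2 * (1 / 2) ^ Suc N\<close>, which is exactly its decrease.\<close>

lemma sum_exp_neg_square_le: "(\<Sum>m\<in>{- int N..int N}. exp (- (real_of_int m)\<^sup>2)) \<le> 3 - 2 * (1 / 2) ^ N"
proof (induction N)
  case 0
  show ?case by simp
next
  case (Suc N)
  have set: "{- int (Suc N)..int (Suc N)} = insert (int (Suc N)) (insert (- int (Suc N)) {- int N..int N})"
    by auto
  have "exp (- (real (Suc N))\<^sup>2) \<le> (1 / 2) ^ Suc N"
  proof -
    have "exp (- (real (Suc N))\<^sup>2) \<le> exp (real (Suc N) * (-1))"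
    proof -
      have "real (Suc N) * 1 \<le> real (Suc N) * real (Suc N)" by (intro mult_left_mono) auto
      thus ?thesis by (simp add: power2_eq_square del: of_nat_Suc)
    qed
    also have "\<dots> = exp (-1) ^ Suc N" by (simp only: exp_of_nat_mult)
    also have "\<dots> \<le> (1 / 2) ^ Suc N"
    proof (rule power_mono)
      have "exp (1::real) \<ge> 2" using exp_ge_add_one_self[of 1] by simp
      thus "exp (-1) \<le> (1 / 2 :: real)" by (simp add: exp_minus field_simps)
    qed simp
    finally show ?thesis .
  qed
  moreover have "(\<Sum>m\<in>{- int (Suc N)..int (Suc N)}. exp (- (real_of_int m)\<^sup>2)) =
      2 * exp (- (real (Suc N))\<^sup>2) + (\<Sum>m\<in>{- int N..int N}. exp (- (real_of_int m)\<^sup>2))"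
    unfolding set by (subst sum.insert, simp, simp, subst sum.insert) (auto simp: power2_eq_square algebra_simps)
  ultimately show ?case using Suc by simp
qed

text \<open>The indicator of the ball is bounded by \<open>exp (16 n - \<bar>z\<bar>\<^sup>2)\<close>, whose sum over the lattice factorizes.\<close>

lemma card_int_net_le: "real (card (int_net n)) \<le> exp (18 * real n)"
proof -
  let ?S = "{..<n} \<rightarrow>\<^sub>E {- 4 * int n..4 * int n}"
  have f: "finite ?S" by (intro finite_PiE) auto
  have "real (card (int_net n)) = (\<Sum>z\<in>int_net n. 1)" by simp
  also have "\<dots> \<le> (\<Sum>z\<in>int_net n. exp (16 * real n) * (\<Prod>i<n. exp (- (real_of_int (z i))\<^sup>2)))"
  proof (rule sum_mono)
    fix z assume "z \<in> int_net n"
    hence "0 \<le> 16 * real n + (\<Sum>i<n. - (real_of_int (z i))\<^sup>2)" by (simp add: int_net_def sum_negf)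
    hence "1 \<le> exp (16 * real n + (\<Sum>i<n. - (real_of_int (z i))\<^sup>2))" by simp
    thus "1 \<le> exp (16 * real n) * (\<Prod>i<n. exp (- (real_of_int (z i))\<^sup>2))"
      by (simp only: exp_add exp_sum[OF finite_lessThan])
  qed
  also have "\<dots> \<le> (\<Sum>z\<in>?S. exp (16 * real n) * (\<Prod>i<n. exp (- (real_of_int (z i))\<^sup>2)))"
  proof (rule sum_mono2[OF f])
    show "int_net n \<subseteq> ?S" by (auto simp: int_net_def)
    show "0 \<le> exp (16 * real n) * (\<Prod>i<n. exp (- (real_of_int (z i))\<^sup>2))" for z
      by (intro mult_nonneg_nonneg prod_nonneg) simp_all
  qed
  also have "\<dots> = exp (16 * real n) * (\<Prod>i<n. \<Sum>m\<in>{- 4 * int n..4 * int n}. exp (- (real_of_int m)\<^sup>2))"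
    unfolding sum_distrib_left[symmetric] by (subst prod_sum_PiE) auto
  also have "\<dots> \<le> exp (16 * real n) * (\<Prod>i<n. 3)"
  proof (intro mult_left_mono prod_mono conjI)
    fix i
    show "0 \<le> (\<Sum>m\<in>{- 4 * int n..4 * int n}. exp (- (real_of_int m)\<^sup>2))" by (rule sum_nonneg) simp
    show "(\<Sum>m\<in>{- 4 * int n..4 * int n}. exp (- (real_of_int m)\<^sup>2)) \<le> 3"
    proof -
      have eq: "{- 4 * int n..4 * int n} = {- int (4 * n)..int (4 * n)}" by simp
      have "3 - 2 * (1 / 2 :: real) ^ (4 * n) \<le> 3" by simp
      with sum_exp_neg_square_le[of "4 * n"] show ?thesis unfolding eq by (rule order_trans)
    qed
  qed simp
  \<comment> \<open>Each coordinate costs at most \<open>3 \<le> exp 2\<close>; with the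
    \<open>16\<close> from the squared radius this is the origin of \<open>18\<close>.\<close>
  also have "(\<Prod>i<n. 3::real) \<le> exp (2 * real n)"
  proof -
    have "(3::real) \<le> exp 2" using exp_ge_add_one_self[of 2] by simp
    hence "(3::real) ^ n \<le> exp 2 ^ n" by (rule power_mono) simp
    thus ?thesis by (simp add: mult.commute flip: exp_of_nat_mult)
  qed
  also have "exp (16 * real n) * exp (2 * real n) = exp (18 * real n)" by (simp flip: exp_add)
  finally show ?thesis by simp
qed

text \<open>Rounding toward zero keeps
  \<open>\<bar>z u\<bar> \<le> 4 * sqrt n * \<bar>x u\<bar>\<close>, so \<open>z\<close> stays
  inside the ball. Each of the \<open>n\<close> coordinates errs by at most
  \<open>1 / (4 * sqrt n)\<close>.\<close>

lemma lattice_rounding: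
  assumes n: "n > 0" and x: "nrm n x \<le> 1"
  shows "\<exists>z\<in>int_net n. nrm n (\<lambda>u. x u - real_of_int (z u) / (4 * sqrt n)) \<le> 1 / 4"
proof -
  let ?s = "4 * sqrt n"
  have s: "?s > 0" using n by simp
  define z where "z = (\<lambda>u\<in>{..<n}. if x u \<ge> 0 then \<lfloor>?s * x u\<rfloor> else - \<lfloor>?s * (- x u)\<rfloor>)"
  have z1: "\<bar>real_of_int (z u)\<bar> \<le> ?s * \<bar>x u\<bar>" and z2: "\<bar>?s * x u - real_of_int (z u)\<bar> \<le> 1" if "u < n" for u
  proof -
    have fl: "\<bar>real_of_int \<lfloor>q\<rfloor>\<bar> \<le> q" "\<bar>q - real_of_int \<lfloor>q\<rfloor>\<bar> \<le> 1" if "q \<ge> 0" for q :: real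
    proof -
      have "real_of_int \<lfloor>q\<rfloor> \<le> q" "q \<le> real_of_int \<lfloor>q\<rfloor> + 1" "0 \<le> real_of_int \<lfloor>q\<rfloor>"
        using that floor_correct[of q] by simp_all
      thus "\<bar>real_of_int \<lfloor>q\<rfloor>\<bar> \<le> q" "\<bar>q - real_of_int \<lfloor>q\<rfloor>\<bar> \<le> 1" by linarith+
    qed
    have "\<bar>real_of_int (z u)\<bar> \<le> ?s * \<bar>x u\<bar> \<and> \<bar>?s * x u - real_of_int (z u)\<bar> \<le> 1"
    proof (cases "x u \<ge> 0")
      case True
      hence "0 \<le> ?s * x u" using s by simp
      from fl[OF this] show ?thesis using True that by (simp add: z_def)
    next
      case False
      define q where "q = ?s * (- x u)"
      have "0 \<le> q" using s False by (simp add: q_def mult_nonneg_nonpos)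
      moreover have "z u = - \<lfloor>q\<rfloor>" "?s * x u = - q" "?s * \<bar>x u\<bar> = q"
        using False that by (simp_all add: z_def q_def)
      ultimately show ?thesis using fl[of q] by (simp add: abs_minus_commute)
    qed
    thus "\<bar>real_of_int (z u)\<bar> \<le> ?s * \<bar>x u\<bar>" "\<bar>?s * x u - real_of_int (z u)\<bar> \<le> 1" by auto
  qed
  have xs: "(\<Sum>u<n. (x u)\<^sup>2) \<le> 1" using x power_mono[of "nrm n x" 1 2] by (simp add: nrm_sq)
  have "(\<Sum>u<n. (real_of_int (z u))\<^sup>2) \<le> (\<Sum>u<n. 16 * real n * (x u)\<^sup>2)"
  proof (rule sum_mono)
    fix u assume "u \<in> {..<n}"
    hence "\<bar>real_of_int (z u)\<bar>\<^sup>2 \<le> (?s * \<bar>x u\<bar>)\<^sup>2" using z1 by (intro power_mono) auto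
    thus "(real_of_int (z u))\<^sup>2 \<le> 16 * real n * (x u)\<^sup>2" by (simp add: power_mult_distrib)
  qed
  also have "\<dots> \<le> 16 * real n * 1"
    unfolding sum_distrib_left[symmetric] using xs by (intro mult_left_mono) auto
  finally have zs: "(\<Sum>u<n. (real_of_int (z u))\<^sup>2) \<le> 16 * n" by simp
  have "z \<in> {..<n} \<rightarrow>\<^sub>E {- 4 * int n..4 * int n}"
  proof (rule PiE_I)
    fix u assume u: "u \<in> {..<n}"
    have "(real_of_int (z u))\<^sup>2 \<le> (\<Sum>u<n. (real_of_int (z u))\<^sup>2)"
      using u by (intro member_le_sum) auto
    also have "\<dots> \<le> (4 * real n)\<^sup>2"
    proof -
      have "real n * 1 \<le> real n * real n" using n by (intro mult_left_mono) auto
      thus ?thesis using zs by (simp add: power2_eq_square)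
    qed
    finally have "\<bar>real_of_int (z u)\<bar> \<le> 4 * real n"
      using abs_le_square_iff[of "real_of_int (z u)" "4 * real n"] by simp
    thus "z u \<in> {- 4 * int n..4 * int n}" by (simp add: abs_le_iff)
  qed (simp add: z_def)
  hence "z \<in> int_net n" using zs by (simp add: int_net_def)
  moreover have "nrm n (\<lambda>u. x u - real_of_int (z u) / ?s) \<le> 1 / 4"
  proof (rule nrm_leI)
    have "(\<Sum>u<n. (x u - real_of_int (z u) / ?s)\<^sup>2) \<le> (\<Sum>u<n. (1 / ?s)\<^sup>2)"
    proof (rule sum_mono)
      fix u assume "u \<in> {..<n}"
      hence "\<bar>?s * x u - real_of_int (z u)\<bar> / ?s \<le> 1 / ?s" using z2[of u] s by (intro divide_right_mono) auto
      moreover have "x u - real_of_int (z u) / ?s = (?s * x u - real_of_int (z u)) / ?s"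
        using s by (simp add: diff_divide_distrib)
      ultimately have "\<bar>x u - real_of_int (z u) / ?s\<bar> \<le> 1 / ?s" using s by simp
      from power_mono[OF this, of 2] show "(x u - real_of_int (z u) / ?s)\<^sup>2 \<le> (1 / ?s)\<^sup>2" by simp
    qed
    also have "\<dots> = (1 / 4)\<^sup>2" using n by (simp add: power_divide power_mult_distrib)
    finally show "(\<Sum>u<n. (x u - real_of_int (z u) / ?s)\<^sup>2) \<le> (1 / 4)\<^sup>2" .
  qed simp
  ultimately show ?thesis by blast
qed

lemma bilinear_form_add:
  "(\<Sum>u<n. \<Sum>v<n. (x u + x' u) * W u v * y v) = (\<Sum>u<n. \<Sum>v<n. x u * W u v * y v) + (\<Sum>u<n. \<Sum>v<n. x' u * W u v * (y v :: real))"
  "(\<Sum>u<n. \<Sum>v<n. x u * W u v * (y v + y' v)) = (\<Sum>u<n. \<Sum>v<n. x u * W u v * y v) + (\<Sum>u<n. \<Sum>v<n. x u * W u v * (y' v :: real))"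
  by (simp_all add: algebra_simps sum.distrib)

text \<open>A self-bounding supremum: rounding both arguments to the net costs a quarter of the
  supremum \<open>s\<close> each, so \<open>s \<le> T + s / 2\<close>. The factor
  \<open>16 * n\<close> undoes the scale \<open>4 * sqrt n\<close> in both arguments.\<close>

lemma op_bounded_from_net:
  assumes n: "n > 0" and T: "T \<ge> 0"
    and net: "\<And>z z'. z \<in> int_net n \<Longrightarrow> z' \<in> int_net n \<Longrightarrow>
      \<bar>\<Sum>u<n. \<Sum>v<n. real_of_int (z u) * W u v * real_of_int (z' v)\<bar> \<le> T * (16 * real n)"
  shows "op_bounded n W (2 * T)"
proof -
  define f where "f x y = (\<Sum>u<n. \<Sum>v<n. x u * W u v * y v)" for x y :: "nat \<Rightarrow> real"
  define B where "B = {(x,y). nrm n x \<le> 1 \<and> nrm n y \<le> 1}"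
  define s where "s = (SUP (x,y)\<in>B. \<bar>f x y\<bar>)"
  have entry: "\<bar>x u\<bar> \<le> nrm n x" if "u < n" for x u
    using member_le_L2_set[of "{..<n}" u "\<lambda>u. \<bar>x u\<bar>"] that by (simp add: L2_set_def)
  \<comment> \<open>Finiteness of \<open>s\<close> comes first: without it
    \<open>s \<le> T + s / 2\<close> would give nothing.\<close>
  have bdd: "bdd_above ((\<lambda>(x,y). \<bar>f x y\<bar>) ` B)"
  proof (rule bdd_aboveI2)
    fix xy assume "xy \<in> B"
    then obtain x y where xy: "xy = (x,y)" "nrm n x \<le> 1" "nrm n y \<le> 1" by (auto simp: B_def)
    have "\<bar>f x y\<bar> \<le> (\<Sum>u<n. \<Sum>v<n. \<bar>x u * W u v * y v\<bar>)"
      unfolding f_def by (rule order_trans[OF sum_abs], rule sum_mono, rule sum_abs)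
    also have "\<dots> \<le> (\<Sum>u<n. \<Sum>v<n. 1 * \<bar>W u v\<bar> * 1)"
      unfolding abs_mult using entry xy by (intro sum_mono mult_mono) (auto intro: order_trans)
    finally show "(case xy of (x,y) \<Rightarrow> \<bar>f x y\<bar>) \<le> (\<Sum>u<n. \<Sum>v<n. 1 * \<bar>W u v\<bar> * 1)"
      using xy(1) by simp
  qed
  have le_s: "\<bar>f x y\<bar> \<le> s" if "nrm n x \<le> 1" "nrm n y \<le> 1" for x y
    unfolding s_def using cSUP_upper[OF _ bdd, of "(x,y)"] that by (auto simp: B_def)
  have "0 \<le> s" using le_s[of "\<lambda>_. 0" "\<lambda>_. 0"] by (simp add: f_def L2_set_def)
  have f_scale: "f (\<lambda>u. a * x u) (\<lambda>u. b * y u) = a * b * f x y" for a b x y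
    unfolding f_def sum_distrib_left by (simp add: mult_ac)
  have hom: "\<bar>f x y\<bar> \<le> s * nrm n x * nrm n y" for x y
  proof (cases "nrm n x = 0 \<or> nrm n y = 0")
    case True
    hence "f x y = 0" unfolding f_def by (auto simp: L2_set_eq_0_iff)
    thus ?thesis using \<open>0 \<le> s\<close> by (auto intro!: mult_nonneg_nonneg)
  next
    case False
    let ?a = "nrm n x" and ?b = "nrm n y"
    have ab: "?a > 0" "?b > 0" using False L2_set_nonneg[of x "{..<n}"] L2_set_nonneg[of y "{..<n}"] by linarith+
    have "\<bar>f (\<lambda>u. (1/?a) * x u) (\<lambda>u. (1/?b) * y u)\<bar> \<le> s"
    proof (rule le_s)
      show "nrm n (\<lambda>u. (1/?a) * x u) \<le> 1" using ab by (simp only: nrm_scale) simp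
      show "nrm n (\<lambda>u. (1/?b) * y u) \<le> 1" using ab by (simp only: nrm_scale) simp
    qed
    thus ?thesis unfolding f_scale using ab by (simp add: abs_mult field_simps)
  qed
  have key: "\<bar>f x y\<bar> \<le> T + s / 2" if xy: "nrm n x \<le> 1" "nrm n y \<le> 1" for x y
  proof -
    obtain z where z: "z \<in> int_net n" "nrm n (\<lambda>u. x u - real_of_int (z u) / (4 * sqrt n)) \<le> 1 / 4"
      using lattice_rounding[OF n xy(1)] by auto
    obtain z' where z': "z' \<in> int_net n" "nrm n (\<lambda>u. y u - real_of_int (z' u) / (4 * sqrt n)) \<le> 1 / 4"
      using lattice_rounding[OF n xy(2)] by auto
    let ?i = "1 / (4 * sqrt n)"
    let ?X = "\<lambda>u. ?i * real_of_int (z u)" and ?Y = "\<lambda>u. ?i * real_of_int (z' u)"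
    let ?dx = "\<lambda>u. x u - ?X u" and ?dy = "\<lambda>u. y u - ?Y u"
    have dx: "nrm n ?dx \<le> 1 / 4" and dy: "nrm n ?dy \<le> 1 / 4" using z(2) z'(2) by simp_all
    have nX: "nrm n ?X \<le> 1"
    proof (rule nrm_leI)
      have "(\<Sum>u<n. (?X u)\<^sup>2) = (1 / (16 * n)) * (\<Sum>u<n. (real_of_int (z u))\<^sup>2)"
        by (simp add: power_mult_distrib power_divide sum_distrib_left)
      also have "\<dots> \<le> (1 / (16 * n)) * (16 * n)"
        using z(1) by (intro mult_left_mono) (auto simp: int_net_def)
      finally show "(\<Sum>u<n. (?X u)\<^sup>2) \<le> 1\<^sup>2" using n by simp
    qed simp
    have "f x y = f ?dx y + f ?X ?dy + f ?X ?Y"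
      using bilinear_form_add(1)[of ?dx ?X W y n] bilinear_form_add(2)[of ?X W ?dy ?Y n]
      by (simp add: f_def)
    hence "\<bar>f x y\<bar> \<le> \<bar>f ?dx y\<bar> + \<bar>f ?X ?dy\<bar> + \<bar>f ?X ?Y\<bar>" by linarith
    also have "\<bar>f ?dx y\<bar> \<le> s * (1/4) * 1"
      using hom[of ?dx y] dx xy(2) \<open>0 \<le> s\<close> by (elim order_trans, intro mult_mono) auto
    also have "\<bar>f ?X ?dy\<bar> \<le> s * 1 * (1/4)"
      using hom[of ?X ?dy] dy nX \<open>0 \<le> s\<close> by (elim order_trans, intro mult_mono) auto
    also have "\<bar>f ?X ?Y\<bar> \<le> T"
    proof -
      have "\<bar>f ?X ?Y\<bar> = ?i * ?i * \<bar>f (\<lambda>u. real_of_int (z u)) (\<lambda>u. real_of_int (z' u))\<bar>"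
        unfolding f_scale by (simp add: abs_mult)
      also have "\<dots> \<le> ?i * ?i * (T * (16 * n))"
        using net[OF z(1) z'(1)] by (intro mult_left_mono) (auto simp: f_def)
      also have "\<dots> = T" using n by simp
      finally show ?thesis .
    qed
    finally show ?thesis by simp
  qed
  have "B \<noteq> {}"
  proof -
    have "((\<lambda>_. 0), (\<lambda>_. 0)) \<in> B" by (simp add: B_def L2_set_def)
    thus ?thesis by blast
  qed
  hence "s \<le> T + s / 2" unfolding s_def
    by (rule cSUP_least) (use key in \<open>auto simp: B_def s_def\<close>)
  hence s: "s \<le> 2 * T" by simp
  have "\<bar>f x y\<bar> \<le> 2 * T * nrm n x * nrm n y" for x y
    using hom[of x y] s by (elim order_trans) (intro mult_right_mono, auto)
  thus ?thesis using T by (simp add: op_bounded_def f_def)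
qed

text \<open>Functions of disjoint coordinate blocks of a product are independent. The blocks are
  single coordinates for bilinear forms and class sizes, and pairs of edge slots for codegrees. When
  all ranges have length zero, the variables are constant and the deviation event is empty.\<close>

lemma hoeffding_Pi_pmf:
  fixes p :: "'i \<Rightarrow> 'b :: countable pmf" and X :: "'j \<Rightarrow> ('i \<Rightarrow> 'b) \<Rightarrow> real"
  assumes I: "finite I" and J: "finite J"
    and F: "disjoint_family_on F J" "\<And>j. j \<in> J \<Longrightarrow> F j \<subseteq> I"
    and dep: "\<And>j f g. j \<in> J \<Longrightarrow> (\<And>i. i \<in> F j \<Longrightarrow> f i = g i) \<Longrightarrow> X j f = X j g"
    and bounds: "\<And>j f. j \<in> J \<Longrightarrow> X j f \<in> {lo j..hi j}"
    and S: "(\<Sum>j\<in>J. (hi j - lo j)\<^sup>2) \<le> S" "S > 0" and \<epsilon>: "\<epsilon> > 0"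
  shows "measure_pmf.prob (Pi_pmf I dflt p)
     {f. \<bar>(\<Sum>j\<in>J. X j f) - (\<Sum>j\<in>J. measure_pmf.expectation (Pi_pmf I dflt p) (X j))\<bar> \<ge> \<epsilon>}
     \<le> 2 * exp (- 2 * \<epsilon>\<^sup>2 / S)"
proof -
  let ?M = "Pi_pmf I dflt p"
  have indep0: "prob_space.indep_vars ?M (\<lambda>j. PiM (F j) (\<lambda>_. count_space UNIV)) (\<lambda>j f. restrict f (F j)) J"
    using prob_space.indep_vars_restrict[OF measure_pmf.prob_space_axioms indep_vars_Pi_pmf[OF I], of J F] F by simp
  have "prob_space.indep_vars ?M (\<lambda>_. borel) (\<lambda>j f. X j (restrict f (F j))) J"
  proof (rule prob_space.indep_vars_compose2[OF measure_pmf.prob_space_axioms indep0])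
    fix j assume j: "j \<in> J"
    have "finite (F j)" using F(2)[OF j] I finite_subset by blast
    hence "PiM (F j) (\<lambda>_. count_space (UNIV :: 'b set)) = count_space (PiE (F j) (\<lambda>_. UNIV))"
      by (intro count_space_PiM_finite) auto
    thus "X j \<in> PiM (F j) (\<lambda>_. count_space UNIV) \<rightarrow>\<^sub>M borel" by simp
  qed
  also have "prob_space.indep_vars ?M (\<lambda>_. borel) (\<lambda>j f. X j (restrict f (F j))) J =
      prob_space.indep_vars ?M (\<lambda>_. borel) X J"
    by (intro prob_space.indep_vars_cong[OF measure_pmf.prob_space_axioms] refl ext dep) auto
  finally have indep: "prob_space.indep_vars ?M (\<lambda>_. borel) X J" .
  interpret Hoeffding_ineq ?M J X lo hi "\<Sum>j\<in>J. measure_pmf.expectation ?M (X j)"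
    by unfold_locales (use J indep bounds in auto)
  show ?thesis
  proof (cases "(\<Sum>j\<in>J. (hi j - lo j)\<^sup>2) > 0")
    case True
    have "measure_pmf.prob ?M {f. \<bar>(\<Sum>j\<in>J. X j f) - (\<Sum>j\<in>J. measure_pmf.expectation ?M (X j))\<bar> \<ge> \<epsilon>}
      \<le> 2 * exp (- 2 * \<epsilon>\<^sup>2 / (\<Sum>j\<in>J. (hi j - lo j)\<^sup>2))"
      using Hoeffding_ineq_abs_ge[of \<epsilon>] \<epsilon> True by simp
    also have "\<dots> \<le> 2 * exp (- 2 * \<epsilon>\<^sup>2 / S)"
      using S True \<epsilon> by (simp add: frac_le)
    finally show ?thesis .
  next
    case False
    hence z: "(\<Sum>j\<in>J. (hi j - lo j)\<^sup>2) = 0" by (meson sum_nonneg zero_le_power2 not_less order_antisym)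
    have X: "X j f = lo j" if "j \<in> J" for j f
    proof -
      have "hi j = lo j" using z that J by (subst (asm) sum_nonneg_eq_0_iff) auto
      thus ?thesis using bounds[OF that, of f] by auto
    qed
    have "X j = (\<lambda>_. lo j)" if "j \<in> J" for j using X[OF that] by auto
    hence "{f. \<bar>(\<Sum>j\<in>J. X j f) - (\<Sum>j\<in>J. measure_pmf.expectation ?M (X j))\<bar> \<ge> \<epsilon>} = {}"
      using \<epsilon> by auto
    thus ?thesis by simp
  qed
qed

section \<open>Concentration of the random graph\<close>

definition edge_slots :: "nat \<Rightarrow> (nat \<times> nat) set" where
  "edge_slots n = {(u, v). u < v \<and> v < n}"

definition edge_pmf :: "nat \<Rightarrow> real mat \<Rightarrow> (nat \<Rightarrow> nat) \<Rightarrow> (nat \<times> nat \<Rightarrow> bool) pmf" where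
  "edge_pmf n P c = Pi_pmf (edge_slots n) False (\<lambda>(u, v). bernoulli_pmf (P $$ (c u, c v)))"

text \<open>The coordinate that holds the coin of the unordered pair, always in the upper
  triangle.\<close>

definition slot :: "nat \<Rightarrow> nat \<Rightarrow> nat \<times> nat" where
  "slot u v = (min u v, max u v)"

definition adj :: "(nat \<times> nat \<Rightarrow> bool) \<Rightarrow> nat \<Rightarrow> nat \<Rightarrow> real" where
  "adj b u v = (if u \<noteq> v \<and> b (slot u v) then 1 else 0)"

text \<open>The conditional mean of \<open>adj\<close> given the labels. It differs from the block
  matrix only on the diagonal.\<close>

definition model :: "real mat \<Rightarrow> (nat \<Rightarrow> nat) \<Rightarrow> nat \<Rightarrow> nat \<Rightarrow> real" where
  "model P c u v = (if u \<noteq> v then P $$ (c u, c v) else 0)"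

lemma finite_edge_slots [simp]: "finite (edge_slots n)"
  unfolding edge_slots_def by (rule finite_subset[of _ "{..<n} \<times> {..<n}"]) auto

lemma slot_commute: "slot u v = slot v u"
  by (simp add: slot_def min.commute max.commute)

lemma slot_in: "u < n \<Longrightarrow> v < n \<Longrightarrow> u \<noteq> v \<Longrightarrow> slot u v \<in> edge_slots n"
  by (auto simp: slot_def edge_slots_def)

lemma slot_less: "u < v \<Longrightarrow> slot u v = (u, v)"
  by (simp add: slot_def)

lemma sum_edge_slots:
  fixes g :: "nat \<Rightarrow> nat \<Rightarrow> real"
  shows "(\<Sum>(u,v)\<in>edge_slots n. g u v + g v u) + (\<Sum>u<n. g u u) = (\<Sum>u<n. \<Sum>v<n. g u v)"
proof -
  let ?sw = "\<lambda>(u,v). (v,u)"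
  have set: "{..<n} \<times> {..<n} = (edge_slots n \<union> ?sw ` edge_slots n) \<union> (\<lambda>u. (u,u)) ` {..<n}"
  proof (intro equalityI subsetI)
    fix e assume "e \<in> {..<n} \<times> {..<n}"
    then obtain u v where e: "e = (u,v)" "u < n" "v < n" by auto
    show "e \<in> (edge_slots n \<union> ?sw ` edge_slots n) \<union> (\<lambda>u. (u,u)) ` {..<n}"
    proof (cases u v rule: linorder_cases)
      case greater
      hence "(v,u) \<in> edge_slots n" using e by (simp add: edge_slots_def)
      hence "?sw (v,u) \<in> ?sw ` edge_slots n" by (rule imageI)
      thus ?thesis using e by simp
    qed (use e in \<open>auto simp: edge_slots_def\<close>)
  qed (auto simp: edge_slots_def)
  have "(\<Sum>u<n. \<Sum>v<n. g u v) = (\<Sum>(u,v)\<in>{..<n} \<times> {..<n}. g u v)" by (rule sum.cartesian_product)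
  also have "\<dots> = (\<Sum>(u,v)\<in>edge_slots n \<union> ?sw ` edge_slots n. g u v) + (\<Sum>(u,v)\<in>(\<lambda>u. (u,u)) ` {..<n}. g u v)"
    unfolding set using finite_edge_slots by (intro sum.union_disjoint finite_UnI finite_imageI) (auto simp: edge_slots_def)
  also have "(\<Sum>(u,v)\<in>(\<lambda>u. (u,u)) ` {..<n}. g u v) = (\<Sum>u<n. g u u)"
    by (subst sum.reindex) (auto simp: inj_on_def)
  also have "(\<Sum>(u,v)\<in>edge_slots n \<union> ?sw ` edge_slots n. g u v)
      = (\<Sum>(u,v)\<in>edge_slots n. g u v) + (\<Sum>(u,v)\<in>?sw ` edge_slots n. g u v)"
    using finite_edge_slots by (intro sum.union_disjoint finite_imageI) (auto simp: edge_slots_def)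
  also have "(\<Sum>(u,v)\<in>?sw ` edge_slots n. g u v) = (\<Sum>(u,v)\<in>edge_slots n. g v u)"
    by (subst sum.reindex) (auto simp: inj_on_def case_prod_unfold)
  finally show ?thesis by (simp add: sum.distrib case_prod_unfold)
qed

section \<open>Tail bounds conditional on the labels\<close>

context
  fixes n k :: nat and P :: "real mat" and c :: "nat \<Rightarrow> nat"
  assumes P01: "\<And>i j. i < k \<Longrightarrow> j < k \<Longrightarrow> 0 \<le> P $$ (i, j) \<and> P $$ (i, j) \<le> 1"
    and P_sym: "\<And>i j. i < k \<Longrightarrow> j < k \<Longrightarrow> P $$ (i, j) = P $$ (j, i)"
    and c: "\<And>v. v < n \<Longrightarrow> c v < k"
begin

lemma expectation_slot:
  fixes f :: "bool \<Rightarrow> real"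
  assumes "(u,v) \<in> edge_slots n"
  shows "measure_pmf.expectation (edge_pmf n P c) (\<lambda>b. f (b (u,v)))
    = f True * P $$ (c u, c v) + f False * (1 - P $$ (c u, c v))"
proof -
  have "measure_pmf.expectation (edge_pmf n P c) (\<lambda>b. f (b (u,v)))
    = measure_pmf.expectation (map_pmf (\<lambda>b. b (u,v)) (edge_pmf n P c)) f"
    by simp
  also have "map_pmf (\<lambda>b. b (u,v)) (edge_pmf n P c) = bernoulli_pmf (P $$ (c u, c v))"
    unfolding edge_pmf_def using assms by (subst Pi_pmf_component) auto
  finally show ?thesis using assms P01[OF c c, of u v] by (simp add: edge_slots_def)
qed

text \<open>The entries at \<open>(u, v)\<close> and \<open>(v, u)\<close> share one coin, so the
  form is regrouped over slots with coefficients \<open>s\<close>. Their squares sum to at most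
  \<open>2 * S\<close>, and this \<open>2\<close> cancels the one in Hoeffding's exponent.\<close>

lemma bilinear_tail:
  fixes x y :: "nat \<Rightarrow> real"
  assumes S: "(nrm n x)\<^sup>2 * (nrm n y)\<^sup>2 \<le> S" "S > 0" and t: "t > 0"
  shows "measure_pmf.prob (edge_pmf n P c)
      {b. \<bar>\<Sum>u<n. \<Sum>v<n. x u * (adj b u v - model P c u v) * y v\<bar> \<ge> t} \<le> 2 * exp (- t\<^sup>2 / S)"
proof -
  define s where "s = (\<lambda>(u,v). x u * y v + x v * y u)"
  define X where "X = (\<lambda>e (b :: nat \<times> nat \<Rightarrow> bool). s e * of_bool (b e))"
  have EX: "measure_pmf.expectation (edge_pmf n P c) (X (u,v)) = s (u,v) * P $$ (c u, c v)"
    if "(u,v) \<in> edge_slots n" for u v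
    using expectation_slot[OF that, of "\<lambda>z. s (u,v) * of_bool z"] by (simp add: X_def)
  have eq: "(\<Sum>u<n. \<Sum>v<n. x u * (adj b u v - model P c u v) * y v) =
      (\<Sum>e\<in>edge_slots n. X e b) - (\<Sum>e\<in>edge_slots n. measure_pmf.expectation (edge_pmf n P c) (X e))" for b
  proof -
    have "(\<Sum>u<n. \<Sum>v<n. x u * (adj b u v - model P c u v) * y v) =
      (\<Sum>(u,v)\<in>edge_slots n. x u * (adj b u v - model P c u v) * y v + x v * (adj b v u - model P c v u) * y u)"
      by (subst sum_edge_slots[symmetric]) (simp add: adj_def model_def)
    also have "\<dots> = (\<Sum>e\<in>edge_slots n. X e b - measure_pmf.expectation (edge_pmf n P c) (X e))"
    proof (rule sum.cong)
      fix e assume e: "e \<in> edge_slots n"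
      obtain u v where uv: "e = (u,v)" by (cases e)
      have l: "u < v" "v < n" "u < n" using e uv by (auto simp: edge_slots_def)
      have "adj b v u = of_bool (b e)" "adj b u v = of_bool (b e)"
        using l slot_less[OF l(1)] slot_commute[of u v] by (auto simp: adj_def uv)
      moreover have "model P c v u = P $$ (c u, c v)" "model P c u v = P $$ (c u, c v)"
        using l P_sym[OF c c] by (auto simp: model_def)
      ultimately show "(case e of (u,v) \<Rightarrow> x u * (adj b u v - model P c u v) * y v + x v * (adj b v u - model P c v u) * y u)
        = X e b - measure_pmf.expectation (edge_pmf n P c) (X e)"
        using EX e by (simp add: uv X_def s_def algebra_simps)
    qed simp
    finally show ?thesis by (simp add: sum_subtractf)
  qed
  have "(\<Sum>e\<in>edge_slots n. (max 0 (s e) - min 0 (s e))\<^sup>2) = (\<Sum>e\<in>edge_slots n. (s e)\<^sup>2)"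
    by (intro sum.cong refl) (auto simp: max_def min_def)
  also have "\<dots> \<le> (\<Sum>(u,v)\<in>edge_slots n. 2 * ((x u)\<^sup>2 * (y v)\<^sup>2) + 2 * ((x v)\<^sup>2 * (y u)\<^sup>2))"
  proof (rule sum_mono)
    fix e :: "nat \<times> nat"
    obtain u v where uv: "e = (u,v)" by (cases e)
    have "0 \<le> (x u * y v - x v * y u)\<^sup>2" by simp
    thus "(s e)\<^sup>2 \<le> (case e of (u,v) \<Rightarrow> 2 * ((x u)\<^sup>2 * (y v)\<^sup>2) + 2 * ((x v)\<^sup>2 * (y u)\<^sup>2))"
      by (simp add: uv s_def power2_eq_square algebra_simps)
  qed
  also have "\<dots> \<le> (\<Sum>u<n. \<Sum>v<n. 2 * ((x u)\<^sup>2 * (y v)\<^sup>2))"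
    unfolding sum_edge_slots[of "\<lambda>u v. 2 * ((x u)\<^sup>2 * (y v)\<^sup>2)", symmetric] by (simp add: sum_nonneg)
  also have "\<dots> = 2 * ((nrm n x)\<^sup>2 * (nrm n y)\<^sup>2)"
    by (simp only: nrm_sq sum_product) (simp add: sum_distrib_left)
  finally have sS: "(\<Sum>e\<in>edge_slots n. (max 0 (s e) - min 0 (s e))\<^sup>2) \<le> 2 * S" using S(1) by linarith
  have "measure_pmf.prob (edge_pmf n P c)
      {b. \<bar>(\<Sum>e\<in>edge_slots n. X e b) - (\<Sum>e\<in>edge_slots n. measure_pmf.expectation (edge_pmf n P c) (X e))\<bar> \<ge> t}
      \<le> 2 * exp (- 2 * t\<^sup>2 / (2 * S))"
    unfolding edge_pmf_def
  proof (rule hoeffding_Pi_pmf[where F = "\<lambda>e. {e}" and lo = "\<lambda>e. min 0 (s e)" and hi = "\<lambda>e. max 0 (s e)"])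
    show "X e f \<in> {min 0 (s e)..max 0 (s e)}" for e f by (auto simp: X_def)
    show "(\<Sum>e\<in>edge_slots n. (max 0 (s e) - min 0 (s e))\<^sup>2) \<le> 2 * S" by (rule sS)
  qed (use S t in \<open>auto simp: disjoint_family_on_def X_def\<close>)
  thus ?thesis unfolding eq by simp
qed

text \<open>For distinct \<open>w\<close> the products use disjoint pairs of coins, so they are
  independent. The vertices \<open>u\<close> and \<open>v\<close> are taken out of \<open>Y\<close>
  because the product is zero there, whatever the model value.\<close>

lemma codegree_tail:
  assumes uv: "u < n" "v < n" "u \<noteq> v" and Y: "Y \<subseteq> {..<n}" and t: "t > 0"
  shows "measure_pmf.prob (edge_pmf n P c)
      {b. \<bar>\<Sum>w\<in>Y - {u,v}. adj b u w * adj b v w - P $$ (c u, c w) * P $$ (c v, c w)\<bar> \<ge> t} \<le> 2 * exp (- 2 * t\<^sup>2 / n)"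
proof -
  define J where "J = Y - {u,v}"
  have J: "finite J" "J \<subseteq> {..<n}" using Y finite_subset[of Y "{..<n}"] by (auto simp: J_def)
  define X where "X = (\<lambda>w b. adj b u w * adj b v w)"
  define F where "F w = {slot u w, slot v w}" for w
  have uvJ: "u \<noteq> w" "v \<noteq> w" "w < n" if "w \<in> J" for w using that J(2) by (auto simp: J_def)
  have slots: "slot u w \<in> edge_slots n" "slot v w \<in> edge_slots n" "slot u w \<noteq> slot v w" if "w \<in> J" for w
    using uvJ[OF that] uv slot_in by (auto simp: slot_def min_def max_def split: if_splits)
  let ?p = "\<lambda>(u, v). bernoulli_pmf (P $$ (c u, c v))"
  have EX: "measure_pmf.expectation (edge_pmf n P c) (X w) = P $$ (c u, c w) * P $$ (c v, c w)" if w: "w \<in> J" for w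
  proof -
    define g where "g e z = (if e \<in> F w then of_bool z else (1::real))" for e z
    have single: "measure_pmf.expectation (?p e) (g e) = (if e \<in> F w then P $$ (c (fst e), c (snd e)) else 1)"
      if e: "e \<in> edge_slots n" for e
    proof (cases e)
      case (Pair a b)
      hence "c a < k" "c b < k" using e c by (auto simp: edge_slots_def)
      thus ?thesis using P01[of "c a" "c b"] by (auto simp: g_def Pair)
    qed
    have pv: "P $$ (c (fst (slot a w)), c (snd (slot a w))) = P $$ (c a, c w)" if "a < n" for a
      using that uvJ[OF w] P_sym[OF c c] by (auto simp: slot_def min_def max_def)
    \<comment> \<open>Writing the product over all slots, with factor one off \<open>F w\<close>,
      lets the expectation factorize over the product law.\<close>
    have "X w = (\<lambda>b. \<Prod>e\<in>edge_slots n. g e (b e))"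
    proof
      fix b
      have "(\<Prod>e\<in>edge_slots n. g e (b e)) = (\<Prod>e\<in>F w. g e (b e))"
        using slots[OF w] by (intro prod.mono_neutral_right) (auto simp: F_def g_def)
      also have "\<dots> = of_bool (b (slot u w)) * of_bool (b (slot v w))"
        using slots(3)[OF w] by (simp add: F_def g_def)
      finally show "X w b = (\<Prod>e\<in>edge_slots n. g e (b e))"
        using uvJ[OF w] by (auto simp: X_def adj_def)
    qed
    hence "measure_pmf.expectation (edge_pmf n P c) (X w) = (\<Prod>e\<in>edge_slots n. measure_pmf.expectation (?p e) (g e))"
      unfolding edge_pmf_def
      by (simp only:) (rule expectation_prod_Pi_pmf, auto simp: g_def intro!: integrable_measure_pmf_finite)
    also have "\<dots> = (\<Prod>e\<in>edge_slots n. if e \<in> F w then P $$ (c (fst e), c (snd e)) else 1)"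
      by (intro prod.cong refl single)
    also have "\<dots> = (\<Prod>e\<in>F w. P $$ (c (fst e), c (snd e)))"
      using slots[OF w] by (intro prod.mono_neutral_cong_right) (auto simp: F_def)
    also have "\<dots> = P $$ (c u, c w) * P $$ (c v, c w)"
      using slots(3)[OF w] by (simp add: F_def pv uv)
    finally show ?thesis .
  qed
  have "measure_pmf.prob (edge_pmf n P c)
      {b. \<bar>(\<Sum>w\<in>J. X w b) - (\<Sum>w\<in>J. measure_pmf.expectation (edge_pmf n P c) (X w))\<bar> \<ge> t}
      \<le> 2 * exp (- 2 * t\<^sup>2 / n)"
    unfolding edge_pmf_def
  proof (rule hoeffding_Pi_pmf[where F = F and lo = "\<lambda>_. 0" and hi = "\<lambda>_. 1"])
    show "disjoint_family_on F J"
      unfolding disjoint_family_on_def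
    proof (intro ballI impI)
      fix w w' assume "w \<in> J" "w' \<in> J" "w \<noteq> w'"
      thus "F w \<inter> F w' = {}" using uvJ[of w] uvJ[of w'] uv(3)
        by (auto simp: F_def slot_def min_def max_def split: if_splits)
    qed
    show "X w f = X w g" if "w \<in> J" "\<And>e. e \<in> F w \<Longrightarrow> f e = g e" for w f g
      using that by (simp add: X_def adj_def F_def)
    show "X w f \<in> {0..1}" for w f by (auto simp: X_def adj_def)
    show "(\<Sum>w\<in>J. (1 - 0)\<^sup>2) \<le> real n" using card_mono[OF _ J(2)] by simp
  qed (use J uv t slots in \<open>auto simp: F_def\<close>)
  also have "{b. \<bar>(\<Sum>w\<in>J. X w b) - (\<Sum>w\<in>J. measure_pmf.expectation (edge_pmf n P c) (X w))\<bar> \<ge> t}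
     = {b. \<bar>\<Sum>w\<in>J. adj b u w * adj b v w - P $$ (c u, c w) * P $$ (c v, c w)\<bar> \<ge> t}"
  proof -
    have "(\<Sum>w\<in>J. measure_pmf.expectation (edge_pmf n P c) (X w)) = (\<Sum>w\<in>J. P $$ (c u, c w) * P $$ (c v, c w))"
      by (intro sum.cong refl EX)
    thus ?thesis by (simp only:) (simp add: sum_subtractf X_def)
  qed
  finally show ?thesis by (simp add: J_def)
qed

end

section \<open>The concentration event and its probability\<close>

definition edges_of :: "(nat \<times> nat \<Rightarrow> bool) \<Rightarrow> (nat \<times> nat) set" where
  "edges_of b = {(u, v). b (u, v) \<or> b (v, u)}"

definition ind_edge :: "(nat \<times> nat) set \<Rightarrow> nat \<Rightarrow> nat \<Rightarrow> real" where
  "ind_edge E u v = (if (u,v) \<in> E then 1 else 0)"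

text \<open>The additive \<open>1\<close> and \<open>2\<close> absorb the terms where a vertex meets
  itself: \<open>v = u\<close> in a degree, and \<open>w \<in> {u, v}\<close> in a codegree.\<close>

definition concentrated_edges :: "nat \<Rightarrow> nat \<Rightarrow> real mat \<Rightarrow> (nat \<Rightarrow> nat) \<Rightarrow> (nat \<times> nat) set \<Rightarrow> bool" where
  "concentrated_edges n k P c E \<longleftrightarrow>
    op_bounded n (\<lambda>u v. ind_edge E u v - P $$ (c u, c v)) (15 * sqrt n) \<and>
    (\<forall>u<n. \<forall>j<k. \<bar>(\<Sum>v\<in>cluster n c j. ind_edge E u v) - P $$ (c u, j) * real (card (cluster n c j))\<bar> \<le> real n powr (3/4) + 1) \<and>
    (\<forall>u<n. \<forall>v<n. \<forall>j<k. u \<noteq> v \<longrightarrow>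
      \<bar>(\<Sum>w\<in>cluster n c j. ind_edge E u w * ind_edge E v w) - P $$ (c u, j) * P $$ (c v, j) * real (card (cluster n c j))\<bar>
        \<le> real n powr (3/4) + 2)"

definition concentrated :: "nat \<Rightarrow> nat \<Rightarrow> (nat \<Rightarrow> real) \<Rightarrow> real mat \<Rightarrow> (nat \<Rightarrow> nat) \<Rightarrow> (nat \<times> nat) set \<Rightarrow> bool" where
  "concentrated n k r P c E \<longleftrightarrow> sym E \<and> (\<forall>v<n. c v < k) \<and>
    (\<forall>i<k. \<bar>real (card (cluster n c i)) - r i * real n\<bar> \<le> real n powr (3/4)) \<and> concentrated_edges n k P c E"

lemma op_bounded_add:
  assumes "op_bounded n W S" "op_bounded n W' T"
  shows "op_bounded n (\<lambda>u v. W u v + W' u v) (S + T)"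
proof -
  have "\<bar>\<Sum>u<n. \<Sum>v<n. x u * (W u v + W' u v) * y v\<bar> \<le> (S + T) * nrm n x * nrm n y" for x y
  proof -
    have "(\<Sum>u<n. \<Sum>v<n. x u * (W u v + W' u v) * y v)
      = (\<Sum>u<n. \<Sum>v<n. x u * W u v * y v) + (\<Sum>u<n. \<Sum>v<n. x u * W' u v * y v)"
      by (simp add: algebra_simps sum.distrib)
    thus ?thesis using op_boundedD[OF assms(1), of x y] op_boundedD[OF assms(2), of x y]
      by (simp add: algebra_simps)
  qed
  thus ?thesis using assms by (simp add: op_bounded_def)
qed

lemma op_bounded_diag:
  assumes "\<And>u. u < n \<Longrightarrow> \<bar>d u\<bar> \<le> 1"
  shows "op_bounded n (\<lambda>u v. if u = v then d u else 0) 1"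
proof -
  have "\<bar>\<Sum>u<n. \<Sum>v<n. x u * (if u = v then d u else 0) * y v\<bar> \<le> nrm n x * nrm n y" for x y
  proof -
    have "(\<Sum>u<n. \<Sum>v<n. x u * (if u = v then d u else 0) * y v) = (\<Sum>u<n. x u * d u * y u)"
      by (intro sum.cong refl) (simp add: if_distrib if_distribR cong: if_cong)
    also have "\<bar>\<dots>\<bar> \<le> (\<Sum>u<n. \<bar>x u\<bar> * \<bar>y u\<bar>)"
    proof (rule order_trans[OF sum_abs], rule sum_mono)
      fix u assume "u \<in> {..<n}"
      hence "\<bar>x u\<bar> * \<bar>d u\<bar> * \<bar>y u\<bar> \<le> \<bar>x u\<bar> * 1 * \<bar>y u\<bar>"
        using assms by (intro mult_mono) auto
      thus "\<bar>x u * d u * y u\<bar> \<le> \<bar>x u\<bar> * \<bar>y u\<bar>" by (simp add: abs_mult)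
    qed
    also have "\<dots> \<le> nrm n x * nrm n y" by (rule L2_set_mult_ineq)
    finally show ?thesis .
  qed
  thus ?thesis by (simp add: op_bounded_def)
qed

lemma op_bounded_mono:
  assumes "op_bounded n W S" "S \<le> T" "\<And>u v. u < n \<Longrightarrow> v < n \<Longrightarrow> W u v = W' u v"
  shows "op_bounded n W' T"
proof -
  have "\<bar>\<Sum>u<n. \<Sum>v<n. x u * W' u v * y v\<bar> \<le> T * nrm n x * nrm n y" for x y
  proof -
    have "\<bar>\<Sum>u<n. \<Sum>v<n. x u * W' u v * y v\<bar> \<le> S * nrm n x * nrm n y"
      using op_boundedD[OF assms(1), of x y] by (simp add: assms(3))
    also have "\<dots> \<le> T * nrm n x * nrm n y" using assms(2) by (intro mult_right_mono) auto
    finally show ?thesis .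
  qed
  thus ?thesis using op_bounded_nonneg[OF assms(1)] assms(2) by (simp add: op_bounded_def)
qed

text \<open>Union bounds over pairs of net points, over a vertex and a class, and over two vertices
  and a class.\<close>

definition edge_failure_bound :: "nat \<Rightarrow> nat \<Rightarrow> real" where
  "edge_failure_bound k n = 2 * exp (- 13 * real n) + real n * real k * (2 * exp (- (real n powr (1/2))))
     + real n * real n * real k * (2 * exp (- 2 * real n powr (1/2)))"

lemma powr_three_quarters:
  assumes "n > 0"
  shows "(real n powr (3/4))\<^sup>2 / real n = real n powr (1/2)"
proof -
  have "(real n powr (3/4))\<^sup>2 = real n powr (3/2)" by (simp add: power2_eq_square flip: powr_add)
  also have "\<dots> = real n powr (1/2 + 1)" by simp
  also have "\<dots> = real n powr (1/2) * real n powr 1" by (rule powr_add)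
  finally show ?thesis using assms by simp
qed

lemma prob_not_concentrated_edges_le:
  assumes P01: "\<And>i j. i < k \<Longrightarrow> j < k \<Longrightarrow> 0 \<le> P $$ (i, j) \<and> P $$ (i, j) \<le> 1"
    and P_sym: "\<And>i j. i < k \<Longrightarrow> j < k \<Longrightarrow> P $$ (i, j) = P $$ (j, i)"
    and c: "\<And>v. v < n \<Longrightarrow> c v < k" and n: "n > 0"
  shows "measure_pmf.prob (edge_pmf n P c) {b. \<not> concentrated_edges n k P c (edges_of b)} \<le> edge_failure_bound k n"
proof -
  let ?M = "edge_pmf n P c"
  define t where "t = real n powr (3/4)"
  have t: "t > 0" "t\<^sup>2 / n = real n powr (1/2)" using n powr_three_quarters[OF n] by (auto simp: t_def)
  define dev where "dev b x y = \<bar>\<Sum>u<n. \<Sum>v<n. x u * (adj b u v - model P c u v) * y v\<bar>"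
    for b and x y :: "nat \<Rightarrow> real"
  define cod where "cod b u v j = \<bar>\<Sum>w\<in>cluster n c j - {u,v}. adj b u w * adj b v w - P $$ (c u, c w) * P $$ (c v, c w)\<bar>"
    for b u v j
  \<comment> \<open>The factor \<open>7\<close> is the least integer for which the net can be paid:
    its pairs number at most \<open>exp (36 * n)\<close>, while each fails with probability at most
    \<open>2 * exp (- 49 * n)\<close>.\<close>
  define T where "T = 7 * sqrt n * (16 * real n)"
  have T: "T > 0" using n by (simp add: T_def)
  let ?Z = "int_net n \<times> int_net n"
  define B1 where "B1 = (\<Union>(z,z')\<in>?Z. {b. dev b (\<lambda>u. real_of_int (z u)) (\<lambda>u. real_of_int (z' u)) \<ge> T})"
  \<comment> \<open>A degree into a class is the bilinear form at two indicators, so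
    \<open>bilinear_tail\<close> covers it too.\<close>
  define B2 where "B2 = (\<Union>(u,j)\<in>{..<n} \<times> {..<k}. {b. dev b (indicator {u}) (indicator (cluster n c j)) \<ge> t})"
  define B3 where "B3 = (\<Union>((u,v),j)\<in>({..<n} \<times> {..<n} - Id) \<times> {..<k}. {b. cod b u v j \<ge> t})"
  have union: "measure_pmf.prob ?M (\<Union>i\<in>I. G i) \<le> real (card I) * q"
    if "finite I" "\<And>i. i \<in> I \<Longrightarrow> measure_pmf.prob ?M (G i) \<le> q" for I :: "'i set" and G q
  proof -
    have "measure_pmf.prob ?M (\<Union>i\<in>I. G i) \<le> (\<Sum>i\<in>I. measure_pmf.prob ?M (G i))"
      using that(1) by (intro measure_pmf.finite_measure_subadditive_finite) auto
    also have "\<dots> \<le> real (card I) * q" using sum_bounded_above[of I "\<lambda>i. measure_pmf.prob ?M (G i)" q] that(2) by simp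
    finally show ?thesis .
  qed
  have 1: "measure_pmf.prob ?M B1 \<le> 2 * exp (- 13 * real n)"
  proof -
    have "measure_pmf.prob ?M B1 \<le> real (card ?Z) * (2 * exp (- 49 * real n))"
      unfolding B1_def
    proof (rule union)
      fix zz assume "zz \<in> ?Z"
      then obtain z z' where zz: "zz = (z,z')" "z \<in> int_net n" "z' \<in> int_net n" by auto
      have sq: "(nrm n (\<lambda>u. real_of_int (z u)))\<^sup>2 * (nrm n (\<lambda>u. real_of_int (z' u)))\<^sup>2 \<le> (16 * real n) * (16 * real n)"
        using zz unfolding nrm_sq by (intro mult_mono sum_nonneg) (auto simp: int_net_def)
      have "measure_pmf.prob ?M {b. dev b (\<lambda>u. real_of_int (z u)) (\<lambda>u. real_of_int (z' u)) \<ge> T}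
        \<le> 2 * exp (- T\<^sup>2 / ((16 * real n) * (16 * real n)))"
        unfolding dev_def by (rule bilinear_tail[OF P01 P_sym c sq _ T]) (use n in auto)
      also have "- T\<^sup>2 / ((16 * real n) * (16 * real n)) = - 49 * real n"
        using n unfolding T_def power_mult_distrib by (simp add: power2_eq_square[of "real n"])
      finally show "measure_pmf.prob ?M (case zz of (z,z') \<Rightarrow> {b. dev b (\<lambda>u. real_of_int (z u)) (\<lambda>u. real_of_int (z' u)) \<ge> T})
        \<le> 2 * exp (- 49 * real n)" by (simp add: zz(1))
    qed (simp add: finite_int_net)
    also have "\<dots> \<le> (exp (18 * real n) * exp (18 * real n)) * (2 * exp (- 49 * real n))"
      unfolding card_cartesian_product of_nat_mult
      by (intro mult_right_mono mult_mono card_int_net_le) auto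
    also have "\<dots> = 2 * exp (- 13 * real n)" by (simp flip: exp_add)
    finally show ?thesis .
  qed
  have 2: "measure_pmf.prob ?M B2 \<le> real n * real k * (2 * exp (- (real n powr (1/2))))"
  proof -
    have "measure_pmf.prob ?M B2 \<le> real (card ({..<n} \<times> {..<k})) * (2 * exp (- (real n powr (1/2))))"
      unfolding B2_def
    proof (rule union)
      fix uj assume "uj \<in> {..<n} \<times> {..<k}"
      then obtain u j where uj: "uj = (u,j)" "u < n" by auto
      have sub: "cluster n c j \<subseteq> {..<n}" by (auto simp: cluster_def)
      have sq: "(nrm n (indicator {u}))\<^sup>2 * (nrm n (indicator (cluster n c j)))\<^sup>2 \<le> real n"
        using uj(2) card_mono[OF _ sub] by (simp add: nrm_indicator[OF sub] nrm_indicator)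
      have "measure_pmf.prob ?M {b. dev b (indicator {u}) (indicator (cluster n c j)) \<ge> t} \<le> 2 * exp (- t\<^sup>2 / real n)"
        unfolding dev_def by (rule bilinear_tail[OF P01 P_sym c sq _ t(1)]) (use n in auto)
      thus "measure_pmf.prob ?M (case uj of (u,j) \<Rightarrow> {b. dev b (indicator {u}) (indicator (cluster n c j)) \<ge> t})
        \<le> 2 * exp (- (real n powr (1/2)))" using t(2) by (simp add: uj(1))
    qed simp
    thus ?thesis by simp
  qed
  have 3: "measure_pmf.prob ?M B3 \<le> real n * real n * real k * (2 * exp (- 2 * real n powr (1/2)))"
  proof -
    have "measure_pmf.prob ?M (case uvj of ((u,v),j) \<Rightarrow> {b. cod b u v j \<ge> t}) \<le> 2 * exp (- 2 * real n powr (1/2))"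
      if uvj_in: "uvj \<in> ({..<n} \<times> {..<n} - Id) \<times> {..<k}" for uvj
    proof -
      obtain u v j where uvj: "uvj = ((u,v),j)" "u < n" "v < n" "u \<noteq> v" using uvj_in by auto
      have sub: "cluster n c j \<subseteq> {..<n}" by (auto simp: cluster_def)
      have "measure_pmf.prob ?M {b. cod b u v j \<ge> t} \<le> 2 * exp (- 2 * t\<^sup>2 / real n)"
        unfolding cod_def by (rule codegree_tail[OF P01 P_sym c uvj(2-4) sub t(1)])
      moreover have "- 2 * t\<^sup>2 / real n = - 2 * real n powr (1/2)" using t(2) by simp
      ultimately show ?thesis by (simp add: uvj(1))
    qed
    hence "measure_pmf.prob ?M B3 \<le> real (card (({..<n} \<times> {..<n} - Id) \<times> {..<k})) * (2 * exp (- 2 * real n powr (1/2)))"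
      unfolding B3_def by (intro union) auto
    also have "\<dots> \<le> (real n * real n * real k) * (2 * exp (- 2 * real n powr (1/2)))"
    proof (rule mult_right_mono)
      have "card ({..<n} \<times> {..<n} - Id) \<le> card ({..<n} \<times> {..<n})" by (rule card_mono) auto
      hence "card ({..<n} \<times> {..<n} - Id) * k \<le> n * n * k" by (simp add: card_cartesian_product)
      thus "real (card (({..<n} \<times> {..<n} - Id) \<times> {..<k})) \<le> real n * real n * real k"
        by (simp add: card_cartesian_product flip: of_nat_mult)
    qed simp
    finally show ?thesis .
  qed
  have good: "concentrated_edges n k P c (edges_of b)"
    if b: "b \<in> set_pmf ?M" and nb: "b \<notin> B1" "b \<notin> B2" "b \<notin> B3" for b
  proof -
    \<comment> \<open>Coordinates outside the slots surely have the default value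
      \<open>False\<close>, so symmetrizing \<open>b\<close> creates neither loops nor stray
      edges.\<close>
    have off: "\<not> b e" if "e \<notin> edge_slots n" for e
      using subsetD[OF set_Pi_pmf_subset[OF finite_edge_slots] b[unfolded edge_pmf_def]] that
      by (cases e) auto
    have ie: "ind_edge (edges_of b) u v = adj b u v" if "u < n" "v < n" for u v
      using off[of "(u,v)"] off[of "(v,u)"]
      by (cases u v rule: linorder_cases) (auto simp: ind_edge_def edges_of_def adj_def slot_def edge_slots_def)
    have Pd: "\<bar>P $$ (c u, c v)\<bar> \<le> 1" if "u < n" "v < n" for u v
      using P01[OF c c, OF that] by auto
    have adj01: "0 \<le> adj b u v" "adj b u v \<le> 1" for u v by (auto simp: adj_def)
    have "op_bounded n (\<lambda>u v. adj b u v - model P c u v) (2 * (7 * sqrt n))"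
    proof (rule op_bounded_from_net[OF n])
      fix z z' assume "z \<in> int_net n" "z' \<in> int_net n"
      hence "\<not> dev b (\<lambda>u. real_of_int (z u)) (\<lambda>u. real_of_int (z' u)) \<ge> T"
        using nb(1) by (auto simp: B1_def)
      thus "\<bar>\<Sum>u<n. \<Sum>v<n. real_of_int (z u) * (adj b u v - model P c u v) * real_of_int (z' v)\<bar> \<le> 7 * sqrt n * (16 * real n)"
        by (simp add: dev_def T_def)
    qed simp
    \<comment> \<open>The net argument doubles \<open>7 * sqrt n\<close>. Passing from
      \<open>model\<close> to the block matrix restores the diagonal at cost \<open>1\<close>, and
      \<open>14 * sqrt n + 1 \<le> 15 * sqrt n\<close>.\<close>
    from op_bounded_add[OF this op_bounded_diag[of n "\<lambda>u. - P $$ (c u, c u)"]]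
    have "op_bounded n (\<lambda>u v. adj b u v - model P c u v + (if u = v then - P $$ (c u, c u) else 0)) (2 * (7 * sqrt n) + 1)"
      using Pd by simp
    hence op: "op_bounded n (\<lambda>u v. ind_edge (edges_of b) u v - P $$ (c u, c v)) (15 * sqrt n)"
    proof (rule op_bounded_mono)
      show "2 * (7 * sqrt n) + 1 \<le> 15 * sqrt (real n)" using n by simp
    qed (auto simp: ie model_def)
    have deg: "\<bar>(\<Sum>v\<in>cluster n c j. ind_edge (edges_of b) u v) - P $$ (c u, j) * real (card (cluster n c j))\<bar> \<le> t + 1"
      if u: "u < n" and j: "j < k" for u j
    proof -
      let ?Y = "cluster n c j"
      have fY: "finite ?Y" "?Y \<subseteq> {..<n}" by (auto simp: cluster_def)
      have "(\<Sum>u'<n. \<Sum>v<n. indicator {u} u' * (adj b u' v - model P c u' v) * indicator ?Y v)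
         = (\<Sum>u'<n. if u' = u then (\<Sum>v<n. (adj b u v - model P c u v) * indicator ?Y v) else 0)"
        by (intro sum.cong) (auto simp: indicator_def)
      also have "\<dots> = (\<Sum>v<n. (adj b u v - model P c u v) * indicator ?Y v)" using u by simp
      also have "\<dots> = (\<Sum>v\<in>?Y. adj b u v - model P c u v)"
        using fY by (intro sum.mono_neutral_cong_right) auto
      finally have 1: "\<bar>\<Sum>v\<in>?Y. adj b u v - model P c u v\<bar> \<le> t"
        using nb(2) u j by (force simp: B2_def dev_def)
      have 2: "(\<Sum>v\<in>?Y. ind_edge (edges_of b) u v) - P $$ (c u, j) * card ?Y
        = (\<Sum>v\<in>?Y. adj b u v - model P c u v) - (\<Sum>v\<in>?Y. if v = u then P $$ (c u, j) else 0)"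
      proof -
        have "(\<Sum>v\<in>?Y. ind_edge (edges_of b) u v) - P $$ (c u, j) * card ?Y = (\<Sum>v\<in>?Y. ind_edge (edges_of b) u v - P $$ (c u, j))"
          by (simp add: sum_subtractf)
        also have "\<dots> = (\<Sum>v\<in>?Y. (adj b u v - model P c u v) - (if v = u then P $$ (c u, j) else 0))"
          using u by (intro sum.cong refl) (auto simp: cluster_def ie model_def)
        finally show ?thesis by (simp add: sum_subtractf)
      qed
      have 3: "\<bar>\<Sum>v\<in>?Y. if v = u then P $$ (c u, j) else 0\<bar> \<le> 1"
        using fY P01[OF c[OF u] j] by simp
      show ?thesis unfolding 2 using 1 3 by linarith
    qed
    have codeg: "\<bar>(\<Sum>w\<in>cluster n c j. ind_edge (edges_of b) u w * ind_edge (edges_of b) v w) - P $$ (c u, j) * P $$ (c v, j) * real (card (cluster n c j))\<bar> \<le> t + 2"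
      if uv: "u < n" "v < n" "u \<noteq> v" and j: "j < k" for u v j
    proof -
      let ?Y = "cluster n c j"
      let ?h = "\<lambda>w. adj b u w * adj b v w - P $$ (c u, j) * P $$ (c v, j)"
      have fY: "finite ?Y" "?Y \<subseteq> {..<n}" by (auto simp: cluster_def)
      have "(\<Sum>w\<in>?Y - {u,v}. adj b u w * adj b v w - P $$ (c u, c w) * P $$ (c v, c w)) = (\<Sum>w\<in>?Y - {u,v}. ?h w)"
        by (intro sum.cong refl) (auto simp: cluster_def)
      hence 1: "\<bar>\<Sum>w\<in>?Y - {u,v}. ?h w\<bar> \<le> t"
        using nb(3) uv j by (force simp: B3_def cod_def)
      have hb: "\<bar>?h w\<bar> \<le> 1" for w
      proof -
        have "0 \<le> adj b u w * adj b v w \<and> adj b u w * adj b v w \<le> 1" by (auto simp: adj_def)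
        moreover have "0 \<le> P $$ (c u, j) * P $$ (c v, j) \<and> P $$ (c u, j) * P $$ (c v, j) \<le> 1"
          using P01[OF c[OF uv(1)] j] P01[OF c[OF uv(2)] j] by (auto intro: mult_le_one)
        ultimately show ?thesis by linarith
      qed
      have "\<bar>\<Sum>w\<in>?Y \<inter> {u,v}. ?h w\<bar> \<le> (\<Sum>w\<in>?Y \<inter> {u,v}. 1)"
        by (rule order_trans[OF sum_abs], rule sum_mono, rule hb)
      also have "\<dots> \<le> 2" using card_mono[of "{u,v}" "?Y \<inter> {u,v}"] uv(3) by simp
      finally have 2: "\<bar>\<Sum>w\<in>?Y \<inter> {u,v}. ?h w\<bar> \<le> 2" .
      have "(\<Sum>w\<in>?Y. ind_edge (edges_of b) u w * ind_edge (edges_of b) v w) - P $$ (c u, j) * P $$ (c v, j) * card ?Y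
        = (\<Sum>w\<in>?Y. ind_edge (edges_of b) u w * ind_edge (edges_of b) v w - P $$ (c u, j) * P $$ (c v, j))"
        by (simp add: sum_subtractf)
      also have "\<dots> = (\<Sum>w\<in>?Y. ?h w)"
        using uv by (intro sum.cong refl) (auto simp: cluster_def ie)
      also have "\<dots> = (\<Sum>w\<in>?Y \<inter> {u,v}. ?h w) + (\<Sum>w\<in>?Y - {u,v}. ?h w)"
        by (rule sum.Int_Diff[OF fY(1)])
      finally show ?thesis using 1 2 by linarith
    qed
    show ?thesis unfolding concentrated_edges_def
      using op deg codeg by (auto simp: t_def)
  qed
  have "measure_pmf.prob ?M {b. \<not> concentrated_edges n k P c (edges_of b)} \<le> measure_pmf.prob ?M ((B1 \<union> B2) \<union> B3)"
    by (rule measure_pmf.finite_measure_mono_AE) (auto simp: AE_measure_pmf_iff intro: good)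
  also have "\<dots> \<le> measure_pmf.prob ?M (B1 \<union> B2) + measure_pmf.prob ?M B3"
    by (rule measure_Un_le) auto
  also have "\<dots> \<le> (measure_pmf.prob ?M B1 + measure_pmf.prob ?M B2) + measure_pmf.prob ?M B3"
    by (intro add_right_mono measure_Un_le) auto
  also have "\<dots> \<le> edge_failure_bound k n"
    unfolding edge_failure_bound_def using 1 2 3 by linarith
  finally show ?thesis .
qed

section \<open>Random labels and the joint law\<close>

lemma pmf_label_pmf:
  assumes r: "\<And>i. i < k \<Longrightarrow> r i > 0" and "(\<Sum>i<k. r i) = 1"
  shows "pmf (label_pmf k r) i = (if i < k then r i else 0)"
  unfolding label_pmf_def
proof (rule pmf_embed_pmf)
  show "0 \<le> (if i < k then r i else 0)" for i using r[of i] by (auto intro: less_imp_le)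
  have "(\<integral>\<^sup>+ i. ennreal (if i < k then r i else 0) \<partial>count_space UNIV) = (\<Sum>i<k. ennreal (if i < k then r i else 0))"
    by (rule nn_integral_count_space') auto
  also have "\<dots> = ennreal (\<Sum>i<k. if i < k then r i else 0)"
    using r by (intro sum_ennreal) (auto intro: less_imp_le)
  also have "(\<Sum>i<k. if i < k then r i else 0) = 1" using assms(2) by simp
  finally show "(\<integral>\<^sup>+ i. ennreal (if i < k then r i else 0) \<partial>count_space UNIV) = 1" by simp
qed

lemma prob_unbalanced_labels_le:
  assumes r: "\<And>i. i < k \<Longrightarrow> r i > 0" "(\<Sum>i<k. r i) = 1" and n: "n > 0"
  shows "measure_pmf.prob (Pi_pmf {..<n} 0 (\<lambda>_. label_pmf k r))
    {c. \<not> (\<forall>i<k. \<bar>real (card (cluster n c i)) - r i * real n\<bar> \<le> real n powr (3/4))} \<le> k * (2 * exp (- 2 * real n powr (1/2)))"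
proof -
  let ?M = "Pi_pmf {..<n} 0 (\<lambda>_. label_pmf k r)"
  let ?t = "real n powr (3/4)"
  have t: "?t > 0" using n by simp
  define X where "X i v c = (of_bool (c v = i) :: real)" for i v and c :: "nat \<Rightarrow> nat"
  have EX: "measure_pmf.expectation ?M (X i v) = r i" if "i < k" "v < n" for i v
  proof -
    have "measure_pmf.expectation ?M (X i v) = measure_pmf.expectation (map_pmf (\<lambda>c. c v) ?M) (indicator {i})"
    proof -
      have "X i v = (\<lambda>c. indicator {i} (c v))" by (auto simp: X_def indicator_def)
      thus ?thesis by (simp only:) (rule integral_map_pmf[symmetric])
    qed
    also have "map_pmf (\<lambda>c. c v) ?M = label_pmf k r" using that by (subst Pi_pmf_component) auto
    also have "measure_pmf.expectation (label_pmf k r) (indicator {i}) = pmf (label_pmf k r) i"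
      by (simp add: measure_pmf_single)
    finally show ?thesis using pmf_label_pmf[OF r] that by simp
  qed
  have one: "measure_pmf.prob ?M {c. \<bar>real (card (cluster n c i)) - r i * real n\<bar> \<ge> ?t} \<le> 2 * exp (- 2 * real n powr (1/2))"
    if i: "i < k" for i
  proof -
    have "measure_pmf.prob ?M {c. \<bar>(\<Sum>v<n. X i v c) - (\<Sum>v<n. measure_pmf.expectation ?M (X i v))\<bar> \<ge> ?t}
      \<le> 2 * exp (- 2 * ?t\<^sup>2 / real n)"
      by (rule hoeffding_Pi_pmf[where F = "\<lambda>v. {v}" and lo = "\<lambda>_. 0" and hi = "\<lambda>_. 1"])
        (use n t in \<open>auto simp: disjoint_family_on_def X_def\<close>)
    moreover have "- 2 * ?t\<^sup>2 / real n = - 2 * real n powr (1/2)" using powr_three_quarters[OF n] by simp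
    moreover have "(\<Sum>v<n. X i v c) = card (cluster n c i)" for c
    proof -
      have "(\<Sum>v<n. X i v c) = (\<Sum>v\<in>cluster n c i. 1)"
        by (intro sum.mono_neutral_cong_right) (auto simp: cluster_def X_def)
      thus ?thesis by simp
    qed
    moreover have "(\<Sum>v<n. measure_pmf.expectation ?M (X i v)) = r i * n" using EX[OF i] by simp
    ultimately show ?thesis by simp
  qed
  have "measure_pmf.prob ?M {c. \<not> (\<forall>i<k. \<bar>real (card (cluster n c i)) - r i * real n\<bar> \<le> ?t)}
    \<le> measure_pmf.prob ?M (\<Union>i\<in>{..<k}. {c. \<bar>real (card (cluster n c i)) - r i * real n\<bar> \<ge> ?t})"
    by (rule measure_pmf.finite_measure_mono) (auto simp: not_le less_imp_le)
  also have "\<dots> \<le> (\<Sum>i\<in>{..<k}. measure_pmf.prob ?M {c. \<bar>real (card (cluster n c i)) - r i * real n\<bar> \<ge> ?t})"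
    by (intro measure_pmf.finite_measure_subadditive_finite) auto
  also have "\<dots> \<le> (\<Sum>i\<in>{..<k}. 2 * exp (- 2 * real n powr (1/2)))"
    by (intro sum_mono one) auto
  finally show ?thesis by simp
qed

text \<open>Conditioning on the first stage: on \<open>B\<close> the trivial bound one is used,
  elsewhere the conditional bound \<open>\<delta>\<close>.\<close>

lemma prob_bind_pmf_le:
  assumes "\<And>x. x \<in> set_pmf p \<Longrightarrow> x \<notin> B \<Longrightarrow> measure_pmf.prob (f x) S \<le> \<delta>" and "\<delta> \<ge> 0"
  shows "measure_pmf.prob (bind_pmf p f) S \<le> measure_pmf.prob p B + \<delta>"
proof -
  have "emeasure (measure_pmf (bind_pmf p f)) S = (\<integral>\<^sup>+x. emeasure (f x) S \<partial>p)" by simp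
  also have "\<dots> \<le> (\<integral>\<^sup>+x. indicator B x + ennreal \<delta> \<partial>p)"
  proof (rule nn_integral_mono_AE, unfold AE_measure_pmf_iff, rule ballI)
    fix x assume x: "x \<in> set_pmf p"
    show "emeasure (measure_pmf (f x)) S \<le> indicator B x + ennreal \<delta>"
    proof (cases "x \<in> B")
      case True
      have "emeasure (measure_pmf (f x)) S \<le> 1" by (rule measure_pmf.emeasure_le_1)
      thus ?thesis using True by (simp add: add_increasing2)
    next
      case False
      thus ?thesis using assms(1)[OF x False] by (simp add: measure_pmf.emeasure_eq_measure ennreal_leI)
    qed
  qed
  also have "\<dots> = emeasure p B + ennreal \<delta>"
    by (subst nn_integral_add) (auto simp: measure_pmf.emeasure_space_1)
  finally have "ennreal (measure_pmf.prob (bind_pmf p f) S) \<le> ennreal (measure_pmf.prob p B + \<delta>)"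
    using assms(2) by (simp add: measure_pmf.emeasure_eq_measure)
  thus ?thesis using assms(2) by (subst (asm) ennreal_le_iff) (auto intro: add_nonneg_nonneg)
qed

lemma prob_not_concentrated_le:
  assumes P01: "\<And>i j. i < k \<Longrightarrow> j < k \<Longrightarrow> 0 \<le> P $$ (i, j) \<and> P $$ (i, j) \<le> 1"
    and P_sym: "\<And>i j. i < k \<Longrightarrow> j < k \<Longrightarrow> P $$ (i, j) = P $$ (j, i)"
    and r: "\<And>i. i < k \<Longrightarrow> r i > 0" "(\<Sum>i<k. r i) = 1" and n: "n > 0"
  shows "measure_pmf.prob (random_graph_pmf n k r P) {(c,E). \<not> concentrated n k r P c E}
    \<le> k * (2 * exp (- 2 * real n powr (1/2))) + edge_failure_bound k n"
proof -
  let ?L = "Pi_pmf {..<n} 0 (\<lambda>_. label_pmf k r)"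
  let ?f = "\<lambda>c. map_pmf (\<lambda>b. (c, edges_of b)) (edge_pmf n P c)"
  let ?B = "{c. \<not> (\<forall>i<k. \<bar>real (card (cluster n c i)) - r i * real n\<bar> \<le> real n powr (3/4))}"
  have eq: "random_graph_pmf n k r P = bind_pmf ?L ?f"
    by (simp add: random_graph_pmf_def edge_pmf_def edge_slots_def edges_of_def)
  have "measure_pmf.prob (bind_pmf ?L ?f) {(c,E). \<not> concentrated n k r P c E}
    \<le> measure_pmf.prob ?L ?B + edge_failure_bound k n"
  proof (rule prob_bind_pmf_le)
    fix c assume c: "c \<in> set_pmf ?L" and nB: "c \<notin> ?B"
    have ck: "c v < k" if "v < n" for v
    proof -
      have "c v \<in> set_pmf (label_pmf k r)" using c that by (auto simp: set_Pi_pmf PiE_dflt_def)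
      thus ?thesis using pmf_label_pmf[OF r, of "c v"] by (auto simp: set_pmf_iff split: if_splits)
    qed
    have "sym (edges_of b)" for b by (auto simp: sym_def edges_of_def)
    hence "(\<lambda>b. (c, edges_of b)) -` {(c,E). \<not> concentrated n k r P c E} = {b. \<not> concentrated_edges n k P c (edges_of b)}"
      using nB ck by (auto simp: concentrated_def)
    thus "measure_pmf.prob (?f c) {(c,E). \<not> concentrated n k r P c E} \<le> edge_failure_bound k n"
      using prob_not_concentrated_edges_le[OF P01 P_sym ck n] by simp
  qed (simp add: edge_failure_bound_def)
  thus ?thesis unfolding eq using prob_unbalanced_labels_le[OF r n] by linarith
qed

section \<open>Almost sure limits\<close>

text \<open>The adjugate times \<open>P\<close> is the determinant times the identity.
  Cauchy-Schwarz then bounds the norm of \<open>det P * z\<close> by that of \<open>P z\<close>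
  times the Frobenius norm of the adjugate; the \<open>1\<close> in \<open>S\<close> keeps the
  divisor positive.\<close>

lemma full_rank_lower_bound:
  fixes P :: "real mat"
  assumes P: "P \<in> carrier_mat k k" and rank: "vec_space.rank k P = k"
  obtains p0 where "p0 > 0" "\<And>z. p0\<^sup>2 * (\<Sum>i<k. (z i)\<^sup>2) \<le> (\<Sum>i<k. (\<Sum>j<k. P $$ (i,j) * z j)\<^sup>2)"
proof -
  define B where "B = adj_mat P"
  have B: "B \<in> carrier_mat k k" "B * P = Determinant.det P \<cdot>\<^sub>m 1\<^sub>m k" using adj_mat[OF P] by (auto simp: B_def)
  have det: "Determinant.det P \<noteq> 0" using vec_space.det_rank_iff[OF P] rank by simp
  define S where "S = 1 + (\<Sum>i<k. \<Sum>j<k. (B $$ (i,j))\<^sup>2)"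
  have S: "S > 0" unfolding S_def by (intro add_pos_nonneg sum_nonneg) auto
  define p0 where "p0 = \<bar>Determinant.det P\<bar> / sqrt S"
  have p0: "p0 > 0" using det S by (simp add: p0_def)
  have "p0\<^sup>2 * (\<Sum>i<k. (z i)\<^sup>2) \<le> (\<Sum>i<k. (\<Sum>j<k. P $$ (i,j) * z j)\<^sup>2)" for z
  proof -
    define y where "y i = (\<Sum>j<k. P $$ (i,j) * z j)" for i
    have BP: "(\<Sum>l<k. B $$ (i,l) * P $$ (l,j)) = (if i = j then Determinant.det P else 0)" if "i < k" "j < k" for i j
    proof -
      have "(B * P) $$ (i,j) = (\<Sum>l<k. B $$ (i,l) * P $$ (l,j))"
        using that P B(1) by (simp add: scalar_prod_def lessThan_atLeast0)
      thus ?thesis unfolding B(2) using that by (cases "i = j") auto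
    qed
    have z: "Determinant.det P * z i = (\<Sum>l<k. B $$ (i,l) * y l)" if i: "i < k" for i
    proof -
      have "(\<Sum>l<k. B $$ (i,l) * y l) = (\<Sum>l<k. \<Sum>j<k. B $$ (i,l) * P $$ (l,j) * z j)"
        by (simp add: y_def sum_distrib_left mult.assoc)
      also have "\<dots> = (\<Sum>j<k. (\<Sum>l<k. B $$ (i,l) * P $$ (l,j)) * z j)"
        by (subst sum.swap) (simp add: sum_distrib_right)
      also have "\<dots> = (\<Sum>j<k. if j = i then Determinant.det P * z j else 0)"
        using i by (intro sum.cong refl) (auto simp: BP)
      finally show ?thesis using i by simp
    qed
    have "(Determinant.det P)\<^sup>2 * (\<Sum>i<k. (z i)\<^sup>2) = (\<Sum>i<k. (\<Sum>l<k. B $$ (i,l) * y l)\<^sup>2)"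
      unfolding sum_distrib_left by (intro sum.cong refl) (simp add: power_mult_distrib flip: z)
    also have "\<dots> \<le> (\<Sum>i<k. (\<Sum>l<k. (B $$ (i,l))\<^sup>2) * (\<Sum>l<k. (y l)\<^sup>2))"
      by (intro sum_mono Cauchy_Schwarz_ineq_sum)
    also have "\<dots> = (\<Sum>i<k. \<Sum>l<k. (B $$ (i,l))\<^sup>2) * (\<Sum>l<k. (y l)\<^sup>2)"
      by (simp add: sum_distrib_right)
    also have "\<dots> \<le> S * (\<Sum>l<k. (y l)\<^sup>2)"
      unfolding S_def by (intro mult_right_mono sum_nonneg) auto
    finally have "(Determinant.det P)\<^sup>2 * (\<Sum>i<k. (z i)\<^sup>2) / S \<le> (\<Sum>l<k. (y l)\<^sup>2)"
      using S by (simp add: divide_le_eq mult.commute)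
    moreover have "p0\<^sup>2 = (Determinant.det P)\<^sup>2 / S" using S by (simp add: p0_def power_divide)
    ultimately show ?thesis by (simp add: y_def)
  qed
  thus thesis using p0 that by blast
qed

lemma eventually_less_linear:
  fixes f :: "nat \<Rightarrow> real"
  assumes "(\<lambda>n. f n / real n) \<longlonglongrightarrow> 0" "s > 0"
  shows "\<forall>\<^sub>F n in sequentially. f n < s * real n"
  using order_tendstoD(2)[OF assms] eventually_gt_at_top[of 0]
  by eventually_elim (simp add: divide_less_eq)

lemma eventually_inverse_sqrt_less:
  fixes C d :: real
  assumes "d > 0"
  shows "\<forall>\<^sub>F n in sequentially. C / sqrt (real n) < d"
proof -
  have "(\<lambda>n. 1 / sqrt (real n)) \<longlonglongrightarrow> 0" by real_asymp
  from tendsto_mult_right_zero[OF this, of C] have "(\<lambda>n. C / sqrt (real n)) \<longlonglongrightarrow> 0" by simp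
  thus ?thesis using assms by (rule order_tendstoD(2))
qed

section \<open>Constants determined by the model graph\<close>

locale model_graph =
  fixes k :: nat and r :: "nat \<Rightarrow> real" and P :: "real mat" and p0 :: real
  assumes k_pos: "k \<ge> 1" and r_pos: "\<And>i. i < k \<Longrightarrow> r i > 0" and r_sum: "(\<Sum>i<k. r i) = 1"
    and P_sym: "\<And>i j. i < k \<Longrightarrow> j < k \<Longrightarrow> P $$ (i,j) = P $$ (j,i)"
    and P01: "\<And>i j. i < k \<Longrightarrow> j < k \<Longrightarrow> 0 \<le> P $$ (i,j) \<and> P $$ (i,j) \<le> 1"
    and p0_pos: "p0 > 0"
    and p0: "\<And>z. p0\<^sup>2 * (\<Sum>i<k. (z i)\<^sup>2) \<le> (\<Sum>i<k. (\<Sum>j<k. P $$ (i,j) * z j)\<^sup>2)"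
begin

text \<open>\<open>\<sigma>\<close> is half the least class frequency. \<open>\<kappa>\<close> is
  half of \<open>rmin * p0\<^sup>2\<close>, since \<open>p0\<^sup>2\<close> bounds the row sums of
  \<open>P\<close> from below. \<open>\<delta>\<close> stays below the
  \<open>\<sigma> * p0 / 2\<close> required by the modularity count, and \<open>\<theta>\<close> is
  at most half of what \<open>md_coarse_greater\<close> allows. The minimum with \<open>1/2\<close>
  keeps both below one.\<close>

definition "rmin = Min (r ` {..<k})"
definition "\<sigma> = rmin / 2"
definition "\<kappa> = rmin * p0\<^sup>2 / 2"
definition "\<delta> = min (1/2) (\<sigma> * p0 / 4)"
definition "\<theta> = min (1/2) (p0 * \<kappa> * \<sigma> / (8 * (real k)\<^sup>2))"

lemma rmin: "rmin > 0" "\<And>i. i < k \<Longrightarrow> rmin \<le> r i"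
  using k_pos r_pos by (auto simp: rmin_def lessThan_empty_iff)

lemma \<sigma>_pos: "\<sigma> > 0" and \<kappa>_pos: "\<kappa> > 0"
  using rmin p0_pos by (auto simp: \<sigma>_def \<kappa>_def)

lemma \<delta>: "0 < \<delta>" "\<delta> < 1" "\<delta> < \<sigma> * p0 / 2"
proof -
  have "\<sigma> * p0 > 0" using \<sigma>_pos p0_pos by simp
  thus "0 < \<delta>" "\<delta> < 1" "\<delta> < \<sigma> * p0 / 2" by (simp_all add: \<delta>_def min_less_iff_disj)
qed

lemma \<theta>: "0 < \<theta>" "\<theta> < 1" "4 * (real k)\<^sup>2 * \<theta> / (\<kappa> * \<sigma>) < p0"
proof -
  have pos: "p0 * \<kappa> * \<sigma> / (8 * (real k)\<^sup>2) > 0" using \<sigma>_pos \<kappa>_pos p0_pos k_pos by simp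
  thus "0 < \<theta>" "\<theta> < 1" by (simp_all add: \<theta>_def min_less_iff_disj)
  have "4 * (real k)\<^sup>2 * \<theta> / (\<kappa> * \<sigma>) \<le> 4 * (real k)\<^sup>2 * (p0 * \<kappa> * \<sigma> / (8 * (real k)\<^sup>2)) / (\<kappa> * \<sigma>)"
    using \<sigma>_pos \<kappa>_pos by (intro divide_right_mono mult_left_mono) (auto simp: \<theta>_def)
  also have "\<dots> = p0 / 2" using \<sigma>_pos \<kappa>_pos k_pos by simp
  also have "\<dots> < p0" using p0_pos by simp
  finally show "4 * (real k)\<^sup>2 * \<theta> / (\<kappa> * \<sigma>) < p0" .
qed

text \<open>As \<open>P\<close> has entries in \<open>[0, 1]\<close>, row sums dominate the sums of squares, which \<open>p0\<close> controls.\<close>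

lemma row_sum_ge:
  assumes i: "i < k"
  shows "(\<Sum>l<k. P $$ (i,l)) \<ge> p0\<^sup>2"
proof -
  have "p0\<^sup>2 * (\<Sum>l<k. (if l = i then 1 else 0 :: real)\<^sup>2) \<le> (\<Sum>l<k. (\<Sum>j<k. P $$ (l,j) * (if j = i then 1 else 0))\<^sup>2)"
    by (rule p0)
  also have "\<dots> = (\<Sum>l<k. (P $$ (i,l))\<^sup>2)"
  proof (intro sum.cong refl)
    fix l assume "l \<in> {..<k}"
    hence l: "l < k" by simp
    have "(\<Sum>j<k. P $$ (l,j) * (if j = i then 1 else 0)) = (\<Sum>j<k. if j = i then P $$ (l,j) else 0)"
      by (intro sum.cong) auto
    thus "(\<Sum>j<k. P $$ (l,j) * (if j = i then 1 else 0))\<^sup>2 = (P $$ (i,l))\<^sup>2"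
      using i P_sym[OF i l] by simp
  qed
  also have "\<dots> \<le> (\<Sum>l<k. P $$ (i,l))"
    using P01[OF i] by (intro sum_mono) (auto simp: power2_eq_square mult_left_le)
  also have "(\<Sum>l<k. (if l = i then 1 else 0 :: real)\<^sup>2) = 1"
    using i by (simp add: if_distrib[of "\<lambda>x. x\<^sup>2"] cong: if_cong)
  finally show ?thesis by simp
qed

text \<open>The two inequalities say that \<open>n\<close> is large enough for the deviations to use
  up at most half of the lower bounds \<open>rmin * n\<close> for class sizes and
  \<open>2 * \<kappa> * n\<close> for degrees.\<close>

definition good :: "nat \<Rightarrow> (nat \<Rightarrow> nat) \<Rightarrow> (nat \<times> nat) set \<Rightarrow> bool" where
  "good n c E \<longleftrightarrow> n > 0 \<and> concentrated n k r P c E \<and> real n powr (3/4) \<le> \<sigma> * n \<and>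
     real k * (2 * real n powr (3/4) + 1) \<le> \<kappa> * n"

lemma good_block_approximation:
  assumes g: "good n c E"
  shows "block_approximation n k c (ind_edge E) (\<lambda>i j. P $$ (i,j)) 15 \<kappa> \<sigma> p0"
proof -
  define t where "t = real n powr (3/4)"
  have n: "n > 0" and conc: "concentrated n k r P c E" and s1: "t \<le> \<sigma> * n" and s2: "real k * (2 * t + 1) \<le> \<kappa> * n"
    using g by (auto simp: good_def t_def)
  have symE: "sym E" and ck: "\<And>v. v < n \<Longrightarrow> c v < k"
    and bal: "\<And>i. i < k \<Longrightarrow> \<bar>real (card (cluster n c i)) - r i * real n\<bar> \<le> t"
    and op: "op_bounded n (\<lambda>u v. ind_edge E u v - P $$ (c u, c v)) (15 * sqrt n)"
    and deg: "\<And>u j. u < n \<Longrightarrow> j < k \<Longrightarrow> \<bar>(\<Sum>v\<in>cluster n c j. ind_edge E u v) - P $$ (c u, j) * real (card (cluster n c j))\<bar> \<le> t + 1"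
    using conc by (auto simp: concentrated_def concentrated_edges_def t_def)
  have sumc: "(\<Sum>v<n. f v) = (\<Sum>i<k. \<Sum>v\<in>cluster n c i. f v)" for f :: "nat \<Rightarrow> real"
    using ck by (rule sum_over_clusters)
  have card_ge: "real (card (cluster n c i)) \<ge> rmin * n - t" if "i < k" for i
  proof -
    have "rmin * n \<le> r i * n" using rmin(2)[OF that] by (intro mult_right_mono) auto
    thus ?thesis using bal[OF that] by linarith
  qed
  have t0: "t \<ge> 0" by (simp add: t_def)
  \<comment> \<open>\<open>2 * \<kappa> = rmin * p0\<^sup>2\<close>, and each of the
    \<open>k\<close> classes loses at most \<open>t\<close> because the entries of \<open>P\<close>
    are at most one.\<close>
  have model: "(\<Sum>l<k. P $$ (i,l) * real (card (cluster n c l))) \<ge> 2 * \<kappa> * n - k * t" if i: "i < k" for i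
  proof -
    have "2 * \<kappa> * n - k * t \<le> (\<Sum>l<k. P $$ (i,l)) * (rmin * n) - k * t"
      using mult_right_mono[OF row_sum_ge[OF i], of "rmin * n"] rmin(1) by (simp add: \<kappa>_def mult_ac)
    also have "\<dots> = (\<Sum>l<k. P $$ (i,l) * (rmin * n) - t)" by (simp add: sum_subtractf sum_distrib_right)
    also have "\<dots> \<le> (\<Sum>l<k. P $$ (i,l) * real (card (cluster n c l)))"
    proof (rule sum_mono)
      fix l assume "l \<in> {..<k}"
      hence l: "l < k" by simp
      have "P $$ (i,l) * (rmin * n - real (card (cluster n c l))) \<le> P $$ (i,l) * t"
        using card_ge[OF l] P01[OF i l] by (intro mult_left_mono) auto
      also have "\<dots> \<le> 1 * t" using P01[OF i l] t0 by (intro mult_right_mono) auto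
      finally show "P $$ (i,l) * (rmin * n) - t \<le> P $$ (i,l) * real (card (cluster n c l))"
        by (simp add: algebra_simps)
    qed
    finally show ?thesis .
  qed
  have model_sum: "(\<Sum>u<n. P $$ (i, c u)) = (\<Sum>l<k. P $$ (i,l) * real (card (cluster n c l)))" for i
    unfolding sumc by (intro sum.cong refl) (simp add: cluster_def mult.commute)
  show ?thesis
  proof
    fix i assume i: "i < k"
    have "2 * \<sigma> = rmin" by (simp add: \<sigma>_def)
    hence "2 * (\<sigma> * n) = rmin * n" by simp
    thus "\<sigma> * real n \<le> real (card (cluster n c i))" using card_ge[OF i] s1 by linarith
  next
    fix i assume i: "i < k"
    have "k * t \<le> real k * (2 * t + 1)" using t0 by (intro mult_left_mono) auto
    thus "\<kappa> * real n \<le> (\<Sum>u<n. P $$ (i, c u))" unfolding model_sum using model[OF i] s2 by linarith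
  next
    fix v assume v: "v < n"
    have "2 * \<kappa> * n - k * t - k * (t + 1) \<le> (\<Sum>l<k. P $$ (c v,l) * real (card (cluster n c l))) - k * (t + 1)"
      using model[OF ck[OF v]] by simp
    also have "\<dots> = (\<Sum>l<k. P $$ (c v,l) * real (card (cluster n c l)) - (t + 1))" by (simp add: sum_subtractf)
    also have "\<dots> \<le> (\<Sum>l<k. \<Sum>u\<in>cluster n c l. ind_edge E v u)"
    proof (rule sum_mono)
      fix l assume "l \<in> {..<k}"
      thus "P $$ (c v,l) * real (card (cluster n c l)) - (t + 1) \<le> (\<Sum>u\<in>cluster n c l. ind_edge E v u)"
        using deg[OF v, of l] by simp
    qed
    finally have "2 * \<kappa> * n - k * t - k * (t + 1) \<le> (\<Sum>u<n. ind_edge E v u)" by (simp add: sumc)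
    moreover have "k * t + k * (t + 1) = real k * (2 * t + 1)" by (simp add: algebra_simps)
    ultimately show "\<kappa> * real n \<le> (\<Sum>u<n. ind_edge E v u)" using s2 by linarith
  qed (use k_pos n ck P_sym P01 op \<sigma>_pos \<kappa>_pos p0_pos p0 symE in \<open>auto simp: ind_edge_def sym_def\<close>)
qed

lemma inverse_sqrt_le_powr:
  assumes "n > 0" "\<tau> < 1/2"
  shows "1 / sqrt (real n) \<le> real n powr (- \<tau>)"
proof -
  have "1 / sqrt (real n) = real n powr (- (1/2))"
    using assms by (simp add: powr_minus powr_half_sqrt field_simps)
  also have "\<dots> \<le> real n powr (- \<tau>)" using assms by (intro powr_mono) auto
  finally show ?thesis .
qed

section \<open>Deterministic consequences along a concentrated sequence\<close>

context
  fixes c :: "nat \<Rightarrow> nat \<Rightarrow> nat" and E :: "nat \<Rightarrow> (nat \<times> nat) set"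
  assumes conc: "\<forall>\<^sub>F n in sequentially. concentrated n k r P (c n) (E n)"
begin

abbreviation "U n \<equiv> cluster n (c n)"
abbreviation "A n \<equiv> adjacency_matrix n (E n)"

lemma eventually_good: "\<forall>\<^sub>F n in sequentially. good n (c n) (E n)"
proof -
  have "\<forall>\<^sub>F n in sequentially. n > 0" by (rule eventually_gt_at_top)
  moreover have "\<forall>\<^sub>F n in sequentially. real n powr (3/4) < \<sigma> * real n"
    by (rule eventually_less_linear[OF _ \<sigma>_pos]) real_asymp
  moreover have "\<forall>\<^sub>F n in sequentially. real k * (2 * real n powr (3/4) + 1) < \<kappa> * real n"
  proof (rule eventually_less_linear[OF _ \<kappa>_pos])
    have "(\<lambda>n. (2 * real n powr (3/4) + 1) / real n) \<longlonglongrightarrow> 0" by real_asymp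
    from tendsto_mult_right_zero[OF this, of "real k"]
    show "(\<lambda>n. real k * (2 * real n powr (3/4) + 1) / real n) \<longlonglongrightarrow> 0" by simp
  qed
  ultimately show ?thesis using conc by eventually_elim (simp add: good_def)
qed

lemma A_carrier: "A n \<in> carrier_mat n n" by (simp add: adjacency_matrix_def)

lemma A_index: "u < n \<Longrightarrow> v < n \<Longrightarrow> A n $$ (u,v) = ind_edge (E n) u v"
  by (simp add: adjacency_matrix_def ind_edge_def)

lemma class_frequencies:
  assumes i: "i < k"
  shows "(\<lambda>n. real (card (U n i)) / real n) \<longlonglongrightarrow> r i"
proof -
  have "\<forall>\<^sub>F n in sequentially. norm (real (card (U n i)) / real n - r i) \<le> real n powr (3/4) / real n"
    using conc eventually_gt_at_top[of 0]
  proof eventually_elim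
    case (elim n)
    have "\<bar>real (card (U n i)) - r i * real n\<bar> \<le> real n powr (3/4)" using elim i by (simp add: concentrated_def)
    hence "\<bar>real (card (U n i)) - r i * real n\<bar> / n \<le> real n powr (3/4) / n" by (rule divide_right_mono) simp
    moreover have "real (card (U n i)) / real n - r i = (real (card (U n i)) - r i * real n) / n"
      using elim by (simp add: diff_divide_distrib)
    ultimately show ?case by simp
  qed
  moreover have "(\<lambda>n. real n powr (3/4) / real n) \<longlonglongrightarrow> 0" by real_asymp
  ultimately have "(\<lambda>n. real (card (U n i)) / real n - r i) \<longlonglongrightarrow> 0" by (rule Lim_null_comparison)
  thus ?thesis by (simp add: LIM_zero_iff)
qed

lemma homomorphism_densities:
  assumes F: "simple_graph VF EF"
  shows "(\<lambda>n. real (hom_count VF EF {..<n} (E n)) / real n ^ card VF) \<longlonglongrightarrow> hom_model VF EF k r P"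
proof -
  define M where "M n = (\<Sum>\<psi>\<in>VF \<rightarrow>\<^sub>E {..<k}. (\<Prod>i\<in>VF. real (card (U n (\<psi> i))) / n) *
        (\<Prod>(i,j)\<in>{(i,j)\<in>EF. i < j}. P $$ (\<psi> i, \<psi> j)))" for n
  have M: "M \<longlonglongrightarrow> hom_model VF EF k r P"
    unfolding M_def hom_model_def
    by (intro tendsto_sum tendsto_mult tendsto_prod tendsto_const class_frequencies) auto
  have "\<forall>\<^sub>F n in sequentially. norm (real (hom_count VF EF {..<n} (E n)) / real n ^ card VF - M n)
      \<le> card EF * (15 * sqrt (real n)) / real n"
    using conc eventually_gt_at_top[of 0]
  proof eventually_elim
    case (elim n)
    thus ?case unfolding M_def real_norm_def
      using P01 by (intro hom_density_close[OF F, where p = "\<lambda>i j. P $$ (i,j)"])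
        (auto simp: concentrated_def concentrated_edges_def ind_edge_def)
  qed
  moreover have "(\<lambda>n. card EF * (15 * sqrt (real n)) / real n) \<longlonglongrightarrow> 0" by real_asymp
  ultimately have "(\<lambda>n. real (hom_count VF EF {..<n} (E n)) / real n ^ card VF - M n) \<longlonglongrightarrow> 0"
    by (rule Lim_null_comparison)
  from tendsto_add[OF this M] show ?thesis by simp
qed

lemma adjacency_spectrum:
  "\<exists>a b C C'. 0 < a \<and> (\<forall>\<^sub>F n in sequentially.
     let L = {# l \<in># eigvals_mset (A n). a * real n \<le> \<bar>l\<bar> \<and> \<bar>l\<bar> \<le> b * real n #} in
       size L = k \<and>
       (\<forall>l \<in># eigvals_mset (A n) - L. \<bar>l\<bar> \<le> C * sqrt (real n)) \<and>
       (\<forall>us. orthonormal_eigenvectors (A n) L us \<longrightarrow> k_variance k n us \<le> C' / real n))"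
proof -
  have ev: "\<forall>\<^sub>F n in sequentially. 15 * sqrt (real n) < \<sigma> * p0 / 4 * real n"
  proof (rule eventually_less_linear)
    show "(\<lambda>n. 15 * sqrt (real n) / real n) \<longlonglongrightarrow> 0" by real_asymp
  qed (use \<sigma>_pos p0_pos in simp)
  have "\<forall>\<^sub>F n in sequentially.
     let L = {# l \<in># eigvals_mset (A n). \<sigma> * p0 / 4 * real n \<le> \<bar>l\<bar> \<and> \<bar>l\<bar> \<le> 1 * real n #} in
       size L = k \<and>
       (\<forall>l \<in># eigvals_mset (A n) - L. \<bar>l\<bar> \<le> 15 * sqrt (real n)) \<and>
       (\<forall>us. orthonormal_eigenvectors (A n) L us \<longrightarrow>
          k_variance k n us \<le> (k * (4 * 15 / (\<sigma> * p0))\<^sup>2) / real n)"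
    using eventually_good ev
  proof eventually_elim
    case (elim n)
    interpret B: block_approximation n k "c n" "ind_edge (E n)" "\<lambda>i j. P $$ (i,j)" 15 \<kappa> \<sigma> p0
      using elim(1) by (rule good_block_approximation)
    note S = B.structural_eigvals_adjacency[OF A_carrier A_index elim(2)]
    show ?case unfolding Let_def
      using S B.k_variance_le[OF A_carrier A_index elim(2) _ S(1)] by simp
  qed
  moreover have "0 < \<sigma> * p0 / 4" using \<sigma>_pos p0_pos by simp
  ultimately show ?thesis by blast
qed

text \<open>The bulk bound for the modularity matrix, multiplied by \<open>sqrt n\<close>.\<close>

definition "\<epsilon>0 = 15 / \<kappa> * (1 + 1 / sqrt (\<kappa> * \<sigma>))"

lemma eventually_modularity_gap:
  "\<forall>\<^sub>F n in sequentially. good n (c n) (E n) \<and> 15 / (\<kappa> * sqrt (real n)) * (1 + 1 / sqrt (\<kappa> * \<sigma>)) \<le> \<delta>"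
proof -
  have "\<forall>\<^sub>F n in sequentially. \<epsilon>0 / sqrt (real n) < \<delta>" using \<delta>(1) by (rule eventually_inverse_sqrt_less)
  thus ?thesis using eventually_good by eventually_elim (simp add: \<epsilon>0_def)
qed

lemma modularity_eigvals_count:
  "\<forall>\<^sub>F n in sequentially. size {# l \<in># eigvals_mset (normalized_modularity (A n)). \<bar>l\<bar> > \<delta> #} = k - 1"
  using eventually_modularity_gap
proof eventually_elim
  case (elim n)
  interpret B: block_approximation n k "c n" "ind_edge (E n)" "\<lambda>i j. P $$ (i,j)" 15 \<kappa> \<sigma> p0
    using elim by (intro good_block_approximation) simp
  show ?case by (rule B.structural_eigvals_modularity(1)[OF A_carrier A_index \<delta>(1,3) conjunct2[OF elim]])
qed

text \<open>The rates obtained are \<open>1 / sqrt n\<close> and \<open>1 / n\<close>, which imply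
  the claim for every \<open>\<tau> < 1/2\<close> with constants that do not depend on
  \<open>\<tau>\<close>.\<close>

lemma modularity_spectrum:
  assumes \<tau>: "0 < \<tau>" "\<tau> < 1/2"
  shows "\<exists>C C'. \<forall>\<^sub>F n in sequentially.
    let L = {# l \<in># eigvals_mset (normalized_modularity (A n)). \<bar>l\<bar> > \<delta> #} in
      (\<forall>l \<in># eigvals_mset (normalized_modularity (A n)) - L. \<bar>l\<bar> \<le> C * real n powr (- \<tau>)) \<and>
      (\<forall>us. orthonormal_eigenvectors (normalized_modularity (A n)) L us \<longrightarrow>
         weighted_k_variance k (A n) us \<le> C' * real n powr (- 2 * \<tau>))"
proof -
  define C' where "C' = real k * ((1 / \<kappa> + 1 / \<kappa>\<^sup>2) * 15 / \<delta>)\<^sup>2"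
  have "\<forall>\<^sub>F n in sequentially.
    let L = {# l \<in># eigvals_mset (normalized_modularity (A n)). \<bar>l\<bar> > \<delta> #} in
      (\<forall>l \<in># eigvals_mset (normalized_modularity (A n)) - L. \<bar>l\<bar> \<le> \<epsilon>0 * real n powr (- \<tau>)) \<and>
      (\<forall>us. orthonormal_eigenvectors (normalized_modularity (A n)) L us \<longrightarrow>
         weighted_k_variance k (A n) us \<le> C' * real n powr (- 2 * \<tau>))"
    using eventually_modularity_gap eventually_gt_at_top[of 0]
  proof eventually_elim
    case (elim n)
    interpret B: block_approximation n k "c n" "ind_edge (E n)" "\<lambda>i j. P $$ (i,j)" 15 \<kappa> \<sigma> p0
      using elim by (intro good_block_approximation) simp
    note gap = conjunct2[OF elim(1)]
    note S = B.structural_eigvals_modularity[OF A_carrier A_index \<delta>(1,3) gap]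
    have "15 / (\<kappa> * sqrt (real n)) * (1 + 1 / sqrt (\<kappa> * \<sigma>)) = \<epsilon>0 * (1 / sqrt (real n))"
      by (simp add: \<epsilon>0_def)
    also have "\<dots> \<le> \<epsilon>0 * real n powr (- \<tau>)"
      using inverse_sqrt_le_powr[OF elim(2) \<tau>(2)] \<kappa>_pos \<sigma>_pos by (intro mult_left_mono) (auto simp: \<epsilon>0_def)
    finally have le1: "15 / (\<kappa> * sqrt (real n)) * (1 + 1 / sqrt (\<kappa> * \<sigma>)) \<le> \<epsilon>0 * real n powr (- \<tau>)" .
    have "C' / real n = C' * real n powr (-1)" using elim by (simp add: powr_minus field_simps)
    also have "\<dots> \<le> C' * real n powr (- 2 * \<tau>)"
      using elim \<tau> by (intro mult_left_mono powr_mono) (auto simp: C'_def)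
    finally have le2: "C' / real n \<le> C' * real n powr (- 2 * \<tau>)" .
    have var: "weighted_k_variance k (A n) us \<le> C' * real n powr (- 2 * \<tau>)"
      if "orthonormal_eigenvectors (normalized_modularity (A n)) {# l \<in># eigvals_mset (normalized_modularity (A n)). \<bar>l\<bar> > \<delta> #} us" for us
      using B.weighted_k_variance_le[OF A_carrier A_index \<delta>(1,3) gap that S(1)] le2 by (simp add: C'_def)
    show ?case unfolding Let_def using S(2) le1 var by (auto intro: order_trans)
  qed
  thus ?thesis by blast
qed

lemma coarse_discrepancy:
  "\<forall>\<^sub>F n in sequentially. \<forall>m. 1 \<le> m \<and> m \<le> k - 1 \<longrightarrow> md_min m (A n) > \<theta>"
proof -
  have "\<forall>\<^sub>F n in sequentially. (15 * (1 + 2 / \<kappa>\<^sup>2) / \<kappa>) / sqrt (real n) < \<theta>"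
    using \<theta>(1) by (rule eventually_inverse_sqrt_less)
  thus ?thesis using eventually_good
  proof eventually_elim
    case (elim n)
    interpret B: block_approximation n k "c n" "ind_edge (E n)" "\<lambda>i j. P $$ (i,j)" 15 \<kappa> \<sigma> p0
      using elim(2) by (rule good_block_approximation)
    have small: "B.K' / (\<kappa> * sqrt (real n)) \<le> \<theta>" using elim(1) by (simp add: B.K'_def)
    have "md_min m (A n) > \<theta>" if "1 \<le> m" "m \<le> k - 1" for m
      using that by (intro B.md_min_greater[OF A_carrier A_index _ _ small \<theta>(3)]) auto
    thus ?case by blast
  qed
qed

lemma cluster_discrepancy:
  assumes \<tau>: "0 < \<tau>" "\<tau> < 1/2"
  shows "(\<lambda>n. md (A n) (U n ` {..<k})) \<in> O(\<lambda>n. real n powr (- \<tau>))"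
proof (rule bigoI)
  let ?C = "2 * (15 * (1 + 2 / \<kappa>\<^sup>2)) / \<kappa>"
  show "\<forall>\<^sub>F n in sequentially. norm (md (A n) (U n ` {..<k})) \<le> ?C * norm (real n powr (- \<tau>))"
    using eventually_good eventually_gt_at_top[of 0]
  proof eventually_elim
    case (elim n)
    interpret B: block_approximation n k "c n" "ind_edge (E n)" "\<lambda>i j. P $$ (i,j)" 15 \<kappa> \<sigma> p0
      using elim(1) by (rule good_block_approximation)
    have "md (A n) (U n ` {..<k}) \<le> 2 * B.K' / (\<kappa> * sqrt (real n))"
      by (rule B.md_clusters_le[OF A_carrier A_index])
    also have "\<dots> = ?C * (1 / sqrt (real n))" by (simp add: B.K'_def)
    also have "\<dots> \<le> ?C * real n powr (- \<tau>)"
      using inverse_sqrt_le_powr[OF elim(2) \<tau>(2)] \<kappa>_pos by (intro mult_left_mono) auto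
    finally show ?case using B.md_clusters_nonneg[OF A_carrier A_index] by simp
  qed
qed

lemma degrees_into_classes:
  assumes ij: "i \<le> j" "j < k" and \<epsilon>: "\<epsilon> > 0"
  shows "\<forall>\<^sub>F n in sequentially. \<forall>u \<in> U n i.
    \<bar>(\<Sum>v \<in> U n j. A n $$ (u, v)) - P $$ (i, j) * real (card (U n j))\<bar> \<le> \<epsilon> * real n"
proof -
  have "\<forall>\<^sub>F n in sequentially. real n powr (3/4) + 1 \<le> \<epsilon> * real n" using \<epsilon> by real_asymp
  with conc show ?thesis
  proof eventually_elim
    case (elim n)
    show ?case
    proof
      fix u assume "u \<in> U n i"
      hence u: "u < n" "c n u = i" by (auto simp: cluster_def)
      have "\<bar>(\<Sum>v\<in>U n j. ind_edge (E n) u v) - P $$ (c n u, j) * real (card (U n j))\<bar> \<le> real n powr (3/4) + 1"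
        using elim(1) u(1) ij(2) unfolding concentrated_def concentrated_edges_def by blast
      moreover have "(\<Sum>v\<in>U n j. A n $$ (u, v)) = (\<Sum>v\<in>U n j. ind_edge (E n) u v)"
        using u by (intro sum.cong refl A_index) (auto simp: cluster_def)
      ultimately show "\<bar>(\<Sum>v \<in> U n j. A n $$ (u, v)) - P $$ (i, j) * real (card (U n j))\<bar> \<le> \<epsilon> * real n"
        using elim(2) u by simp
    qed
  qed
qed

lemma codegrees_into_classes:
  assumes ij: "i \<le> j" "j < k" and \<epsilon>: "\<epsilon> > 0"
  shows "\<forall>\<^sub>F n in sequentially. \<forall>u \<in> U n i. \<forall>v \<in> U n i. u \<noteq> v \<longrightarrow>
    \<bar>(\<Sum>t \<in> U n j. A n $$ (u, t) * A n $$ (v, t)) - (P $$ (i, j))\<^sup>2 * real (card (U n j))\<bar> \<le> \<epsilon> * real n"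
proof -
  have "\<forall>\<^sub>F n in sequentially. real n powr (3/4) + 2 \<le> \<epsilon> * real n" using \<epsilon> by real_asymp
  with conc show ?thesis
  proof eventually_elim
    case (elim n)
    show ?case
    proof (intro ballI impI)
      fix u v assume "u \<in> U n i" "v \<in> U n i" and uv: "u \<noteq> v"
      hence u: "u < n" "c n u = i" "v < n" "c n v = i" by (auto simp: cluster_def)
      have "\<bar>(\<Sum>t\<in>U n j. ind_edge (E n) u t * ind_edge (E n) v t) - P $$ (c n u, j) * P $$ (c n v, j) * real (card (U n j))\<bar> \<le> real n powr (3/4) + 2"
        using elim(1) u(1,3) ij(2) uv unfolding concentrated_def concentrated_edges_def by blast
      moreover have "(\<Sum>t\<in>U n j. A n $$ (u, t) * A n $$ (v, t)) = (\<Sum>t\<in>U n j. ind_edge (E n) u t * ind_edge (E n) v t)"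
        using u by (intro sum.cong refl) (auto simp: cluster_def A_index)
      ultimately show "\<bar>(\<Sum>t \<in> U n j. A n $$ (u, t) * A n $$ (v, t)) - (P $$ (i, j))\<^sup>2 * real (card (U n j))\<bar> \<le> \<epsilon> * real n"
        using elim(2) u by (simp add: power2_eq_square)
    qed
  qed
qed

end

text \<open>The slowest term is of order \<open>n * exp (- sqrt n)\<close>, still far below
  \<open>1 / n\<^sup>2\<close>.\<close>

lemma summable_failure_bound:
  "summable (\<lambda>n. real k * (2 * exp (- 2 * real n powr (1/2))) + edge_failure_bound k n)"
proof (rule summable_comparison_test_bigo)
  show "summable (\<lambda>n. norm (inverse (real n ^ 2)))"
    using inverse_power_summable[of 2, where 'a = real] by simp
  have "real k > 0" using k_pos by simp
  thus "(\<lambda>n. real k * (2 * exp (- 2 * real n powr (1/2))) + edge_failure_bound k n) \<in> O(\<lambda>n. inverse (real n ^ 2))"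
    unfolding edge_failure_bound_def by real_asymp
qed

text \<open>This half of Borel-Cantelli needs no independence: the law of each single pair of labels
  and edges suffices.\<close>

lemma AE_eventually_concentrated:
  assumes G: "generalized_random_graph_sequence M k r P c E"
  shows "AE \<omega> in M. \<forall>\<^sub>F n in sequentially. concentrated n k r P (c n \<omega>) (E n \<omega>)"
proof -
  interpret prob_space M using G by (simp add: generalized_random_graph_sequence_def)
  define X where "X n \<omega> = (c n \<omega>, E n \<omega>)" for n \<omega>
  have X [measurable]: "X n \<in> M \<rightarrow>\<^sub>M count_space UNIV"
    and distr: "distr M (count_space UNIV) (X n) = measure_pmf (random_graph_pmf n k r P)" for n
    using G by (auto simp: generalized_random_graph_sequence_def X_def[abs_def])
  define Bad where "Bad n = {(c,E). \<not> concentrated n k r P c E}" for n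
  define F where "F n = X n -` Bad n \<inter> space M" for n
  have F: "F n \<in> sets M" for n unfolding F_def by (rule measurable_sets[OF X]) simp
  have prob: "prob (F n) = measure_pmf.prob (random_graph_pmf n k r P) (Bad n)" for n
    unfolding distr[symmetric] F_def by (subst measure_distr[OF X]) auto
  have "AE \<omega> in M. \<forall>\<^sub>F n in sequentially. \<omega> \<in> space M - F n"
  proof (rule borel_cantelli_AE1[OF F])
    show "emeasure M (F n) < \<infinity>" for n by (simp add: emeasure_eq_measure)
    show "summable (\<lambda>n. prob (F n))"
    proof (rule summable_comparison_test_ev[OF _ summable_failure_bound])
      show "\<forall>\<^sub>F n in sequentially. norm (prob (F n)) \<le> real k * (2 * exp (- 2 * real n powr (1/2))) + edge_failure_bound k n"
        using eventually_gt_at_top[of 0]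
      proof eventually_elim
        case (elim n)
        thus ?case unfolding prob Bad_def
          using prob_not_concentrated_le[OF P01 P_sym r_pos r_sum elim] by simp
      qed
    qed
  qed
  thus ?thesis
  proof eventually_elim
    case (elim \<omega>)
    thus ?case by eventually_elim (auto simp: F_def Bad_def X_def)
  qed
qed

end

theorem theorem1:
  fixes k :: nat and r :: "nat \<Rightarrow> real" and P :: "real mat"
  assumes "k \<ge> 1"
    and "\<forall>i<k. r i > 0"
    and "(\<Sum>i<k. r i) = 1"
    and "P \<in> carrier_mat k k"
    and "transpose_mat P = P"
    and "vec_space.rank k P = k"
    and "\<forall>i<k. \<forall>j<k. 0 \<le> P $$ (i, j) \<and> P $$ (i, j) \<le> 1"
  shows
    "\<exists>\<delta> \<theta>. 0 < \<delta> \<and> \<delta> < 1 \<and> 0 < \<theta> \<and> \<theta> < 1 \<and>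
      (\<forall>(M :: 'a measure) c E. generalized_random_graph_sequence M k r P c E \<longrightarrow>
        (AE \<omega> in M.
          let U = (\<lambda>n. cluster n (c n \<omega>));
              A = (\<lambda>n. adjacency_matrix n (E n \<omega>));
              MD = (\<lambda>n. normalized_modularity (A n))
          in
            (\<forall>i<k. (\<lambda>n. real (card (U n i)) / real n) \<longlonglongrightarrow> r i)
          \<and>
            (\<forall>VF EF. simple_graph VF EF \<longrightarrow>
              (\<lambda>n. real (hom_count VF EF {..<n} (E n \<omega>)) / real n ^ card VF)
                \<longlonglongrightarrow> hom_model VF EF k r P)
          \<and>
            (\<exists>a b C C'. 0 < a \<and> (\<forall>\<^sub>F n in sequentially.
              let L = {# l \<in># eigvals_mset (A n). a * real n \<le> \<bar>l\<bar> \<and> \<bar>l\<bar> \<le> b * real n #} in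
                size L = k \<and>
                (\<forall>l \<in># eigvals_mset (A n) - L. \<bar>l\<bar> \<le> C * sqrt (real n)) \<and>
                (\<forall>us. orthonormal_eigenvectors (A n) L us \<longrightarrow> k_variance k n us \<le> C' / real n)))
          \<and>
            (\<forall>\<^sub>F n in sequentially. size {# l \<in># eigvals_mset (MD n). \<bar>l\<bar> > \<delta> #} = k - 1)
          \<and>
            (\<forall>\<tau>. 0 < \<tau> \<and> \<tau> < 1 / 2 \<longrightarrow> (\<exists>C C'. \<forall>\<^sub>F n in sequentially.
              let L = {# l \<in># eigvals_mset (MD n). \<bar>l\<bar> > \<delta> #} in
                (\<forall>l \<in># eigvals_mset (MD n) - L. \<bar>l\<bar> \<le> C * real n powr (- \<tau>)) \<and>
                (\<forall>us. orthonormal_eigenvectors (MD n) L us \<longrightarrow>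
                   weighted_k_variance k (A n) us \<le> C' * real n powr (- 2 * \<tau>))))
          \<and>
            (\<forall>\<^sub>F n in sequentially. \<forall>m. 1 \<le> m \<and> m \<le> k - 1 \<longrightarrow> md_min m (A n) > \<theta>)
          \<and>
            (\<forall>\<tau>. 0 < \<tau> \<and> \<tau> < 1 / 2 \<longrightarrow>
              (\<lambda>n. md (A n) (U n ` {..<k})) \<in> O(\<lambda>n. real n powr (- \<tau>)))
          \<and>
            (\<forall>i j. i \<le> j \<and> j < k \<longrightarrow> (\<forall>\<epsilon>>0. \<forall>\<^sub>F n in sequentially. \<forall>u \<in> U n i.
              \<bar>(\<Sum>v \<in> U n j. A n $$ (u, v)) - P $$ (i, j) * real (card (U n j))\<bar> \<le> \<epsilon> * real n))
          \<and>
            (\<forall>i j. i \<le> j \<and> j < k \<longrightarrow> (\<forall>\<epsilon>>0. \<forall>\<^sub>F n in sequentially.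
              \<forall>u \<in> U n i. \<forall>v \<in> U n i. u \<noteq> v \<longrightarrow>
              \<bar>(\<Sum>t \<in> U n j. A n $$ (u, t) * A n $$ (v, t))
                 - (P $$ (i, j))\<^sup>2 * real (card (U n j))\<bar> \<le> \<epsilon> * real n))))"
proof -
  have P_sym: "P $$ (i,j) = P $$ (j,i)" if "i < k" "j < k" for i j
    using arg_cong[OF assms(5), of "\<lambda>B. B $$ (i,j)"] that assms(4) by auto
  obtain p0 where p0: "p0 > 0" "\<And>z. p0\<^sup>2 * (\<Sum>i<k. (z i)\<^sup>2) \<le> (\<Sum>i<k. (\<Sum>j<k. P $$ (i,j) * z j)\<^sup>2)"
    using full_rank_lower_bound[OF assms(4,6)] by blast
  interpret model_graph k r P p0
    by unfold_locales (use assms P_sym p0 in auto)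
  show ?thesis
  proof (rule exI[of _ \<delta>], rule exI[of _ \<theta>], intro conjI allI impI \<delta>(1,2) \<theta>(1,2), goal_cases)
    case (1 M c E)
    from AE_eventually_concentrated[OF 1] show ?case
    proof eventually_elim
      \<comment> \<open>All clauses are derived on this one event, so the quantifiers over
        \<open>\<tau>\<close>, \<open>\<epsilon>\<close> and the test graphs may stand inside the
        almost sure statement.\<close>
      case (elim \<omega>)
      show ?case unfolding Let_def
        by (intro conjI allI impI class_frequencies[OF elim] homomorphism_densities[OF elim]
          adjacency_spectrum[OF elim, unfolded Let_def] modularity_eigvals_count[OF elim]
          modularity_spectrum[OF elim, unfolded Let_def] coarse_discrepancy[OF elim]
          cluster_discrepancy[OF elim] degrees_into_classes[OF elim] codegrees_into_classes[OF elim])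
         simp_all
    qed
  qed
qed

end
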